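(* Let $(E,\omega)$ be a weighted graph and $R$ a ring. Then $L_R(E,\omega)$ is a domain if and only if $R$ is a domain and $(E,\omega)$ is either an unweighted rose with not more than one petal or an LV-rose.
   Context: A weighted graph $(E,\omega)$, $E=(E^0,E^{\mathrm{st}},E^1,s,r,\omega)$, consists of countable sets $E^0$ (vertices), $E^{\mathrm{st}}$ (structured edges), $E^1$ (edges), maps $s,r:E^{\mathrm{st}}\to E^0$ and a weight map $\omega:E^{\mathrm{st}}\to\mathbb N=\{1,2,\dots\}$ such that $E^1=\bigsqcup_{\alpha\in E^{\mathrm{st}}}\{\alpha_1,\dots,\alpha_{\omega(\alpha)}\}$. All weighted graphs are assumed row-finite: $s^{-1}(v)\subseteq E^{\mathrm{st}}$ is finite for every $v\in E^0$. A vertex $v$ is a sink if $s^{-1}(v)=\emptyset$; if $v$ is not a sink, $\omega(v):=\max\{\omega(\alpha)\mid\alpha\in s^{-1}(v)\}$. Rings of coefficients $R$ are unital. Let $(E^1)^*=\{\alpha_i^*\mid\alpha_i\in E^1\}$, $X=E^0\cup E^1\cup(E^1)^*$, and let $R\langle X\rangle$ be the free (non-unital) $R$-ring on $X$: the free left $R$-module on the nonempty words over $X$ with multiplication $(\sum r_xx)(\sum s_yy)=\sum r_xs_y\,xy$. The weighted Leavitt path algebra $L_R(E,\omega)$ is the quotient of $R\langle X\rangle$ by the ideal generated by the relations: (1) $vw=\delta_{vw}v$ for $v,w\in E^0$; (2) $s(\alpha)\alpha_i=\alpha_ir(\alpha)=\alpha_i$ and $r(\alpha)\alpha_i^*=\alpha_i^*s(\alpha)=\alpha_i^*$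 for $\alpha\in E^{\mathrm{st}}$, $1\le i\le\omega(\alpha)$; (3) $\sum_{\alpha\in s^{-1}(v)}\alpha_i\alpha_j^*=\delta_{ij}v$ for every non-sink $v$ and $1\le i,j\le\omega(v)$; (4) $\sum_{1\le i\le\max\{\omega(\alpha),\omega(\beta)\}}\alpha_i^*\beta_i=\delta_{\alpha\beta}r(\alpha)$ for all $\alpha,\beta\in E^{\mathrm{st}}$; where in (3) and (4) $\alpha_i:=\alpha_i^*:=0$ whenever $i>\omega(\alpha)$. A domain is a nonzero (not necessarily commutative) ring without zero divisors. A rose is a weighted graph with exactly one vertex, its petals being the structured edges (loops); it is unweighted if all weights equal $1$. So an unweighted rose with not more than one petal is a graph with one vertex and either no structured edge or one structured edge of weight $1$. An LV-rose is a weighted graph with $|E^0|=1$, $E^{\mathrm{st}}\ne\emptyset$, $\omega(\alpha)\ge2$ for all $\alpha\in E^{\mathrm{st}}$, and such that at least two structured edges have the maximal weight. *)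

theory Defs
  imports "HOL-Library.Countable_Set" "HOL-Algebra.QuotRing" "HOL-Algebra.Module"
begin

section \<open>Weighted graphs\<close>

record ('v, 'e) wgraph =
  verts :: "'v set"
  sedges :: "'e set"
  src :: "'e \<Rightarrow> 'v"
  tgt :: "'e \<Rightarrow> 'v"
  wt :: "'e \<Rightarrow> nat"

definition out :: "('v, 'e, 'm) wgraph_scheme \<Rightarrow> 'v \<Rightarrow> 'e set" where
  "out G v = {\<alpha> \<in> sedges G. src G \<alpha> = v}"

text \<open>
  The edge set \<open>E\<^sup>1\<close> is not a separate component: the edge \<open>\<alpha>\<^sub>i\<close> is encoded by the pair of
  a structured edge \<open>\<alpha>\<close> and an index \<open>1 \<le> i \<le> wt G \<alpha>\<close>. Row-finiteness is part of the definition.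
\<close>

locale weighted_graph =
  fixes G :: "('v, 'e, 'm) wgraph_scheme"
  assumes countable_verts: "countable (verts G)"
    and countable_sedges: "countable (sedges G)"
    and src_closed: "\<alpha> \<in> sedges G \<Longrightarrow> src G \<alpha> \<in> verts G"
    and tgt_closed: "\<alpha> \<in> sedges G \<Longrightarrow> tgt G \<alpha> \<in> verts G"
    and wt_pos: "\<alpha> \<in> sedges G \<Longrightarrow> 1 \<le> wt G \<alpha>"
    and row_finite: "v \<in> verts G \<Longrightarrow> finite (out G v)"

definition sink :: "('v, 'e, 'm) wgraph_scheme \<Rightarrow> 'v \<Rightarrow> bool" where
  "sink G v \<longleftrightarrow> out G v = {}"

definition vwt :: "('v, 'e, 'm) wgraph_scheme \<Rightarrow> 'v \<Rightarrow> nat" where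
  "vwt G v = Max (wt G ` out G v)"

definition rose :: "('v, 'e, 'm) wgraph_scheme \<Rightarrow> bool" where
  "rose G \<longleftrightarrow> card (verts G) = 1"

definition unweighted :: "('v, 'e, 'm) wgraph_scheme \<Rightarrow> bool" where
  "unweighted G \<longleftrightarrow> (\<forall>\<alpha>\<in>sedges G. wt G \<alpha> = 1)"

definition LV_rose :: "('v, 'e, 'm) wgraph_scheme \<Rightarrow> bool" where
  "LV_rose G \<longleftrightarrow>
     rose G \<and> sedges G \<noteq> {} \<and> (\<forall>\<alpha>\<in>sedges G. 2 \<le> wt G \<alpha>) \<and>
     (\<exists>\<alpha>\<in>sedges G. \<exists>\<beta>\<in>sedges G. \<alpha> \<noteq> \<beta> \<and>
        (\<forall>\<gamma>\<in>sedges G. wt G \<gamma> \<le> wt G \<alpha> \<and> wt G \<gamma> \<le> wt G \<beta>))"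


section \<open>Rings without unit, domains\<close>

text \<open>
  In HOL-Algebra a \<open>ring\<close> is unital and a \<open>domain\<close> is moreover commutative, whereas Leavitt path
  algebras over infinitely many vertices have no unit and are rarely commutative. The \<open>one\<close> field
  of the record is irrelevant below.
\<close>

locale nonunital_ring = abelian_group A for A (structure) +
  assumes m_closed: "\<lbrakk>x \<in> carrier A; y \<in> carrier A\<rbrakk> \<Longrightarrow> x \<otimes> y \<in> carrier A"
    and m_assoc: "\<lbrakk>x \<in> carrier A; y \<in> carrier A; z \<in> carrier A\<rbrakk>
          \<Longrightarrow> (x \<otimes> y) \<otimes> z = x \<otimes> (y \<otimes> z)"
    and l_distr: "\<lbrakk>x \<in> carrier A; y \<in> carrier A; z \<in> carrier A\<rbrakk>
          \<Longrightarrow> (x \<oplus> y) \<otimes> z = x \<otimes> z \<oplus> y \<otimes> z"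
    and r_distr: "\<lbrakk>x \<in> carrier A; y \<in> carrier A; z \<in> carrier A\<rbrakk>
          \<Longrightarrow> z \<otimes> (x \<oplus> y) = z \<otimes> x \<oplus> z \<otimes> y"

locale nc_domain = nonunital_ring A for A (structure) +
  assumes nonzero: "carrier A \<noteq> {\<zero>}"
    and no_zero_divisors: "\<lbrakk>x \<in> carrier A; y \<in> carrier A; x \<otimes> y = \<zero>\<rbrakk> \<Longrightarrow> x = \<zero> \<or> y = \<zero>"


section \<open>Free rings and their ideals\<close>

text \<open>
  An element \<open>\<Sum> r\<^sub>w w\<close> of the free \<open>R\<close>-ring on \<open>X\<close> is the finitely supported function \<open>w \<mapsto> r\<^sub>w\<close> on
  words, a word being a nonempty list over \<open>X\<close>. The coefficient of \<open>w\<close> in a product is obtained by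
  summing over the factorisations of \<open>w\<close> into two nonempty words. There is no unit, so the \<open>one\<close>
  field is arbitrary.
\<close>

definition free_ring :: "('a, 'm) ring_scheme \<Rightarrow> 'x set \<Rightarrow> ('a, 'x list \<Rightarrow> 'a) module" where
  "free_ring R X =
    \<lparr>carrier = {f. (\<forall>w. f w \<in> carrier R) \<and> finite {w. f w \<noteq> \<zero>\<^bsub>R\<^esub>} \<and>
                   {w. f w \<noteq> \<zero>\<^bsub>R\<^esub>} \<subseteq> lists X - {[]}},
     mult = (\<lambda>f g w. \<Oplus>\<^bsub>R\<^esub>i\<in>{1..<length w}. f (take i w) \<otimes>\<^bsub>R\<^esub> g (drop i w)),
     one = undefined,
     zero = (\<lambda>w. \<zero>\<^bsub>R\<^esub>),
     add = (\<lambda>f g w. f w \<oplus>\<^bsub>R\<^esub> g w),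
     smult = (\<lambda>c f w. c \<otimes>\<^bsub>R\<^esub> f w)\<rparr>"

definition free_gen :: "('a, 'm) ring_scheme \<Rightarrow> 'x \<Rightarrow> 'x list \<Rightarrow> 'a" where
  "free_gen R x = (\<lambda>w. if w = [x] then \<one>\<^bsub>R\<^esub> else \<zero>\<^bsub>R\<^esub>)"

text \<open>
  Ideals of an \<open>R\<close>-ring \<open>A\<close> are stable under scalars; in the absence of a unit this does not follow
  from stability under multiplication by elements of \<open>A\<close>. Left scalars suffice for the ideals below, as
  they are generated by elements whose coefficients are central in \<open>R\<close>.
\<close>

definition R_ideal :: "('a, 'm) ring_scheme \<Rightarrow> ('a, 'b, 'n) module_scheme \<Rightarrow> 'b set \<Rightarrow> bool" where
  "R_ideal R A I \<longleftrightarrow>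
     additive_subgroup I A \<and>
     (\<forall>x\<in>carrier A. \<forall>a\<in>I. x \<otimes>\<^bsub>A\<^esub> a \<in> I \<and> a \<otimes>\<^bsub>A\<^esub> x \<in> I) \<and>
     (\<forall>c\<in>carrier R. \<forall>a\<in>I. c \<odot>\<^bsub>A\<^esub> a \<in> I)"

definition gen_R_ideal :: "('a, 'm) ring_scheme \<Rightarrow> ('a, 'b, 'n) module_scheme \<Rightarrow> 'b set \<Rightarrow> 'b set" where
  "gen_R_ideal R A S = \<Inter>{I. R_ideal R A I \<and> S \<subseteq> I}"


section \<open>Weighted Leavitt path algebras\<close>

datatype ('v, 'e) letter = Vertex 'v | Edge 'e nat | Ghost 'e nat

definition letters :: "('v, 'e, 'm) wgraph_scheme \<Rightarrow> ('v, 'e) letter set" where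
  "letters G = Vertex ` verts G
     \<union> {Edge \<alpha> i | \<alpha> i. \<alpha> \<in> sedges G \<and> i \<in> {1..wt G \<alpha>}}
     \<union> {Ghost \<alpha> i | \<alpha> i. \<alpha> \<in> sedges G \<and> i \<in> {1..wt G \<alpha>}}"

context
  fixes R :: "('a, 'm) ring_scheme" and G :: "('v, 'e, 'n) wgraph_scheme"
begin

abbreviation wlpa_free :: "('a, ('v, 'e) letter list \<Rightarrow> 'a) module" (\<open>F\<close>) where
  "wlpa_free \<equiv> free_ring R (letters G)"

definition vertex_elt :: "'v \<Rightarrow> ('v, 'e) letter list \<Rightarrow> 'a" where
  "vertex_elt v = free_gen R (Vertex v)"

definition edge_elt :: "'e \<Rightarrow> nat \<Rightarrow> ('v, 'e) letter list \<Rightarrow> 'a" where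
  "edge_elt \<alpha> i = (if i \<le> wt G \<alpha> then free_gen R (Edge \<alpha> i) else \<zero>\<^bsub>F\<^esub>)"

definition ghost_elt :: "'e \<Rightarrow> nat \<Rightarrow> ('v, 'e) letter list \<Rightarrow> 'a" where
  "ghost_elt \<alpha> i = (if i \<le> wt G \<alpha> then free_gen R (Ghost \<alpha> i) else \<zero>\<^bsub>F\<^esub>)"

text \<open>The defining relations \<open>l = r\<close>, each represented by the element \<open>l \<ominus> r\<close> of the free ring.\<close>

definition vertex_rels :: "(('v, 'e) letter list \<Rightarrow> 'a) set" where
  "vertex_rels =
     {vertex_elt v \<otimes>\<^bsub>F\<^esub> vertex_elt w \<ominus>\<^bsub>F\<^esub> (if v = w then vertex_elt v else \<zero>\<^bsub>F\<^esub>)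
      | v w. v \<in> verts G \<and> w \<in> verts G}"

definition path_rels :: "(('v, 'e) letter list \<Rightarrow> 'a) set" where
  "path_rels =
     (\<Union>\<alpha>\<in>sedges G. \<Union>i\<in>{1..wt G \<alpha>}.
       {vertex_elt (src G \<alpha>) \<otimes>\<^bsub>F\<^esub> edge_elt \<alpha> i \<ominus>\<^bsub>F\<^esub> edge_elt \<alpha> i,
        edge_elt \<alpha> i \<otimes>\<^bsub>F\<^esub> vertex_elt (tgt G \<alpha>) \<ominus>\<^bsub>F\<^esub> edge_elt \<alpha> i,
        vertex_elt (tgt G \<alpha>) \<otimes>\<^bsub>F\<^esub> ghost_elt \<alpha> i \<ominus>\<^bsub>F\<^esub> ghost_elt \<alpha> i,
        ghost_elt \<alpha> i \<otimes>\<^bsub>F\<^esub> vertex_elt (src G \<alpha>) \<ominus>\<^bsub>F\<^esub> ghost_elt \<alpha> i})"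

definition row_rels :: "(('v, 'e) letter list \<Rightarrow> 'a) set" where
  "row_rels =
     {(\<Oplus>\<^bsub>F\<^esub>\<alpha>\<in>out G v. edge_elt \<alpha> i \<otimes>\<^bsub>F\<^esub> ghost_elt \<alpha> j)
        \<ominus>\<^bsub>F\<^esub> (if i = j then vertex_elt v else \<zero>\<^bsub>F\<^esub>)
      | v i j. v \<in> verts G \<and> \<not> sink G v \<and> i \<in> {1..vwt G v} \<and> j \<in> {1..vwt G v}}"

definition column_rels :: "(('v, 'e) letter list \<Rightarrow> 'a) set" where
  "column_rels =
     {(\<Oplus>\<^bsub>F\<^esub>i\<in>{1..max (wt G \<alpha>) (wt G \<beta>)}. ghost_elt \<alpha> i \<otimes>\<^bsub>F\<^esub> edge_elt \<beta> i)
        \<ominus>\<^bsub>F\<^esub> (if \<alpha> = \<beta> then vertex_elt (tgt G \<alpha>) else \<zero>\<^bsub>F\<^esub>)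
      | \<alpha> \<beta>. \<alpha> \<in> sedges G \<and> \<beta> \<in> sedges G}"

definition wlpa :: "(('v, 'e) letter list \<Rightarrow> 'a) set ring" where
  "wlpa = F Quot (gen_R_ideal R F (vertex_rels \<union> path_rels \<union> row_rels \<union> column_rels))"

end

end

theory Submission
  imports Defs "HOL-Library.Poly_Mapping"
begin

text \<open>
  The algebra acts on the free module on the normal words, the words without factors
  \<open>\<alpha>\<^sub>i \<alpha>\<^sub>j\<^sup>*\<close> (\<open>\<alpha>\<close> a fixed edge of maximal weight at its source) and \<open>\<alpha>\<^sub>1\<^sup>* \<beta>\<^sub>1\<close>; the matrix entries of the
  letters are integers. In particular vertices, edges and ghost edges have no annihilator in \<open>R\<close>.

  If the algebra is a domain, then there is a single vertex, as \<open>v w = 0\<close> for distinct vertices, and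
  \<open>R\<close> is a domain, as \<open>(r v) (s v) = (r s) v\<close>. If \<open>\<alpha>\<close> has weight \<open>1\<close> and \<open>\<beta>\<close> is another edge, then
  \<open>\<alpha>\<^sub>1\<^sup>* \<beta>\<^sub>1 = 0\<close>. If \<open>\<alpha>\<close> is the only edge of the maximal weight \<open>n \<ge> 2\<close>, then \<open>\<alpha>\<^sub>n \<alpha>\<^sub>1\<^sup>* = 0\<close>.

  Conversely, over a rose the normal words span the algebra, so that they form a basis. It suffices that
  for finite nonempty sets \<open>A\<close>, \<open>B\<close> of normal words some word has coefficient \<open>\<plusminus>1\<close> in exactly one of
  the products \<open>p q\<close> with \<open>p \<in> A\<close>, \<open>q \<in> B\<close>, and \<open>0\<close> in the others. For an LV-rose such a word occurs
  among the longest words in the products of the longest elements of \<open>A\<close> and \<open>B\<close>; for a single loop of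
  weight \<open>1\<close> the normal words are the powers of an invertible element.
\<close>

section \<open>Normal words\<close>

text \<open>The difficulty is that no combination of normal words may collapse in the quotient.
  Instead of proving a rewriting system terminating and confluent, the outcome of one rewriting step
  is declared to be the action of a letter, and the defining relations are verified for it. The
  solved terms are chosen so that every relation has one: the special edge carries all indices of
  the row relations at its source, and index 1 occurs on every edge. The two kinds of redexes
  overlap in just two patterns, \<open>Edge \<alpha> i, Ghost \<alpha> 1, Edge \<beta> 1\<close> and
  \<open>Ghost \<alpha> 1, Edge \<beta> 1, Ghost \<beta> j\<close>, where the edge next to its own
  ghost is special; each is resolved by exchanging two finite sums. A product of normal words may
  have several longest words, all equally good, so there is no single leading word to compare. Hence
  the search for a word that exactly one product reaches, with a coefficient that stays invertible
  over every coefficient ring.\<close>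

abbreviation lookup :: "('x \<Rightarrow>\<^sub>0 int) \<Rightarrow> 'x \<Rightarrow> int" where
  "lookup \<equiv> Poly_Mapping.lookup"

abbreviation keys :: "('x \<Rightarrow>\<^sub>0 int) \<Rightarrow> 'x set" where
  "keys \<equiv> Poly_Mapping.keys"

fun first_vertex :: "('v, 'e, 'm) wgraph_scheme \<Rightarrow> ('v, 'e) letter list \<Rightarrow> 'v" where
  "first_vertex G (Vertex v # u) = v"
| "first_vertex G (Edge \<alpha> i # u) = src G \<alpha>"
| "first_vertex G (Ghost \<alpha> i # u) = tgt G \<alpha>"
| "first_vertex G [] = undefined"

fun last_vertex :: "('v, 'e, 'm) wgraph_scheme \<Rightarrow> ('v, 'e) letter \<Rightarrow> 'v" where
  "last_vertex G (Vertex v) = v"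
| "last_vertex G (Edge \<alpha> i) = tgt G \<alpha>"
| "last_vertex G (Ghost \<alpha> i) = src G \<alpha>"

text \<open>A row relation at \<open>v\<close> involves indices up to \<open>vwt G v\<close>. Only
  an edge of maximal weight is sure to contribute a term for all of them, so this is the edge whose
  term can be eliminated; among several such edges the choice is arbitrary.\<close>

definition special :: "('v, 'e, 'm) wgraph_scheme \<Rightarrow> 'v \<Rightarrow> 'e" where
  "special G v = (SOME \<alpha>. \<alpha> \<in> out G v \<and> (\<forall>\<beta>\<in>out G v. wt G \<beta> \<le> wt G \<alpha>))"

text \<open>These are the pairs of letters eliminated by the relations: the term at the special edge
  for all indices of a row relation, and the term with index 1 for all pairs of edges of a column
  relation. Sources need not be compared in the second case, since normal words only contain
  composable letters.\<close>

fun redex :: "('v, 'e, 'm) wgraph_scheme \<Rightarrow> ('v, 'e) letter \<Rightarrow> ('v, 'e) letter list \<Rightarrow> bool" where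
  "redex G (Edge \<alpha> i) (Ghost \<beta> j # u) \<longleftrightarrow> \<alpha> = \<beta> \<and> \<alpha> = special G (src G \<alpha>)"
| "redex G (Ghost \<alpha> i) (Edge \<beta> j # u) \<longleftrightarrow> i = 1 \<and> j = 1"
| "redex G _ _ \<longleftrightarrow> False"

text \<open>
  Every normal word ends with its final vertex. So the empty path at each vertex is represented by a
  nonempty word, and left multiplication by an edge or a ghost edge only prepends a letter.
\<close>

fun normal_word :: "('v, 'e, 'm) wgraph_scheme \<Rightarrow> ('v, 'e) letter list \<Rightarrow> bool" where
  "normal_word G [] \<longleftrightarrow> False"
| "normal_word G (Vertex v # u) \<longleftrightarrow> v \<in> verts G \<and> u = []"
| "normal_word G (x # u) \<longleftrightarrow> x \<in> letters G \<and> first_vertex G u = last_vertex G x \<and> normal_word G u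
     \<and> \<not> redex G x u"

lemma not_in_range_Vertex [simp]: "Edge \<alpha> i \<notin> range Vertex" "Ghost \<alpha> i \<notin> range Vertex"
  by auto

text \<open>
  If \<open>x # q\<close> is not normal although \<open>q\<close> is, then one application of a row relation
  \<open>\<Sum>\<gamma>. \<gamma>\<^sub>i \<gamma>\<^sub>j\<^sup>* = \<delta>\<^sub>i\<^sub>j v\<close>, solved for its term at the special edge, or of a column relation
  \<open>\<Sum>k. \<alpha>\<^sub>k\<^sup>* \<beta>\<^sub>k = \<delta>\<^sub>\<alpha>\<^sub>\<beta> r(\<alpha>)\<close>, solved for its term at \<open>k = 1\<close>, already yields normal words.
\<close>

fun letter_op :: "('v, 'e, 'm) wgraph_scheme \<Rightarrow> ('v, 'e) letter \<Rightarrow> ('v, 'e) letter list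
    \<Rightarrow> ('v, 'e) letter list \<Rightarrow>\<^sub>0 int" where
  "letter_op G (Vertex v) q = (if first_vertex G q = v then frag_of q else 0)"
| "letter_op G (Edge \<alpha> i) q =
    (if 1 \<le> i \<and> i \<le> wt G \<alpha> \<and> first_vertex G q = tgt G \<alpha> then
       if redex G (Edge \<alpha> i) q then
         (case q of Ghost \<beta> j # r \<Rightarrow>
           (if i = j then frag_of r else 0) -
           (\<Sum>\<gamma>\<in>out G (src G \<alpha>) - {\<alpha>}. if i \<le> wt G \<gamma> \<and> j \<le> wt G \<gamma>
              then frag_of (Edge \<gamma> i # Ghost \<gamma> j # r) else 0) | _ \<Rightarrow> 0)
       else frag_of (Edge \<alpha> i # q)
     else 0)"
| "letter_op G (Ghost \<alpha> i) q =
    (if 1 \<le> i \<and> i \<le> wt G \<alpha> \<and> first_vertex G q = src G \<alpha> then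
       if redex G (Ghost \<alpha> i) q then
         (case q of Edge \<beta> j # r \<Rightarrow>
           (if \<alpha> = \<beta> then frag_of r else 0) -
           (\<Sum>k\<in>{2..min (wt G \<alpha>) (wt G \<beta>)}. frag_of (Ghost \<alpha> k # Edge \<beta> k # r)) | _ \<Rightarrow> 0)
       else frag_of (Ghost \<alpha> i # q)
     else 0)"

fun word_op :: "('v, 'e, 'm) wgraph_scheme \<Rightarrow> ('v, 'e) letter list
    \<Rightarrow> (('v, 'e) letter list \<Rightarrow>\<^sub>0 int) \<Rightarrow> ('v, 'e) letter list \<Rightarrow>\<^sub>0 int" where
  "word_op G [] z = z"
| "word_op G (x # p) z = frag_extend (letter_op G x) (word_op G p z)"

lemma frag_extend_if: "frag_extend f (if b then x else 0) = (if b then frag_extend f x else 0)"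
  by simp

lemma frag_extend_sum': "finite I \<Longrightarrow> frag_extend f (\<Sum>i\<in>I. g i) = (\<Sum>i\<in>I. frag_extend f (g i))"
  by (simp add: frag_extend_sum o_def)

lemma word_op_append: "word_op G (p @ p') z = word_op G p (word_op G p' z)"
  by (induction p) auto

lemma word_op_add: "word_op G p (x + y) = word_op G p x + word_op G p y"
  by (induction p) (auto simp: frag_extend_add)

lemma word_op_0 [simp]: "word_op G p 0 = 0"
  by (induction p) auto

text \<open>Linearity makes the action computable from the images of single words, so that the
  action of a concatenation becomes a sum over intermediate words.\<close>

lemma word_op_frag_extend: "word_op G p z = frag_extend (\<lambda>w. word_op G p (frag_of w)) z"
proof (induction p)
  case Nil
  show ?case by (simp flip: frag_expansion)
next
  case (Cons x p)
  have "word_op G (x # p) z = frag_extend (letter_op G x) (frag_extend (\<lambda>w. word_op G p (frag_of w)) z)"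
    unfolding word_op.simps by (subst Cons.IH) (rule refl)
  also have "\<dots> = frag_extend (\<lambda>w. word_op G (x # p) (frag_of w)) z"
    unfolding frag_extend_def[of _ z] by (simp add: frag_extend_sum' frag_extend_cmul)
  finally show ?case .
qed

lemma letters_simps [simp]:
  "Vertex v \<in> letters G \<longleftrightarrow> v \<in> verts G"
  "Edge \<alpha> i \<in> letters G \<longleftrightarrow> \<alpha> \<in> sedges G \<and> 1 \<le> i \<and> i \<le> wt G \<alpha>"
  "Ghost \<alpha> i \<in> letters G \<longleftrightarrow> \<alpha> \<in> sedges G \<and> 1 \<le> i \<and> i \<le> wt G \<alpha>"
  by (auto simp: letters_def)

context weighted_graph
begin

section \<open>Edges of maximal weight and the words produced by one letter\<close>

lemma finite_out: "finite (out G v)"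
proof (cases "v \<in> verts G")
  case True then show ?thesis by (rule row_finite)
next
  case False
  then have "out G v = {}" using src_closed by (auto simp: out_def)
  then show ?thesis by simp
qed

lemma special:
  assumes "out G v \<noteq> {}"
  shows "special G v \<in> out G v" "\<beta> \<in> out G v \<Longrightarrow> wt G \<beta> \<le> wt G (special G v)"
    "wt G (special G v) = vwt G v"
proof -
  have "Max (wt G ` out G v) \<in> wt G ` out G v"
    using finite_out assms by (intro Max_in) auto
  then obtain \<alpha> where "\<alpha> \<in> out G v" "wt G \<alpha> = Max (wt G ` out G v)" by auto
  then have "\<exists>\<alpha>. \<alpha> \<in> out G v \<and> (\<forall>\<beta>\<in>out G v. wt G \<beta> \<le> wt G \<alpha>)"
    using finite_out by (metis Max_ge finite_imageI imageI)
  then have *: "special G v \<in> out G v \<and> (\<forall>\<beta>\<in>out G v. wt G \<beta> \<le> wt G (special G v))"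
    unfolding special_def by (rule someI_ex)
  then show "special G v \<in> out G v" "\<beta> \<in> out G v \<Longrightarrow> wt G \<beta> \<le> wt G (special G v)" by auto
  show "wt G (special G v) = vwt G v"
    unfolding vwt_def using * finite_out by (intro Max_eqI[symmetric]) auto
qed

lemma letter_op_normal:
  assumes "normal_word G (x # u)" "x \<notin> range Vertex"
  shows "letter_op G x u = frag_of (x # u)"
  using assms by (cases x) auto

lemma redex_EdgeE:
  assumes "redex G (Edge \<alpha> i) q"
  obtains j r where "q = Ghost \<alpha> j # r" "\<alpha> = special G (src G \<alpha>)"
  using assms by (cases q; cases "hd q") auto

lemma redex_GhostE:
  assumes "redex G (Ghost \<alpha> i) q"
  obtains \<beta> r where "q = Edge \<beta> 1 # r" "i = 1"
  using assms by (cases q; cases "hd q") auto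

lemma redex_Edge_index: "redex G (Edge \<alpha> i) r = redex G (Edge \<alpha> j) r"
  by (cases r; cases "hd r") auto

lemma redex_Ghost_edge: "redex G (Ghost \<alpha> i) r = redex G (Ghost \<beta> i) r"
  by (cases r; cases "hd r") auto

text \<open>Preservation of normality and the bound on lengths both depend only on the shape of the
  words that can occur. Sorting these by origin leaves six shapes, and the sums in
  \<open>letter_op\<close> need not be opened again for either purpose.\<close>

lemma keys_letter_op_cases:
  assumes x: "x \<in> letters G" and w: "w \<in> keys (letter_op G x q)"
  obtains (vertex) "x \<in> range Vertex" "first_vertex G q = first_vertex G [x]" "w = q"
    | (cons) "x \<notin> range Vertex" "first_vertex G q = last_vertex G x" "\<not> redex G x q" "w = x # q"
    | (edge) \<alpha> i j r where "x = Edge \<alpha> i" "q = Ghost \<alpha> j # r" "w = r"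
    | (edges) \<alpha> i j r \<gamma> where "x = Edge \<alpha> i" "q = Ghost \<alpha> j # r" "\<alpha> = special G (src G \<alpha>)"
      "\<gamma> \<in> out G (src G \<alpha>)" "\<gamma> \<noteq> \<alpha>" "i \<le> wt G \<gamma>" "j \<le> wt G \<gamma>" "w = Edge \<gamma> i # Ghost \<gamma> j # r"
    | (ghost) \<alpha> r where "x = Ghost \<alpha> 1" "q = Edge \<alpha> 1 # r" "w = r"
    | (ghosts) \<alpha> \<beta> r k where "x = Ghost \<alpha> 1" "q = Edge \<beta> 1 # r" "src G \<beta> = src G \<alpha>"
      "2 \<le> k" "k \<le> wt G \<alpha>" "k \<le> wt G \<beta>" "w = Ghost \<alpha> k # Edge \<beta> k # r"
proof (cases "x \<in> range Vertex")
  case True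
  then obtain v where "x = Vertex v" by (rule imageE)
  then show ?thesis using vertex w by (auto split: if_splits)
next
  case nv: False
  show ?thesis
  proof (cases "redex G x q")
    case False
    then have "letter_op G x q = (if first_vertex G q = last_vertex G x then frag_of (x # q) else 0)"
      using x nv by (cases x) auto
    with w have "w = x # q" "first_vertex G q = last_vertex G x"
      by (simp_all split: if_splits del: letter_op.simps)
    then show ?thesis using cons nv False by blast
  next
    case True
    have fv: "first_vertex G q = last_vertex G x" using w nv by (cases x) (auto split: if_splits)
    show ?thesis
    proof (cases x)
      case (Edge \<alpha> i)
      then obtain j r where r: "q = Ghost \<alpha> j # r" "\<alpha> = special G (src G \<alpha>)"
        using True by (blast elim: redex_EdgeE)
      let ?f = "\<lambda>\<gamma>. if i \<le> wt G \<gamma> \<and> j \<le> wt G \<gamma> then frag_of (Edge \<gamma> i # Ghost \<gamma> j # r) else 0"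
      let ?O = "out G (src G \<alpha>) - {\<alpha>}"
      have "letter_op G x q = (if i = j then frag_of r else 0) - sum ?f ?O"
        using True fv x Edge r by auto
      with w have "w \<in> keys ((if i = j then frag_of r else 0) - sum ?f ?O)" by (simp only:)
      then have "w \<in> keys (if i = j then frag_of r else 0) \<or> (\<exists>\<gamma>\<in>?O. w \<in> keys (?f \<gamma>))"
        using keys_diff[of "if i = j then frag_of r else 0" "sum ?f ?O"] keys_sum[of ?f ?O] by blast
      then show ?thesis
      proof (elim disjE bexE)
        assume "w \<in> keys (if i = j then frag_of r else 0)"
        then have "w = r" by (auto split: if_splits)
        then show ?thesis using edge Edge r(1) by blast
      next
        fix \<gamma> assume "\<gamma> \<in> ?O" "w \<in> keys (?f \<gamma>)"
        then show ?thesis using edges[OF Edge r] by (auto split: if_splits)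
      qed
    next
      case (Ghost \<alpha> i)
      then obtain \<beta> r where r: "q = Edge \<beta> 1 # r" "i = 1" using True by (blast elim: redex_GhostE)
      let ?f = "\<lambda>k. frag_of (Ghost \<alpha> k # Edge \<beta> k # r)"
      let ?K = "{2..min (wt G \<alpha>) (wt G \<beta>)}"
      have "letter_op G x q = (if \<alpha> = \<beta> then frag_of r else 0) - sum ?f ?K"
        using True fv x Ghost r by auto
      with w have "w \<in> keys ((if \<alpha> = \<beta> then frag_of r else 0) - sum ?f ?K)" by (simp only:)
      then have "w \<in> keys (if \<alpha> = \<beta> then frag_of r else 0) \<or> (\<exists>k\<in>?K. w \<in> keys (?f k))"
        using keys_diff[of "if \<alpha> = \<beta> then frag_of r else 0" "sum ?f ?K"] keys_sum[of ?f ?K] by blast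
      then show ?thesis
      proof (elim disjE bexE)
        assume "w \<in> keys (if \<alpha> = \<beta> then frag_of r else 0)"
        then have "w = r" "\<alpha> = \<beta>" by (auto split: if_splits)
        then show ?thesis using ghost Ghost r by blast
      next
        fix k assume "k \<in> ?K" "w \<in> keys (?f k)"
        then show ?thesis using ghosts[of \<alpha> \<beta> r k] Ghost r fv by auto
      qed
    qed (use nv in auto)
  qed
qed

text \<open>One rewriting step never creates a new redex. A new edge \<gamma> is not special and a
  new index \<open>k\<close> is at least 2, so the new pair is irreducible. Its second letter meets
  \<open>r\<close> as the old one did, because a redex starting with an edge ignores the index and
  one starting with a ghost edge ignores the edge.\<close>

lemma keys_letter_op:
  assumes q: "normal_word G q" and x: "x \<in> letters G" and w: "w \<in> keys (letter_op G x q)"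
  shows "normal_word G w \<and> first_vertex G w = first_vertex G (x # u)"
  using x w
proof (cases rule: keys_letter_op_cases)
  case vertex
  then show ?thesis using q by auto
next
  case cons
  then show ?thesis using q x by (cases x) auto
next
  case (edges \<alpha> i j r \<gamma>)
  have "\<not> redex G (Ghost \<gamma> j) r" using q edges redex_Ghost_edge[of \<gamma> j r \<alpha>] by auto
  then show ?thesis using edges q x by (auto simp: out_def)
next
  case (ghosts \<alpha> \<beta> r k)
  have "\<not> redex G (Edge \<beta> k) r" using q ghosts redex_Edge_index[of \<beta> k r 1] by auto
  then show ?thesis using ghosts q x by auto
qed (use q in auto)

lemma length_letter_op:
  assumes "w \<in> keys (letter_op G x q)" "x \<in> letters G"
  shows "length w \<le> length q + (if x \<in> range Vertex then 0 else 1)"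
  using assms(2,1) by (cases rule: keys_letter_op_cases) auto

lemma keys_word_op:
  assumes "set p \<subseteq> letters G" "\<And>w. w \<in> keys z \<Longrightarrow> normal_word G w"
    "w \<in> keys (word_op G p z)"
  shows "normal_word G w"
  using assms
proof (induction p arbitrary: w)
  case (Cons x p)
  then obtain w' where "w' \<in> keys (word_op G p z)" "w \<in> keys (letter_op G x w')"
    using keys_frag_extend by fastforce
  then show ?case using Cons keys_letter_op[of w' x w] by auto
qed auto

section \<open>The action satisfies the defining relations\<close>

lemma vertex_vertex_op:
  "frag_extend (letter_op G (Vertex v)) (letter_op G (Vertex w) q) =
   (if v = w then letter_op G (Vertex v) q else 0)"
  by auto

lemma op_last_vertex:
  assumes "x \<in> letters G"
  shows "frag_extend (letter_op G x) (letter_op G (Vertex (last_vertex G x)) q) = letter_op G x q"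
  using assms by (cases x) auto

text \<open>All words in \<open>letter_op G x q\<close> start where \<open>x\<close> starts, so the
  vertex fixes each of them.\<close>

lemma op_first_vertex:
  assumes "x \<in> letters G" "normal_word G q"
  shows "frag_extend (letter_op G (Vertex (first_vertex G [x]))) (letter_op G x q) = letter_op G x q"
proof -
  have "frag_extend (letter_op G (Vertex (first_vertex G [x]))) (letter_op G x q) =
    frag_extend frag_of (letter_op G x q)"
    using keys_letter_op[OF assms(2,1), where u = "[]"] by (intro frag_extend_eq) auto
  then show ?thesis by (simp flip: frag_expansion)
qed

text \<open>The term at the special edge was defined as the right-hand side minus all other terms,
  so the others cancel.\<close>

lemma sum_edge_ghost:
  assumes "out G v \<noteq> {}" "first_vertex G r = v" "1 \<le> i" "i \<le> vwt G v" "1 \<le> j" "j \<le> vwt G v"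
  shows "(\<Sum>\<alpha>\<in>out G v. if j \<le> wt G \<alpha> then letter_op G (Edge \<alpha> i) (Ghost \<alpha> j # r) else 0) =
    (if i = j then frag_of r else 0)"
proof -
  let ?s = "special G v"
  have s: "?s \<in> out G v" "wt G ?s = vwt G v" using special assms by auto
  have ss: "src G ?s = v" using s by (auto simp: out_def)
  have 1: "letter_op G (Edge ?s i) (Ghost ?s j # r) = (if i = j then frag_of r else 0) -
           (\<Sum>\<gamma>\<in>out G v - {?s}. if i \<le> wt G \<gamma> \<and> j \<le> wt G \<gamma>
              then frag_of (Edge \<gamma> i # Ghost \<gamma> j # r) else 0)"
    using assms s ss by simp
  have 2: "(\<Sum>\<alpha>\<in>out G v - {?s}. if j \<le> wt G \<alpha> then letter_op G (Edge \<alpha> i) (Ghost \<alpha> j # r) else 0)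
    = (\<Sum>\<gamma>\<in>out G v - {?s}. if i \<le> wt G \<gamma> \<and> j \<le> wt G \<gamma>
              then frag_of (Edge \<gamma> i # Ghost \<gamma> j # r) else 0)"
    using assms by (intro sum.cong) (auto simp: out_def)
  show ?thesis
    unfolding sum.remove[OF finite_out s(1)] 2 using 1 s assms by simp
qed

text \<open>Here the term with index 1 plays the role of the special edge. If the sources differ, no
  term survives, and then the edges differ as well.\<close>

lemma sum_ghost_edge:
  assumes "first_vertex G r = tgt G \<beta>" "1 \<le> wt G \<alpha>" "1 \<le> wt G \<beta>"
  shows "(\<Sum>i\<in>{1..wt G \<beta>}. letter_op G (Ghost \<alpha> i) (Edge \<beta> i # r)) =
    (if \<alpha> = \<beta> then frag_of r else 0)"
proof (cases "src G \<alpha> = src G \<beta>")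
  case False
  then show ?thesis by auto
next
  case True
  have "(\<Sum>i\<in>{1..wt G \<beta>}. letter_op G (Ghost \<alpha> i) (Edge \<beta> i # r)) =
     letter_op G (Ghost \<alpha> 1) (Edge \<beta> 1 # r) +
     (\<Sum>i\<in>{Suc 1..wt G \<beta>}. letter_op G (Ghost \<alpha> i) (Edge \<beta> i # r))"
    by (rule sum.atLeast_Suc_atMost) (use assms in simp)
  also have "(\<Sum>i\<in>{Suc 1..wt G \<beta>}. letter_op G (Ghost \<alpha> i) (Edge \<beta> i # r)) =
     (\<Sum>i\<in>{2..min (wt G \<alpha>) (wt G \<beta>)}. frag_of (Ghost \<alpha> i # Edge \<beta> i # r))"
    using True by (intro sum.mono_neutral_cong_right) auto
  finally show ?thesis using True assms by simp
qed

text \<open>If the ghost letter is only prepended, the sum is that of \<open>sum_edge_ghost\<close>.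
  The other case is the overlap with a column redex: there \<open>j = 1\<close> and \<open>q\<close>
  starts with \<open>Edge \<beta> 1\<close>, and the ghost letter produces a second sum, over an
  index \<open>k\<close>. Exchanging it with the sum over edges turns it into a family of row
  relations.\<close>

lemma row_op:
  assumes v: "out G v \<noteq> {}" "1 \<le> i" "i \<le> vwt G v" "1 \<le> j" "j \<le> vwt G v" and q: "normal_word G q"
  shows "(\<Sum>\<alpha>\<in>out G v. frag_extend (letter_op G (Edge \<alpha> i)) (letter_op G (Ghost \<alpha> j) q)) =
    (if i = j then letter_op G (Vertex v) q else 0)"
proof (cases "first_vertex G q = v")
  case False
  then have "letter_op G (Ghost \<alpha> j) q = 0" if "\<alpha> \<in> out G v" for \<alpha>
    using that by (auto simp: out_def)
  then show ?thesis using False by simp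
next
  case fv: True
  show ?thesis
  proof (cases "\<exists>\<alpha>. redex G (Ghost \<alpha> j) q")
    case False
    then have "letter_op G (Ghost \<alpha> j) q = (if j \<le> wt G \<alpha> then frag_of (Ghost \<alpha> j # q) else 0)"
      if "\<alpha> \<in> out G v" for \<alpha>
      using that fv v by (auto simp: out_def)
    then have "(\<Sum>\<alpha>\<in>out G v. frag_extend (letter_op G (Edge \<alpha> i)) (letter_op G (Ghost \<alpha> j) q)) =
      (\<Sum>\<alpha>\<in>out G v. if j \<le> wt G \<alpha> then letter_op G (Edge \<alpha> i) (Ghost \<alpha> j # q) else 0)"
      by (intro sum.cong) (simp_all del: letter_op.simps)
    also have "\<dots> = (if i = j then frag_of q else 0)"
      using sum_edge_ghost assms fv by auto
    finally show ?thesis using fv by simp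
  next
    case True
    then obtain \<beta> r where r: "q = Edge \<beta> 1 # r" "j = 1" by (blast elim: redex_GhostE)
    have b: "\<beta> \<in> out G v" "first_vertex G r = tgt G \<beta>" using q r fv by (auto simp: out_def)
    have "letter_op G (Ghost \<alpha> j) q = (if \<alpha> = \<beta> then frag_of r else 0) -
        (\<Sum>k\<in>{2..wt G \<beta>}. if k \<le> wt G \<alpha> then frag_of (Ghost \<alpha> k # Edge \<beta> k # r) else 0)"
      if "\<alpha> \<in> out G v" for \<alpha>
    proof -
      have "(\<Sum>k\<in>{2..min (wt G \<alpha>) (wt G \<beta>)}. frag_of (Ghost \<alpha> k # Edge \<beta> k # r)) =
        (\<Sum>k\<in>{2..wt G \<beta>}. if k \<le> wt G \<alpha> then frag_of (Ghost \<alpha> k # Edge \<beta> k # r) else 0 :: _ \<Rightarrow>\<^sub>0 int)"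
        by (intro sum.mono_neutral_cong_left) auto
      then show ?thesis
        using that fv r wt_pos[of \<alpha>] by (auto simp: out_def)
    qed
    then have "(\<Sum>\<alpha>\<in>out G v. frag_extend (letter_op G (Edge \<alpha> i)) (letter_op G (Ghost \<alpha> j) q)) =
      (\<Sum>\<alpha>\<in>out G v. (if \<alpha> = \<beta> then letter_op G (Edge \<alpha> i) r else 0) -
        (\<Sum>k\<in>{2..wt G \<beta>}. if k \<le> wt G \<alpha> then letter_op G (Edge \<alpha> i) (Ghost \<alpha> k # Edge \<beta> k # r) else 0))"
      by (intro sum.cong) (simp_all add: frag_extend_diff frag_extend_sum' frag_extend_if del: letter_op.simps cong: if_cong)
    also have "\<dots> = letter_op G (Edge \<beta> i) r - (\<Sum>\<alpha>\<in>out G v. \<Sum>k\<in>{2..wt G \<beta>}.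
        if k \<le> wt G \<alpha> then letter_op G (Edge \<alpha> i) (Ghost \<alpha> k # Edge \<beta> k # r) else 0)"
      using b finite_out by (simp add: sum_subtractf del: letter_op.simps)
    also have "(\<Sum>\<alpha>\<in>out G v. \<Sum>k\<in>{2..wt G \<beta>}.
        if k \<le> wt G \<alpha> then letter_op G (Edge \<alpha> i) (Ghost \<alpha> k # Edge \<beta> k # r) else 0) =
      (\<Sum>k\<in>{2..wt G \<beta>}. \<Sum>\<alpha>\<in>out G v.
        if k \<le> wt G \<alpha> then letter_op G (Edge \<alpha> i) (Ghost \<alpha> k # Edge \<beta> k # r) else 0)"
      by (rule sum.swap)
    \<comment> \<open>For fixed \<open>k\<close> the inner sum is the row relation with indices
      \<open>i\<close> and \<open>k\<close>, applied to the word
      \<open>Edge \<beta> k # r\<close>.\<close>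
    also have "\<dots> = (\<Sum>k\<in>{2..wt G \<beta>}. if i = k then frag_of (Edge \<beta> k # r) else 0)"
    proof (rule sum.cong)
      fix k assume k: "k \<in> {2..wt G \<beta>}"
      have "k \<le> vwt G v" using special(2)[OF v(1) b(1)] special(3)[OF v(1)] k by simp
      then show "(\<Sum>\<alpha>\<in>out G v. if k \<le> wt G \<alpha> then letter_op G (Edge \<alpha> i) (Ghost \<alpha> k # Edge \<beta> k # r) else 0)
        = (if i = k then frag_of (Edge \<beta> k # r) else 0)"
        using k b v by (intro sum_edge_ghost) (auto simp: out_def)
    qed simp
    also have "\<dots> = (if 2 \<le> i \<and> i \<le> wt G \<beta> then frag_of (Edge \<beta> i # r) else 0)"
      by simp
    also have "letter_op G (Edge \<beta> i) r = (if i \<le> wt G \<beta> then frag_of (Edge \<beta> i # r) else 0)"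
      using q r b v redex_Edge_index[of \<beta> i r 1] by auto
    \<comment> \<open>The sum starts at 2, so the difference is nonzero only for
      \<open>i = 1\<close>, where it is the word \<open>q\<close>; and \<open>j\<close> is 1 in this
      case.\<close>
    also have "(if i \<le> wt G \<beta> then frag_of (Edge \<beta> i # r) else 0) -
        (if 2 \<le> i \<and> i \<le> wt G \<beta> then frag_of (Edge \<beta> i # r) else 0) =
        (if i = j then letter_op G (Vertex v) q else 0)"
      using v r fv wt_pos[of \<beta>] b by (auto simp: out_def)
    finally show ?thesis .
  qed
qed

text \<open>Dual to \<open>row_op\<close>: the overlap occurs when \<open>q\<close> starts with a
  ghost of the special edge \<beta>. The edge letters then produce a sum over the other edges
  \<gamma>, and the exchange of sums yields a column relation for each \<gamma>.\<close>

lemma column_op: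
  assumes \<alpha>: "\<alpha> \<in> sedges G" and \<beta>: "\<beta> \<in> sedges G" and q: "normal_word G q"
  shows "(\<Sum>i\<in>{1..max (wt G \<alpha>) (wt G \<beta>)}.
      frag_extend (letter_op G (Ghost \<alpha> i)) (letter_op G (Edge \<beta> i) q)) =
    (if \<alpha> = \<beta> then letter_op G (Vertex (tgt G \<alpha>)) q else 0)"
proof (cases "first_vertex G q = tgt G \<beta>")
  case False
  then show ?thesis by auto
next
  case fv: True
  have "(\<Sum>i\<in>{1..max (wt G \<alpha>) (wt G \<beta>)}.
      frag_extend (letter_op G (Ghost \<alpha> i)) (letter_op G (Edge \<beta> i) q)) =
    (\<Sum>i\<in>{1..wt G \<beta>}. frag_extend (letter_op G (Ghost \<alpha> i)) (letter_op G (Edge \<beta> i) q))"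
    by (intro sum.mono_neutral_right) auto
  also have "\<dots> = (if \<alpha> = \<beta> then frag_of q else 0)"
  proof (cases "redex G (Edge \<beta> 1) q")
    case False
    then have "letter_op G (Edge \<beta> i) q = frag_of (Edge \<beta> i # q)" if "i \<in> {1..wt G \<beta>}" for i
      using that False fv redex_Edge_index[of \<beta> i q 1] by auto
    then show ?thesis
      using sum_ghost_edge[of q \<beta> \<alpha>] fv wt_pos \<alpha> \<beta> by (simp del: letter_op.simps)
  next
    case True
    then obtain j r where r: "q = Ghost \<beta> j # r" "\<beta> = special G (src G \<beta>)" by (blast elim: redex_EdgeE)
    let ?O = "out G (src G \<beta>) - {\<beta>}"
    have ne: "out G (src G \<beta>) \<noteq> {}" using \<beta> by (auto simp: out_def)
    have j: "1 \<le> j" "j \<le> wt G \<beta>" "first_vertex G r = src G \<beta>" using q r by auto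
    have "(\<Sum>\<gamma>\<in>?O. if i \<le> wt G \<gamma> \<and> j \<le> wt G \<gamma> then frag_of (Edge \<gamma> i # Ghost \<gamma> j # r) else 0) =
      (\<Sum>\<gamma>\<in>?O. if j \<le> wt G \<gamma> then if i \<le> wt G \<gamma>
              then frag_of (Edge \<gamma> i # Ghost \<gamma> j # r) else 0 else 0 :: _ \<Rightarrow>\<^sub>0 int)" for i
      by (rule sum.cong) simp_all
    then have "letter_op G (Edge \<beta> i) q = (if i = j then frag_of r else 0) -
           (\<Sum>\<gamma>\<in>?O. if j \<le> wt G \<gamma> then if i \<le> wt G \<gamma>
              then frag_of (Edge \<gamma> i # Ghost \<gamma> j # r) else 0 else 0)"
      if "i \<in> {1..wt G \<beta>}" for i
      using that True r j by simp
    then have "(\<Sum>i\<in>{1..wt G \<beta>}. frag_extend (letter_op G (Ghost \<alpha> i)) (letter_op G (Edge \<beta> i) q)) =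
      (\<Sum>i\<in>{1..wt G \<beta>}. (if i = j then letter_op G (Ghost \<alpha> i) r else 0) -
           (\<Sum>\<gamma>\<in>?O. if j \<le> wt G \<gamma> then if i \<le> wt G \<gamma>
              then letter_op G (Ghost \<alpha> i) (Edge \<gamma> i # Ghost \<gamma> j # r) else 0 else 0))"
      by (intro sum.cong) (simp_all add: frag_extend_diff frag_extend_sum' frag_extend_if finite_out del: letter_op.simps cong: if_cong)
    also have "\<dots> = letter_op G (Ghost \<alpha> j) r -
      (\<Sum>i\<in>{1..wt G \<beta>}. \<Sum>\<gamma>\<in>?O. if j \<le> wt G \<gamma> then if i \<le> wt G \<gamma>
              then letter_op G (Ghost \<alpha> i) (Edge \<gamma> i # Ghost \<gamma> j # r) else 0 else 0)"
      using j by (simp add: sum_subtractf del: letter_op.simps)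
    also have "(\<Sum>i\<in>{1..wt G \<beta>}. \<Sum>\<gamma>\<in>?O. if j \<le> wt G \<gamma> then if i \<le> wt G \<gamma>
              then letter_op G (Ghost \<alpha> i) (Edge \<gamma> i # Ghost \<gamma> j # r) else 0 else 0) =
      (\<Sum>\<gamma>\<in>?O. \<Sum>i\<in>{1..wt G \<beta>}. if j \<le> wt G \<gamma> then if i \<le> wt G \<gamma>
              then letter_op G (Ghost \<alpha> i) (Edge \<gamma> i # Ghost \<gamma> j # r) else 0 else 0)"
      by (rule sum.swap)
    also have "\<dots> = (\<Sum>\<gamma>\<in>?O. if j \<le> wt G \<gamma> then if \<alpha> = \<gamma> then frag_of (Ghost \<gamma> j # r) else 0 else 0)"
    proof (rule sum.cong)
      fix \<gamma> assume g: "\<gamma> \<in> ?O"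
      \<comment> \<open>Maximality of the special edge matters here: the indices up to the weight of
        \<beta> include all those of \<gamma>, so the column relation for \<gamma> is
        complete.\<close>
      then have "wt G \<gamma> \<le> wt G \<beta>" using special(2)[OF ne, of \<gamma>] r by auto
      then have "(\<Sum>i\<in>{1..wt G \<beta>}. if i \<le> wt G \<gamma>
              then letter_op G (Ghost \<alpha> i) (Edge \<gamma> i # Ghost \<gamma> j # r) else 0) =
         (\<Sum>i\<in>{1..wt G \<gamma>}. letter_op G (Ghost \<alpha> i) (Edge \<gamma> i # Ghost \<gamma> j # r))"
        by (intro sum.mono_neutral_cong_right) auto
      also have "\<dots> = (if \<alpha> = \<gamma> then frag_of (Ghost \<gamma> j # r) else 0)"
        using g wt_pos \<alpha> by (intro sum_ghost_edge) (auto simp: out_def)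
      finally show "(\<Sum>i\<in>{1..wt G \<beta>}. if j \<le> wt G \<gamma> then if i \<le> wt G \<gamma>
              then letter_op G (Ghost \<alpha> i) (Edge \<gamma> i # Ghost \<gamma> j # r) else 0 else 0) =
         (if j \<le> wt G \<gamma> then if \<alpha> = \<gamma> then frag_of (Ghost \<gamma> j # r) else 0 else 0)"
        by (simp del: letter_op.simps)
    qed simp
    also have "\<dots> = (\<Sum>\<gamma>\<in>?O. if \<alpha> = \<gamma> then if j \<le> wt G \<gamma> then frag_of (Ghost \<gamma> j # r) else 0 else 0)"
      by (intro sum.cong) auto
    also have "\<dots> = (if \<alpha> \<in> ?O then if j \<le> wt G \<alpha> then frag_of (Ghost \<alpha> j # r) else 0 else 0)"
      by (simp add: finite_out)
    also have "letter_op G (Ghost \<alpha> j) r =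
      (if j \<le> wt G \<alpha> \<and> src G \<alpha> = src G \<beta> then frag_of (Ghost \<alpha> j # r) else 0)"
      using j q r redex_Ghost_edge[of \<alpha> j r \<beta>] by auto
    \<comment> \<open>The second term removes the word for every \<alpha> other than \<beta>; for
      \<beta> itself the word is \<open>q\<close>.\<close>
    also have "(if j \<le> wt G \<alpha> \<and> src G \<alpha> = src G \<beta> then frag_of (Ghost \<alpha> j # r) else 0) -
        (if \<alpha> \<in> ?O then if j \<le> wt G \<alpha> then frag_of (Ghost \<alpha> j # r) else 0 else 0) =
        (if \<alpha> = \<beta> then frag_of q else 0)"
      using \<alpha> j r by (auto simp: out_def)
    finally show ?thesis .
  qed
  finally show ?thesis using fv by simp
qed

end

text \<open>An analogue of the unique product property of groups, for words whose products are
  integer combinations. A coefficient that is merely nonzero would not do, as it might vanish in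
  positive characteristic.\<close>

definition unique_product :: "('v, 'e, 'm) wgraph_scheme \<Rightarrow> ('v, 'e) letter list set \<Rightarrow> ('v, 'e) letter list set \<Rightarrow> bool" where
  "unique_product G A B \<longleftrightarrow> (\<exists>p0\<in>A. \<exists>q0\<in>B. \<exists>u.
     lookup (word_op G p0 (frag_of q0)) u \<in> {1, -1} \<and>
     (\<forall>p\<in>A. \<forall>q\<in>B. lookup (word_op G p (frag_of q)) u \<noteq> 0 \<longrightarrow> p = p0 \<and> q = q0))"

section \<open>Leading terms of products of normal words\<close>

definition unique_products :: "('v, 'e, 'm) wgraph_scheme \<Rightarrow> bool" where
  "unique_products G \<longleftrightarrow>
     (\<forall>A B. finite A \<and> A \<noteq> {} \<and> (\<forall>p\<in>A. normal_word G p) \<and> finite B \<and> B \<noteq> {} \<and> (\<forall>q\<in>B. normal_word G q)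
       \<longrightarrow> unique_product G A B)"

text \<open>
  Let \<open>x\<close> be the last letter of a normal word and \<open>y\<close> the first letter of another one. The words of
  maximal length in their product arise by replacing \<open>x y\<close> by the pairs in \<open>leading G x y\<close>, all
  with the same coefficient \<open>\<plusminus>1\<close>.
\<close>

fun leading :: "('v, 'e, 'm) wgraph_scheme \<Rightarrow> ('v, 'e) letter \<Rightarrow> ('v, 'e) letter
    \<Rightarrow> (('v, 'e) letter \<times> ('v, 'e) letter) set" where
  "leading G (Edge \<alpha> i) (Ghost \<beta> j) =
     (if \<alpha> = \<beta> \<and> \<alpha> = special G (src G \<alpha>)
      then (\<lambda>\<gamma>. (Edge \<gamma> i, Ghost \<gamma> j)) ` {\<gamma> \<in> out G (src G \<alpha>) - {\<alpha>}. i \<le> wt G \<gamma> \<and> j \<le> wt G \<gamma>}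
      else {(Edge \<alpha> i, Ghost \<beta> j)})"
| "leading G (Ghost \<alpha> i) (Edge \<beta> j) =
     (if i = 1 \<and> j = 1
      then (\<lambda>k. (Ghost \<alpha> k, Edge \<beta> k)) ` {2..min (wt G \<alpha>) (wt G \<beta>)}
      else {(Ghost \<alpha> i, Edge \<beta> j)})"
| "leading G x y = {(x, y)}"

lemma redex_Cons: "redex G z (x # u) = redex G z (x # u')"
  by (cases z; cases x) auto

lemma normal_Cons: "x \<notin> range Vertex \<Longrightarrow> normal_word G (x # u) \<longleftrightarrow>
    x \<in> letters G \<and> first_vertex G u = last_vertex G x \<and> normal_word G u \<and> \<not> redex G x u"
  by (cases x) auto

context weighted_graph
begin

lemma finite_leading: "finite (leading G x y)"
  by (cases "(G, x, y)" rule: leading.cases) (auto simp: finite_out)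

text \<open>Normality is local: a prefix sees of the following word only its first vertex and
  whether its first letter completes a redex.\<close>

lemma normal_subst:
  assumes "normal_word G (p @ x # u)" "normal_word G (x' # u')" "first_vertex G (x' # u') = first_vertex G (x # u)"
    "\<And>z. redex G z (x' # u') \<Longrightarrow> redex G z (x # u)"
  shows "normal_word G (p @ x' # u')"
  using assms(1)
proof (induction p)
  case Nil
  then show ?case using assms by simp
next
  case (Cons z p)
  have z: "z \<notin> range Vertex" using Cons.prems by (cases z) auto
  have "\<not> redex G z (p @ x' # u')"
  proof (cases p)
    case Nil
    then show ?thesis using Cons.prems assms(4) z by (auto simp: normal_Cons)
  next
    case (Cons a as)
    then show ?thesis using Cons.prems z redex_Cons[of G z a "as @ x # u" "as @ x' # u'"]
      by (auto simp: normal_Cons)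
  qed
  moreover have "first_vertex G (p @ x' # u') = first_vertex G (p @ x # u)"
  proof (cases p)
    case (Cons a as) then show ?thesis by (cases a) auto
  qed (use assms in auto)
  ultimately show ?case using Cons z by (auto simp: normal_Cons)
qed

text \<open>Reading a normal word from the right meets no redex, so each letter is simply
  prepended.\<close>

lemma word_op_normal:
  assumes "normal_word G (p @ u)" "u \<noteq> []"
  shows "word_op G p (frag_of u) = frag_of (p @ u)"
  using assms(1)
proof (induction p)
  case (Cons z p)
  have z: "z \<notin> range Vertex" using Cons.prems assms(2) by (cases z) auto
  have "normal_word G (p @ u)" using Cons.prems z by (simp add: normal_Cons)
  then have "word_op G (z # p) (frag_of u) = letter_op G z (p @ u)" using Cons.IH by simp
  also have "\<dots> = frag_of (z # p @ u)"
    using letter_op_normal Cons.prems z by simp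
  finally show ?case by simp
qed simp

text \<open>Vertices never lengthen a word. Since a normal word ends with a vertex, its product with
  \<open>q\<close> has length at most the sum of both lengths minus 1.\<close>

lemma length_word_op:
  assumes "set p \<subseteq> letters G" "w \<in> keys (word_op G p (frag_of q))"
  shows "length w \<le> length q + length (filter (\<lambda>x. x \<notin> range Vertex) p)"
  using assms
proof (induction p arbitrary: w)
  case (Cons x p)
  then obtain w' where w': "w' \<in> keys (word_op G p (frag_of q))"
    "w \<in> keys (letter_op G x w')"
    using keys_frag_extend by fastforce
  have "length w \<le> length w' + (if x \<in> range Vertex then 0 else 1)"
    using length_letter_op[OF w'(2)] Cons.prems by auto
  moreover have "length w' \<le> length q + length (filter (\<lambda>x. x \<notin> range Vertex) p)"
    using Cons w' by auto
  ultimately show ?case by (auto split: if_splits)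
qed auto

text \<open>The sign is negative exactly when a relation has been solved for the pair
  \<open>x\<close>, \<open>y\<close>. The flag \<open>d\<close> records whether that relation also
  leaves \<open>q\<close>, which is two letters shorter than the leading words.\<close>

lemma leading_letter_op:
  assumes "normal_word G (y # q)" "x \<in> letters G" "x \<notin> range Vertex" "first_vertex G (y # q) = last_vertex G x"
  shows "\<exists>c d. c \<in> {1, -1} \<and>
    letter_op G x (y # q) = frag_cmul c (\<Sum>(a, b)\<in>leading G x y. frag_of (a # b # q)) +
      (if d \<and> normal_word G q then frag_of q else 0)"
proof (cases "redex G x (y # q)")
  case False
  then have "leading G x y = {(x, y)}" by (cases "(G, x, y)" rule: leading.cases) auto
  moreover have "letter_op G x (y # q) = frag_of (x # y # q)"
    using False assms by (intro letter_op_normal) (auto simp: normal_Cons)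
  ultimately show ?thesis by (intro exI[of _ 1] exI[of _ False]) simp
next
  case True
  show ?thesis
  proof (cases x)
    case (Edge \<alpha> i)
    with True obtain j where y: "y = Ghost \<alpha> j" "\<alpha> = special G (src G \<alpha>)"
      by (blast elim: redex_EdgeE)
    let ?O = "out G (src G \<alpha>) - {\<alpha>}"
    have "(\<Sum>(a, b)\<in>leading G x y. frag_of (a # b # q)) =
      (\<Sum>\<gamma>\<in>{\<gamma> \<in> ?O. i \<le> wt G \<gamma> \<and> j \<le> wt G \<gamma>}. frag_of (Edge \<gamma> i # Ghost \<gamma> j # q) :: _ \<Rightarrow>\<^sub>0 int)"
      using y Edge by (simp add: sum.reindex inj_on_def)
    also have "\<dots> = (\<Sum>\<gamma>\<in>?O. if i \<le> wt G \<gamma> \<and> j \<le> wt G \<gamma> then frag_of (Edge \<gamma> i # Ghost \<gamma> j # q) else 0)"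
      using finite_out by (intro sum.inter_filter) auto
    finally have "letter_op G x (y # q) = frag_cmul (-1) (\<Sum>(a, b)\<in>leading G x y. frag_of (a # b # q)) +
      (if i = j \<and> normal_word G q then frag_of q else 0)"
      using assms y True Edge by auto
    then show ?thesis by blast
  next
    case (Ghost \<alpha> i)
    with True obtain \<beta> where y: "y = Edge \<beta> 1" "i = 1"
      by (blast elim: redex_GhostE)
    have "(\<Sum>(a, b)\<in>leading G x y. frag_of (a # b # q)) =
      (\<Sum>k\<in>{2..min (wt G \<alpha>) (wt G \<beta>)}. frag_of (Ghost \<alpha> k # Edge \<beta> k # q) :: _ \<Rightarrow>\<^sub>0 int)"
      using y Ghost by (simp add: sum.reindex inj_on_def)
    then have "letter_op G x (y # q) = frag_cmul (-1) (\<Sum>(a, b)\<in>leading G x y. frag_of (a # b # q)) +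
      (if \<alpha> = \<beta> \<and> normal_word G q then frag_of q else 0)"
      using assms y True Ghost by auto
    then show ?thesis by blast
  qed (use assms in auto)
qed

text \<open>A replacement keeps just what a preceding letter can detect in a redex: the index of an
  edge and the underlying edge of a ghost edge.\<close>

lemma leading_normal:
  assumes "normal_word G (y # q)" "x \<in> letters G" "x \<notin> range Vertex" "first_vertex G (y # q) = last_vertex G x"
    "(a, b) \<in> leading G x y"
  shows "normal_word G (a # b # q)" "first_vertex G (a # b # q) = first_vertex G (x # u)"
    "redex G z (a # b # q) \<Longrightarrow> redex G z (x # u)"
proof -
  have "normal_word G (a # b # q) \<and> first_vertex G (a # b # q) = first_vertex G (x # u) \<and>
    (redex G z (a # b # q) \<longrightarrow> redex G z (x # u))"
  proof (cases "redex G x (y # q)")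
    case False
    then have "leading G x y = {(x, y)}" by (cases "(G, x, y)" rule: leading.cases) auto
    then show ?thesis using False assms redex_Cons[of G z x "y # q" u]
      by (cases x) (auto simp: normal_Cons)
  next
    case True
    show ?thesis
    proof (cases x)
      case (Edge \<alpha> i)
      with True obtain j where y: "y = Ghost \<alpha> j" "\<alpha> = special G (src G \<alpha>)"
        by (blast elim: redex_EdgeE)
      obtain \<gamma> where g: "\<gamma> \<in> out G (src G \<alpha>)" "\<gamma> \<noteq> \<alpha>" "a = Edge \<gamma> i" "b = Ghost \<gamma> j"
        "i \<le> wt G \<gamma>" "j \<le> wt G \<gamma>"
        using assms(5) y Edge by auto
      then show ?thesis using assms y Edge redex_Ghost_edge[of \<gamma> j q \<alpha>]
        by (cases z) (auto simp: out_def)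
    next
      case (Ghost \<alpha> i)
      with True obtain \<beta> where y: "y = Edge \<beta> 1" "i = 1"
        by (blast elim: redex_GhostE)
      obtain k where g: "2 \<le> k" "k \<le> wt G \<alpha>" "k \<le> wt G \<beta>" "a = Ghost \<alpha> k" "b = Edge \<beta> k"
        using assms(5) y Ghost by auto
      then show ?thesis using assms y Ghost redex_Edge_index[of \<beta> k q 1]
        by (cases z) auto
    qed (use assms in auto)
  qed
  then show "normal_word G (a # b # q)" "first_vertex G (a # b # q) = first_vertex G (x # u)"
    "redex G z (a # b # q) \<Longrightarrow> redex G z (x # u)" by auto
qed

lemma normal_letters: "normal_word G u \<Longrightarrow> set u \<subseteq> letters G"
proof (induction u)
  case (Cons x u) then show ?case by (cases x) auto
qed simp

lemma normal_snocE:
  assumes "normal_word G u"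
  obtains v p where "u = p @ [Vertex v]" "v \<in> verts G" "\<forall>x\<in>set p. x \<notin> range Vertex"
proof -
  have "\<exists>v p. u = p @ [Vertex v] \<and> v \<in> verts G \<and> (\<forall>x\<in>set p. x \<notin> range Vertex)"
    using assms
  proof (induction u)
    case (Cons x u)
    show ?case
    proof (cases "x \<in> range Vertex")
      case True
      then show ?thesis using Cons.prems by auto
    next
      case False
      then have "normal_word G u" using Cons.prems by (simp add: normal_Cons)
      then obtain v p where "u = p @ [Vertex v]" "v \<in> verts G" "\<forall>x\<in>set p. x \<notin> range Vertex"
        using Cons.IH by auto
      then show ?thesis using False by (intro exI[of _ v] exI[of _ "x # p"]) auto
    qed
  qed simp
  then show ?thesis using that by blast
qed

lemma normal_append: "normal_word G (p @ u) \<Longrightarrow> u \<noteq> [] \<Longrightarrow> normal_word G u"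
proof (induction p)
  case (Cons x p)
  then have "x \<notin> range Vertex" by (cases x) auto
  then show ?case using Cons by (simp add: normal_Cons)
qed simp

section \<open>Products of normal words over a single vertex\<close>

lemma first_vertex_rose:
  assumes "verts G = {v}" "normal_word G u"
  shows "first_vertex G u = v"
  using assms src_closed tgt_closed by (cases u; cases "hd u") auto

lemma last_vertex_rose:
  assumes "verts G = {v}" "x \<in> letters G"
  shows "last_vertex G x = v"
  using assms src_closed tgt_closed by (cases x) auto

lemma word_op_last_Vertex:
  assumes "verts G = {v}" "normal_word G q"
  shows "word_op G (p @ [Vertex v]) (frag_of q) = word_op G p (frag_of q)"
  using first_vertex_rose[OF assms] by (simp add: word_op_append)

text \<open>The final vertex of the left factor acts trivially, so \<open>x\<close> is the first
  letter to touch \<open>y\<close>. The pairs it creates cause no redex with \<open>p\<close>, and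
  the shorter remainder cannot grow back to the length of the leading words.\<close>

lemma word_op_top:
  assumes V: "verts G = {v}" and p: "normal_word G (p @ [x, Vertex v])" and q: "normal_word G (y # q)"
  shows "\<exists>c \<in> {1, -1}. \<forall>u. length u = length p + length q + 2 \<longrightarrow>
    lookup (word_op G (p @ [x, Vertex v]) (frag_of (y # q))) u =
      (if \<exists>a b. (a, b) \<in> leading G x y \<and> u = p @ a # b # q then c else 0)"
proof -
  have "normal_word G [x, Vertex v]" using normal_append[OF p] by simp
  then have x: "x \<in> letters G" "x \<notin> range Vertex" by (cases x; auto)+
  have fv: "first_vertex G (y # q) = last_vertex G x"
    using first_vertex_rose[OF V q] last_vertex_rose[OF V x(1)] by simp
  obtain c d where c: "c \<in> {1, -1}" and
    eq: "letter_op G x (y # q) = frag_cmul c (\<Sum>(a, b)\<in>leading G x y. frag_of (a # b # q)) +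
      (if d \<and> normal_word G q then frag_of q else 0)"
    using leading_letter_op[OF q x fv] by blast
  have set_p: "set p \<subseteq> letters G" using normal_letters[OF p] by auto
  \<comment> \<open>The contribution of the word \<open>q\<close>, from which both \<open>x\<close>
    and \<open>y\<close> have disappeared.\<close>
  define L where "L = word_op G p (if d \<and> normal_word G q then frag_of q else 0)"
  have lin: "word_op G p (frag_cmul c (\<Sum>z\<in>S. f z)) = frag_cmul c (\<Sum>z\<in>S. word_op G p (f z))"
    if "finite S" for S f
    using that by (subst (1 2) word_op_frag_extend) (simp add: frag_extend_cmul frag_extend_sum')
  have "word_op G (p @ [x, Vertex v]) (frag_of (y # q)) = word_op G (p @ [x]) (frag_of (y # q))"
    using word_op_last_Vertex[OF V q, of "p @ [x]"] by simp
  also have "\<dots> = word_op G p (letter_op G x (y # q))" by (simp add: word_op_append)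
  also have "\<dots> = frag_cmul c (\<Sum>z\<in>leading G x y. word_op G p (case z of (a, b) \<Rightarrow> frag_of (a # b # q))) + L"
    unfolding eq word_op_add L_def by (simp only: lin[OF finite_leading])
  also have "(\<Sum>z\<in>leading G x y. word_op G p (case z of (a, b) \<Rightarrow> frag_of (a # b # q))) =
      (\<Sum>z\<in>leading G x y. frag_of (p @ fst z # snd z # q))"
  proof (rule sum.cong)
    fix z assume "z \<in> leading G x y"
    then obtain a b where z: "z = (a, b)" "(a, b) \<in> leading G x y" by (cases z) auto
    have "normal_word G (p @ a # b # q)"
      using normal_subst[OF p leading_normal(1)[OF q x fv z(2)]] leading_normal(2,3)[OF q x fv z(2)]
      by blast
    then show "word_op G p (case z of (a, b) \<Rightarrow> frag_of (a # b # q)) = frag_of (p @ fst z # snd z # q)"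
      using z word_op_normal by simp
  qed simp
  finally have main: "word_op G (p @ [x, Vertex v]) (frag_of (y # q)) =
    frag_cmul c (\<Sum>z\<in>leading G x y. frag_of (p @ fst z # snd z # q)) + L" .
  have "lookup (word_op G (p @ [x, Vertex v]) (frag_of (y # q))) u =
      (if \<exists>a b. (a, b) \<in> leading G x y \<and> u = p @ a # b # q then c else 0)"
    if u: "length u = length p + length q + 2" for u
  proof -
    have "lookup L u = 0"
    proof (cases "d \<and> normal_word G q")
      case True
      \<comment> \<open>The letters of \<open>p\<close> lengthen \<open>q\<close> by at most
        \<open>length p\<close>, which is two short of the length of \<open>u\<close>.\<close>
      have "u \<notin> keys L"
      proof
        assume "u \<in> keys L"
        then have "length u \<le> length q + length (filter (\<lambda>x. x \<notin> range Vertex) p)"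
          using length_word_op[OF set_p, of u q] True by (auto simp: L_def)
        then show False using u length_filter_le[of "\<lambda>x. x \<notin> range Vertex" p] by linarith
      qed
      then show ?thesis by (simp add: in_keys_iff)
    next
      case False
      then show ?thesis unfolding L_def by auto
    qed
    moreover have "lookup (\<Sum>z\<in>leading G x y. frag_of (p @ fst z # snd z # q)) u =
      (\<Sum>z\<in>leading G x y. if u = p @ fst z # snd z # q then 1 else 0)"
      by (simp add: lookup_sum)
    moreover have "\<dots> = (if \<exists>a b. (a, b) \<in> leading G x y \<and> u = p @ a # b # q then 1 else (0::int))"
    proof (cases "\<exists>a b. (a, b) \<in> leading G x y \<and> u = p @ a # b # q")
      case True
      then obtain a b where ab: "(a, b) \<in> leading G x y" "u = p @ a # b # q" by auto
      \<comment> \<open>With \<open>p\<close> and \<open>q\<close> fixed, the word determines the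
        pair, so terms do not accumulate and the coefficient stays a sign.\<close>
      then have "(if u = p @ fst z # snd z # q then 1 else (0::int)) = (if z = (a, b) then 1 else 0)" for z
        by (cases z) auto
      then show ?thesis using ab finite_leading[of x y] True by simp
    next
      case False
      then have "u \<noteq> p @ fst z # snd z # q" if "z \<in> leading G x y" for z
        using that by (cases z) auto
      then show ?thesis using False by simp
    qed
    ultimately show ?thesis unfolding main by (auto simp: lookup_add)
  qed
  then show ?thesis using c by blast
qed

text \<open>
  Here both halves of the definition of an LV-rose are needed: the second edge of maximal weight gives
  a leading pair for \<open>\<alpha>\<^sub>i \<alpha>\<^sub>j\<^sup>*\<close> with \<open>\<alpha>\<close> special, and the weights at least \<open>2\<close> give a leading pair
  for \<open>\<alpha>\<^sub>1\<^sup>* \<beta>\<^sub>1\<close>.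
\<close>

lemma LV_unique_pair:
  assumes LV: "LV_rose G" and V: "verts G = {v}"
    and X: "X \<noteq> {}" "X \<subseteq> letters G" "X \<inter> range Vertex = {}"
    and Y: "Y \<noteq> {}" "Y \<subseteq> letters G"
  shows "\<exists>x\<in>X. \<exists>y\<in>Y. \<exists>ab \<in> leading G x y. \<forall>x'\<in>X. \<forall>y'\<in>Y. ab \<in> leading G x' y' \<longrightarrow> x' = x \<and> y' = y"
proof -
  have out: "out G v = sedges G" using src_closed V by (auto simp: out_def)
  have sv: "src G \<alpha> = v" if "\<alpha> \<in> sedges G" for \<alpha> using that src_closed V by auto
  let ?s = "special G v"
  have w2: "2 \<le> wt G \<alpha>" if "\<alpha> \<in> sedges G" for \<alpha> using LV that by (auto simp: LV_rose_def)
  have "sedges G \<noteq> {}" using LV by (auto simp: LV_rose_def)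
  then have s: "?s \<in> sedges G" using special(1) out by auto
  obtain \<gamma> where \<gamma>: "\<gamma> \<in> sedges G" "\<gamma> \<noteq> ?s" "\<And>\<beta>. \<beta> \<in> sedges G \<Longrightarrow> wt G \<beta> \<le> wt G \<gamma>"
    using LV unfolding LV_rose_def by metis
  obtain x y where xy: "x \<in> X" "y \<in> Y" using X Y by auto
  have unred: ?thesis
    if "x \<in> X" "y \<in> Y" "leading G x y = {(x, y)}"
      "\<And>x' y'. x' \<in> X \<Longrightarrow> y' \<in> Y \<Longrightarrow> (x, y) \<in> leading G x' y' \<Longrightarrow> x' = x \<and> y' = y" for x y
    using that by blast
  \<comment> \<open>Replacements always combine an edge with a ghost edge. A pair of any other kind
    therefore arises only from itself, and two cases of opposite letters remain.\<close>
  consider (vertex) u where "Vertex u \<in> Y" | (ee) \<alpha> i \<beta> j where "Edge \<alpha> i \<in> X" "Edge \<beta> j \<in> Y"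
    | (gg) \<alpha> i \<beta> j where "Ghost \<alpha> i \<in> X" "Ghost \<beta> j \<in> Y"
    | (eg) "X \<subseteq> {Edge \<alpha> i | \<alpha> i. True}" "Y \<subseteq> {Ghost \<alpha> i | \<alpha> i. True}"
    | (ge) "X \<subseteq> {Ghost \<alpha> i | \<alpha> i. True}" "Y \<subseteq> {Edge \<alpha> i | \<alpha> i. True}"
  proof -
    have XX: "(\<exists>\<alpha> i. a = Edge \<alpha> i) \<or> (\<exists>\<alpha> i. a = Ghost \<alpha> i)" if "a \<in> X" for a
      using that X by (cases a) auto
    have YY: "(\<exists>u. a = Vertex u) \<or> (\<exists>\<alpha> i. a = Edge \<alpha> i) \<or> (\<exists>\<alpha> i. a = Ghost \<alpha> i)" for a :: "('v, 'e) letter"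
      by (cases a) auto
    show ?thesis
    proof (cases "\<exists>u. Vertex u \<in> Y")
      case False
      then have YY': "(\<exists>\<alpha> i. a = Edge \<alpha> i) \<or> (\<exists>\<alpha> i. a = Ghost \<alpha> i)" if "a \<in> Y" for a
        using YY[of a] that by auto
      show ?thesis
      proof (cases "(\<exists>\<alpha> i. Edge \<alpha> i \<in> X) \<and> (\<exists>\<alpha> i. Edge \<alpha> i \<in> Y)")
        case True then show ?thesis using ee by blast
      next
        case a: False
        show ?thesis
        proof (cases "(\<exists>\<alpha> i. Ghost \<alpha> i \<in> X) \<and> (\<exists>\<alpha> i. Ghost \<alpha> i \<in> Y)")
          case True then show ?thesis using gg by blast
        next
          case b: False
          show ?thesis
          proof (cases "\<exists>\<alpha> i. Edge \<alpha> i \<in> X")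
            case True
            then have "Y \<subseteq> {Ghost \<alpha> i | \<alpha> i. True}" using a YY' by blast
            moreover from this xy have "\<exists>\<alpha> i. Ghost \<alpha> i \<in> Y" by blast
            then have "X \<subseteq> {Edge \<alpha> i | \<alpha> i. True}" using b XX by blast
            ultimately show ?thesis using eg by blast
          next
            case False
            then have "X \<subseteq> {Ghost \<alpha> i | \<alpha> i. True}" using XX by blast
            moreover from this xy have "\<exists>\<alpha> i. Ghost \<alpha> i \<in> X" by blast
            then have "Y \<subseteq> {Edge \<alpha> i | \<alpha> i. True}" using b YY' by blast
            ultimately show ?thesis using ge by blast
          qed
        qed
      qed
    qed (use vertex in blast)
  qed
  then show ?thesis
  proof cases
    case vertex
    show ?thesis
    proof (rule unred[OF xy(1) vertex])
      show "leading G x (Vertex u) = {(x, Vertex u)}" by (cases x) auto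
      fix x' y' assume "(x, Vertex u) \<in> leading G x' y'"
      then show "x' = x \<and> y' = Vertex u"
        by (cases "(G, x', y')" rule: leading.cases) (auto split: if_splits)
    qed
  next
    case ee
    show ?thesis
    proof (rule unred[OF ee])
      fix x' y' assume "(Edge \<alpha> i, Edge \<beta> j) \<in> leading G x' y'"
      then show "x' = Edge \<alpha> i \<and> y' = Edge \<beta> j"
        by (cases "(G, x', y')" rule: leading.cases) (auto split: if_splits)
    qed simp
  next
    case gg
    show ?thesis
    proof (rule unred[OF gg])
      fix x' y' assume "(Ghost \<alpha> i, Ghost \<beta> j) \<in> leading G x' y'"
      then show "x' = Ghost \<alpha> i \<and> y' = Ghost \<beta> j"
        by (cases "(G, x', y')" rule: leading.cases) (auto split: if_splits)
    qed simp
  next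
    case eg
    \<comment> \<open>The pairs created from an edge and a ghost share their underlying edge. So a
      pair on distinct edges arises only from itself; if there is none, all of \<open>X\<close> and
      \<open>Y\<close> lie on one edge.\<close>
    show ?thesis
    proof (cases "\<exists>\<alpha> i \<beta> j. Edge \<alpha> i \<in> X \<and> Ghost \<beta> j \<in> Y \<and> \<alpha> \<noteq> \<beta>")
      case True
      then obtain \<alpha> i \<beta> j where ab: "Edge \<alpha> i \<in> X" "Ghost \<beta> j \<in> Y" "\<alpha> \<noteq> \<beta>" by blast
      show ?thesis
      proof (rule unred[OF ab(1,2)])
        fix x' y' assume "(Edge \<alpha> i, Ghost \<beta> j) \<in> leading G x' y'"
        then show "x' = Edge \<alpha> i \<and> y' = Ghost \<beta> j" using ab(3)
          by (cases "(G, x', y')" rule: leading.cases) (auto split: if_splits)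
      qed (use ab(3) in simp)
    next
      case same: False
      obtain \<alpha> i where x: "x = Edge \<alpha> i" using eg xy by blast
      obtain j where y: "y = Ghost \<alpha> j" using eg xy same x by blast
      have \<alpha>: "\<alpha> \<in> sedges G" "i \<le> wt G \<alpha>" "j \<le> wt G \<alpha>" using X Y xy x y by auto
      have Xa: "x' \<in> X \<Longrightarrow> \<exists>i. x' = Edge \<alpha> i" and Ya: "y' \<in> Y \<Longrightarrow> \<exists>j. y' = Ghost \<alpha> j" for x' y'
        using same x y xy eg by blast+
      show ?thesis
      proof (cases "\<alpha> = ?s")
        case False
        show ?thesis
        proof (rule unred[OF xy])
          show "leading G x y = {(x, y)}" using x y False sv[OF \<alpha>(1)] by simp
          fix x' y' assume "x' \<in> X" "y' \<in> Y" "(x, y) \<in> leading G x' y'"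
          then show "x' = x \<and> y' = y" using Xa[of x'] Ya[of y'] False sv[OF \<alpha>(1)] by auto
        qed
      next
        case True
        \<comment> \<open>Moving to \<gamma> keeps both indices, and these identify \<open>x\<close>
          and \<open>y\<close> because their edge is already known.\<close>
        have "i \<le> wt G \<gamma>" "j \<le> wt G \<gamma>" using \<gamma>(3)[OF \<alpha>(1)] \<alpha> by auto
        then have "(Edge \<gamma> i, Ghost \<gamma> j) \<in> leading G x y"
          using x y True \<gamma> sv s out by auto
        moreover have "x' = x \<and> y' = y"
          if "x' \<in> X" "y' \<in> Y" "(Edge \<gamma> i, Ghost \<gamma> j) \<in> leading G x' y'" for x' y'
          using Xa[OF that(1)] Ya[OF that(2)] that(3) x y True sv s by auto
        ultimately show ?thesis using xy by blast
      qed
    qed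
  next
    case ge
    \<comment> \<open>The pairs created from a ghost and an edge share their index. So a pair with
      distinct indices arises only from itself; if there is none, a single index is common to
      \<open>X\<close> and \<open>Y\<close>.\<close>
    show ?thesis
    proof (cases "\<exists>\<alpha> i \<beta> j. Ghost \<alpha> i \<in> X \<and> Edge \<beta> j \<in> Y \<and> i \<noteq> j")
      case True
      then obtain \<alpha> i \<beta> j where ab: "Ghost \<alpha> i \<in> X" "Edge \<beta> j \<in> Y" "i \<noteq> j" by blast
      show ?thesis
      proof (rule unred[OF ab(1,2)])
        fix x' y' assume "(Ghost \<alpha> i, Edge \<beta> j) \<in> leading G x' y'"
        then show "x' = Ghost \<alpha> i \<and> y' = Edge \<beta> j" using ab(3)
          by (cases "(G, x', y')" rule: leading.cases) (auto split: if_splits)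
      qed (use ab(3) in simp)
    next
      case same: False
      obtain \<alpha> i where x: "x = Ghost \<alpha> i" using ge xy by blast
      obtain \<beta> where y: "y = Edge \<beta> i" using ge xy same x by blast
      have ab: "\<alpha> \<in> sedges G" "\<beta> \<in> sedges G" using X Y xy x y by auto
      have Xa: "x' \<in> X \<Longrightarrow> \<exists>\<alpha>. x' = Ghost \<alpha> i" and Ya: "y' \<in> Y \<Longrightarrow> \<exists>\<beta>. y' = Edge \<beta> i" for x' y'
        using same x y xy ge by blast+
      show ?thesis
      proof (cases "i = 1")
        case False
        show ?thesis
        proof (rule unred[OF xy])
          show "leading G x y = {(x, y)}" using x y False by simp
          fix x' y' assume "x' \<in> X" "y' \<in> Y" "(x, y) \<in> leading G x' y'"
          then show "x' = x \<and> y' = y" using Xa[of x'] Ya[of y'] False x y by auto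
        qed
      next
        case True
        \<comment> \<open>The pair with index 2 keeps both edges, and these identify
          \<open>x\<close> and \<open>y\<close> because their index is known to be 1.\<close>
        have "(Ghost \<alpha> 2, Edge \<beta> 2) \<in> leading G x y"
          using x y True w2[OF ab(1)] w2[OF ab(2)] by auto
        moreover have "x' = x \<and> y' = y"
          if "x' \<in> X" "y' \<in> Y" "(Ghost \<alpha> 2, Edge \<beta> 2) \<in> leading G x' y'" for x' y'
          using Xa[OF that(1)] Ya[OF that(2)] that(3) x y True by auto
        ultimately show ?thesis using xy by blast
      qed
    qed
  qed
qed

text \<open>The length of a longest word forces both factors to be longest, their lengths fix the
  place where they meet, and the uniqueness of the pair found there settles the two letters. The
  remaining letters are unchanged by the product.\<close>

lemma LV_unique_products:
  assumes LV: "LV_rose G"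
  shows "unique_products G"
  unfolding unique_products_def
proof (intro allI impI, elim conjE)
  fix A B :: "('v, 'e) letter list set"
  assume A: "finite A" "A \<noteq> {}" "\<forall>p\<in>A. normal_word G p" and B: "finite B" "B \<noteq> {}" "\<forall>q\<in>B. normal_word G q"
  obtain v where V: "verts G = {v}" using LV by (auto simp: LV_rose_def rose_def card_1_singleton_iff)
  define m where "m = Max (length ` A)"
  define n where "n = Max (length ` B)"
  have m: "\<And>p. p \<in> A \<Longrightarrow> length p \<le> m" and n: "\<And>q. q \<in> B \<Longrightarrow> length q \<le> n"
    unfolding m_def n_def using A B by auto
  have "m \<in> length ` A" "n \<in> length ` B" unfolding m_def n_def using A B by (intro Max_in; auto)+
  then obtain pm qn where pm: "pm \<in> A" "length pm = m" and qn: "qn \<in> B" "length qn = n" by auto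
  have A': "\<exists>p'. p = p' @ [Vertex v] \<and> (\<forall>x\<in>set p'. x \<notin> range Vertex)" if "p \<in> A" for p
    using that A V by (metis normal_snocE singletonD)
  have B': "q \<noteq> []" if "q \<in> B" for q using that B by force
  \<comment> \<open>If \<open>m\<close> is at most 1, the left factors have no letter before the
    final vertex, and multiplication by them is the identity.\<close>
  show "unique_product G A B"
  proof (cases "m \<le> 1")
    case True
    have pA: "p = [Vertex v]" if p: "p \<in> A" for p
    proof -
      obtain p' where p': "p = p' @ [Vertex v]" using A'[OF p] by blast
      then have "length p' + 1 \<le> m" using m[OF p] by simp
      then have "length p' = 0" using True by linarith
      then show ?thesis using p' by simp
    qed
    have "word_op G p (frag_of q) = frag_of q" if "p \<in> A" "q \<in> B" for p q
      using word_op_last_Vertex[OF V, of q "[]"] pA[OF that(1)] that(2) B(3) by simp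
    note id = this
    show ?thesis
      unfolding unique_product_def
    proof (intro bexI exI conjI ballI impI)
      show "lookup (word_op G pm (frag_of qn)) qn \<in> {1, -1}" using id pm qn by simp
      fix p q assume p: "p \<in> A" and q: "q \<in> B"
        and nz: "lookup (word_op G p (frag_of q)) qn \<noteq> 0"
      show "p = pm" using pA p pm by metis
      show "q = qn" using nz id[OF p q] by (simp split: if_splits)
    qed (use pm qn in auto)
  next
    case False
    \<comment> \<open>The letters that meet in products of longest words. On the left it is the last
      letter but one, as the final vertex is absorbed; on the right it may be a vertex, namely when
      \<open>n\<close> is 1.\<close>
    define X where "X = {x. \<exists>p. p @ [x, Vertex v] \<in> A \<and> length p + 2 = m}"
    define Y where "Y = {y. \<exists>q. y # q \<in> B \<and> length q + 1 = n}"
    have long: "\<exists>p' x. p = p' @ [x, Vertex v] \<and> x \<notin> range Vertex" if p: "p \<in> A" "length p = m" for p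
    proof -
      obtain p' where p': "p = p' @ [Vertex v]" "\<forall>x\<in>set p'. x \<notin> range Vertex" using A'[OF p(1)] by blast
      with p False have "p' \<noteq> []" by auto
      then obtain p2 x where "p' = p2 @ [x]" by (cases p' rule: rev_cases) auto
      then show ?thesis using p' by auto
    qed
    have X: "X \<noteq> {}" "X \<subseteq> letters G" "X \<inter> range Vertex = {}"
    proof -
      obtain p' x where "pm = p' @ [x, Vertex v]" using long[OF pm] by blast
      then show "X \<noteq> {}" using pm by (auto simp: X_def)
      show "X \<subseteq> letters G" using normal_letters A by (fastforce simp: X_def)
      show "X \<inter> range Vertex = {}"
      proof -
        have "x \<notin> range Vertex" if x: "x \<in> X" for x
        proof -
          obtain p where p: "p @ [x, Vertex v] \<in> A" "length p + 2 = m" using x by (auto simp: X_def)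
          then show ?thesis using long[OF p(1)] by auto
        qed
        then show ?thesis by blast
      qed
    qed
    have Y: "Y \<noteq> {}" "Y \<subseteq> letters G"
    proof -
      obtain y q where "qn = y # q" using B'[OF qn(1)] by (cases qn) auto
      then show "Y \<noteq> {}" using qn by (auto simp: Y_def)
      show "Y \<subseteq> letters G" using normal_letters B by (fastforce simp: Y_def)
    qed
    obtain x y a b where xy: "x \<in> X" "y \<in> Y" "(a, b) \<in> leading G x y"
      and uniq: "\<And>x' y'. x' \<in> X \<Longrightarrow> y' \<in> Y \<Longrightarrow> (a, b) \<in> leading G x' y' \<Longrightarrow> x' = x \<and> y' = y"
      using LV_unique_pair[OF LV V X Y] by (metis prod.exhaust)
    obtain p where p: "p @ [x, Vertex v] \<in> A" "length p + 2 = m" using xy by (auto simp: X_def)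
    obtain q where q: "y # q \<in> B" "length q + 1 = n" using xy by (auto simp: Y_def)
    let ?u = "p @ a # b # q"
    show ?thesis
      unfolding unique_product_def
    proof (intro bexI exI conjI ballI impI)
      show "lookup (word_op G (p @ [x, Vertex v]) (frag_of (y # q))) ?u \<in> {1, -1}"
      proof -
        have "normal_word G (p @ [x, Vertex v])" "normal_word G (y # q)" using p q A B by auto
        then obtain c where c: "c \<in> {1, -1}" "\<And>u. length u = length p + length q + 2 \<Longrightarrow>
          lookup (word_op G (p @ [x, Vertex v]) (frag_of (y # q))) u =
            (if \<exists>a b. (a, b) \<in> leading G x y \<and> u = p @ a # b # q then c else 0)"
          using word_op_top[OF V] by blast
        moreover have "\<exists>a' b'. (a', b') \<in> leading G x y \<and> ?u = p @ a' # b' # q" using xy by blast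
        ultimately show ?thesis using c(2)[of ?u] by (simp only:) simp
      qed
      fix p1 q1 assume p1: "p1 \<in> A" and q1: "q1 \<in> B"
        and nz: "lookup (word_op G p1 (frag_of q1)) ?u \<noteq> 0"
      obtain p1' where p1': "p1 = p1' @ [Vertex v]" using A'[OF p1] by blast
      have "?u \<in> keys (word_op G p1 (frag_of q1))" using nz by (simp add: in_keys_iff)
      \<comment> \<open>The word \<open>?u\<close> has \<open>m + n - 1\<close> letters. No product
        exceeds this length, and a product with a factor that is not longest stays below it.\<close>
      then have "length ?u \<le> length q1 + length (filter (\<lambda>x. x \<notin> range Vertex) p1)"
        using length_word_op[of p1 ?u q1] normal_letters A B p1 q1 by blast
      also have "length (filter (\<lambda>x. x \<notin> range Vertex) p1) \<le> length p1'"
        using p1' by (simp add: length_filter_le)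
      finally have len: "length p1 = m" "length q1 = n"
        using p(2) q(2) m[OF p1] n[OF q1] p1' by auto
      obtain p2 x2 where p2: "p1 = p2 @ [x2, Vertex v]" using long[OF p1 len(1)] by blast
      obtain y2 q2 where q2: "q1 = y2 # q2" using B'[OF q1] by (cases q1) auto
      have in_XY: "x2 \<in> X" "y2 \<in> Y" using p1 q1 p2 q2 len by (auto simp: X_def Y_def)
      have lens: "length p2 = length p" "length q2 = length q" using len p q p2 q2 by auto
      obtain a' b' where "(a', b') \<in> leading G x2 y2" "?u = p2 @ a' # b' # q2"
      proof -
        have "normal_word G (p2 @ [x2, Vertex v])" "normal_word G (y2 # q2)" using p1 q1 p2 q2 A B by auto
        then obtain c where c: "\<And>u. length u = length p2 + length q2 + 2 \<Longrightarrow>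
          lookup (word_op G (p2 @ [x2, Vertex v]) (frag_of (y2 # q2))) u =
            (if \<exists>a b. (a, b) \<in> leading G x2 y2 \<and> u = p2 @ a # b # q2 then c else 0)"
          using word_op_top[OF V] by blast
        have "length ?u = length p2 + length q2 + 2" using lens by simp
        from c[OF this] nz p2 q2 have "\<exists>a b. (a, b) \<in> leading G x2 y2 \<and> ?u = p2 @ a # b # q2"
          by (simp only: split: if_splits) blast
        then show ?thesis using that by blast
      qed
      \<comment> \<open>Both splittings of \<open>?u\<close> cut at the same positions, so the pairs
        in the middle agree and \<open>uniq\<close> applies.\<close>
      then show "p1 = p @ [x, Vertex v]" "q1 = y # q"
        using uniq[OF in_XY] lens p2 q2 by auto
    qed (use p q in auto)
  qed
qed

text \<open>The empty path is the only normal word, and it is idempotent.\<close>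

lemma edgeless_unique_products:
  assumes V: "verts G = {v}" and "sedges G = {}"
  shows "unique_products G"
proof -
  have normal: "u = [Vertex v]" if u: "normal_word G u" for u
  proof -
    obtain v' p where p: "u = p @ [Vertex v']" "v' \<in> verts G" "\<forall>x\<in>set p. x \<notin> range Vertex"
      using normal_snocE[OF u] by blast
    have letter: "x \<in> range Vertex" if "x \<in> letters G" for x
      using that assms(2) by (cases x) simp_all
    have "set p \<subseteq> letters G" using normal_letters[OF u] unfolding p(1) set_append by (rule le_supE)
    then have "x \<notin> set p" for x using p(3) letter[of x] by (meson subsetD)
    then have "p = []" by (cases p) auto
    then show ?thesis using p V by simp
  qed
  have op: "word_op G [Vertex v] (frag_of [Vertex v]) = frag_of [Vertex v]" by simp
  show ?thesis
    unfolding unique_products_def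
  proof (intro allI impI, elim conjE)
    fix A B :: "('v, 'e) letter list set"
    assume "A \<noteq> {}" "B \<noteq> {}" and AB: "\<forall>p\<in>A. normal_word G p" "\<forall>q\<in>B. normal_word G q"
    then obtain p q where pq: "p \<in> A" "q \<in> B" by auto
    then have [simp]: "p = [Vertex v]" "q = [Vertex v]" using normal AB by auto
    show "unique_product G A B"
      unfolding unique_product_def
    proof (intro bexI exI conjI ballI impI)
      show "lookup (word_op G p (frag_of q)) [Vertex v] \<in> {1, -1}" by simp
    qed (use pq normal AB in auto)
  qed
qed

text \<open>The loop is special and has only the index 1, so both mixed pairs of letters are redexes
  and the sums replacing them are empty. Multiplication then adds exponents, and the largest
  exponents on both sides give the unique product.\<close>

lemma single_loop_unique_products:
  assumes V: "verts G = {v}" and E: "sedges G = {\<alpha>}" and wt: "wt G \<alpha> = 1"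
  shows "unique_products G"
proof -
  \<comment> \<open>Powers with integer exponents; negative ones are powers of the ghost edge, which
    is the inverse of the edge.\<close>
  define pw :: "int \<Rightarrow> ('v, 'e) letter list" where
    "pw k = (if k \<ge> 0 then replicate (nat k) (Edge \<alpha> 1) else replicate (nat (- k)) (Ghost \<alpha> 1)) @ [Vertex v]" for k
  have st: "src G \<alpha> = v" "tgt G \<alpha> = v" using V E src_closed tgt_closed by auto
  have out: "out G v = {\<alpha>}" using E st by (auto simp: out_def)
  have sp: "special G v = \<alpha>" using special(1)[of v] out by auto
  have fv: "first_vertex G (pw k) = v" for k
  proof -
    consider n where "nat k = Suc n" "k \<ge> 0" | n where "nat (- k) = Suc n" "k < 0" | "k = 0"
      by (metis nat_0_iff neg_0_less_iff_less not0_implies_Suc not_le le_less zero_less_nat_eq)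
    then show ?thesis by cases (auto simp: pw_def st)
  qed
  have edge: "letter_op G (Edge \<alpha> 1) (pw k) = frag_of (pw (k + 1))" for k
  proof (cases "k \<ge> 0")
    case True
    then have eq: "pw (k + 1) = Edge \<alpha> 1 # pw k" by (simp add: pw_def nat_add_distrib)
    have "\<not> redex G (Edge \<alpha> 1) (pw k)"
      using True by (cases "nat k") (auto simp: pw_def)
    then show ?thesis using eq fv[of k] wt st by simp
  next
    case False
    then have "nat (- k) = Suc (nat (- (k + 1)))" by simp
    then have eq: "pw k = Ghost \<alpha> 1 # pw (k + 1)" using False by (auto simp: pw_def)
    then show ?thesis using wt st sp out by simp
  qed
  have ghost: "letter_op G (Ghost \<alpha> 1) (pw k) = frag_of (pw (k - 1))" for k
  proof (cases "k \<le> 0")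
    case True
    then have "nat (- (k - 1)) = Suc (nat (- k))" by simp
    then have eq: "pw (k - 1) = Ghost \<alpha> 1 # pw k" using True by (auto simp: pw_def)
    have "\<not> redex G (Ghost \<alpha> 1) (pw k)"
      using True by (cases "nat (- k)") (auto simp: pw_def)
    then show ?thesis using eq fv[of k] wt st by simp
  next
    case False
    then have "nat k = Suc (nat (k - 1))" by simp
    then have eq: "pw k = Edge \<alpha> 1 # pw (k - 1)" using False by (auto simp: pw_def)
    then show ?thesis using wt st sp out fv[of k] by simp
  qed
  have edges: "word_op G (replicate n (Edge \<alpha> 1)) (frag_of (pw l)) = frag_of (pw (int n + l))" for n l
    by (induction n) (simp_all add: edge algebra_simps del: letter_op.simps One_nat_def)
  have ghosts: "word_op G (replicate n (Ghost \<alpha> 1)) (frag_of (pw l)) = frag_of (pw (l - int n))" for n l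
    by (induction n) (simp_all add: ghost algebra_simps del: letter_op.simps One_nat_def)
  have mult: "word_op G (pw k) (frag_of (pw l)) = frag_of (pw (k + l))" for k l
  proof -
    have "word_op G [Vertex v] (frag_of (pw l)) = frag_of (pw l)" using fv[of l] by simp
    then show ?thesis
      unfolding pw_def[of k] word_op_append using edges[of "nat k" l] ghosts[of "nat (- k)" l]
      by (simp add: algebra_simps del: word_op.simps)
  qed
  have normal: "\<exists>k. u = pw k" if "normal_word G u" for u
    using that
  proof (induction u)
    case (Cons x u)
    show ?case
    proof (cases "x \<in> range Vertex")
      case True
      then obtain w where "x = Vertex w" by (rule imageE)
      then have "x # u = [Vertex v]" using Cons.prems V by simp
      then have "x # u = pw 0" by (simp add: pw_def)
      then show ?thesis by blast
    next
      case False
      then have nu: "normal_word G u" "x \<in> letters G" using Cons.prems by (auto simp: normal_Cons)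
      then obtain k where k: "u = pw k" using Cons.IH by auto
      have op: "letter_op G x u = frag_of (x # u)" using letter_op_normal[OF Cons.prems False] .
      have "x = Edge \<alpha> 1 \<or> x = Ghost \<alpha> 1" using nu False E wt by (cases x) auto
      \<comment> \<open>As \<open>x # u\<close> is normal, the action of \<open>x\<close> on
        \<open>u\<close> is just this word; computed by exponents, it is a neighbouring
        power.\<close>
      then have "frag_of (x # u) = frag_of (pw (k + 1)) \<or> frag_of (x # u) = frag_of (pw (k - 1))"
        using op edge[of k] ghost[of k] k by metis
      then show ?thesis unfolding frag_of_eq by blast
    qed
  qed simp
  \<comment> \<open>Recovers the exponent from the word, which makes \<open>pw\<close> injective and
    provides the maximum over a finite set.\<close>
  define deg :: "('v, 'e) letter list \<Rightarrow> int" where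
    "deg u = int (length (filter ((=) (Edge \<alpha> 1)) u)) - int (length (filter ((=) (Ghost \<alpha> 1)) u))" for u
  have "deg (pw k) = k" for k
    by (simp add: deg_def pw_def filter_replicate)
  then have inj: "pw k = pw l \<longleftrightarrow> k = l" for k l by metis
  show ?thesis
    unfolding unique_products_def
  proof (intro allI impI, elim conjE)
    fix A B :: "('v, 'e) letter list set"
    assume A: "finite A" "A \<noteq> {}" "\<forall>p\<in>A. normal_word G p" and B: "finite B" "B \<noteq> {}" "\<forall>q\<in>B. normal_word G q"
    have top: "\<exists>k. pw k \<in> S \<and> (\<forall>u\<in>S. \<exists>l\<le>k. u = pw l)" if "finite S" "S \<noteq> {}" "\<forall>p\<in>S. normal_word G p" for S
    proof -
      have "Max (deg ` S) \<in> deg ` S" using that by (intro Max_in) auto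
      then obtain u where u: "u \<in> S" "deg u = Max (deg ` S)" by auto
      have "deg w \<le> deg u" if "w \<in> S" for w using u that \<open>finite S\<close> by simp
      then show ?thesis using normal that u \<open>\<And>k. deg (pw k) = k\<close> by metis
    qed
    obtain k where k: "pw k \<in> A" "\<forall>u\<in>A. \<exists>l\<le>k. u = pw l" using top[OF A] by blast
    obtain l where l: "pw l \<in> B" "\<forall>u\<in>B. \<exists>l'\<le>l. u = pw l'" using top[OF B] by blast
    show "unique_product G A B"
      unfolding unique_product_def
    proof (intro bexI exI conjI ballI impI)
      show "lookup (word_op G (pw k) (frag_of (pw l))) (pw (k + l)) \<in> {1, -1}"
        by (simp add: mult)
      fix p q assume "p \<in> A" "q \<in> B" and nz: "lookup (word_op G p (frag_of q)) (pw (k + l)) \<noteq> 0"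
      then obtain k' l' where "k' \<le> k" "l' \<le> l" "p = pw k'" "q = pw l'" using k l by meson
      with nz show "p = pw k" "q = pw l" by (auto simp: mult inj split: if_splits)
    qed (use k l in auto)
  qed
qed

end

section \<open>Free rings\<close>

lemma (in abelian_monoid) finsum_swap:
  assumes "finite A" "finite B" "\<And>i j. i \<in> A \<Longrightarrow> j \<in> B \<Longrightarrow> f i j \<in> carrier G"
  shows "(\<Oplus>i\<in>A. \<Oplus>j\<in>B. f i j) = (\<Oplus>j\<in>B. \<Oplus>i\<in>A. f i j)"
  using assms(1,3)
proof (induction A)
  case empty
  then show ?case by simp
next
  case (insert a A)
  have "(\<Oplus>i\<in>insert a A. \<Oplus>j\<in>B. f i j) = (\<Oplus>j\<in>B. f a j) \<oplus> (\<Oplus>i\<in>A. \<Oplus>j\<in>B. f i j)"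
    using insert assms(2) by (intro finsum_insert) (auto intro!: finsum_closed)
  also have "\<dots> = (\<Oplus>j\<in>B. f a j \<oplus> (\<Oplus>i\<in>A. f i j))"
    using insert assms(2) by (subst finsum_addf) (auto intro!: finsum_closed)
  also have "\<dots> = (\<Oplus>j\<in>B. \<Oplus>i\<in>insert a A. f i j)"
    using insert by (intro finsum_cong') (auto intro!: finsum_closed)
  finally show ?case .
qed

lemma (in abelian_monoid) finsum_single:
  assumes "finite A" "i \<in> A" "f i \<in> carrier G" "\<And>j. j \<in> A \<Longrightarrow> j \<noteq> i \<Longrightarrow> f j = \<zero>"
  shows "(\<Oplus>j\<in>A. f j) = f i"
proof -
  have "(\<Oplus>j\<in>A. f j) = (\<Oplus>j\<in>A. if i = j then f j else \<zero>)"
    using assms by (intro finsum_cong') auto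
  also have "\<dots> = f i"
  proof -
    have "(\<Oplus>j\<in>A. if i = j then f j else \<zero>) = (\<Oplus>j\<in>A. if i = j then (\<lambda>_. f i) j else \<zero>)"
      using assms by (intro finsum_cong') auto
    also have "\<dots> = f i"
      using assms by (subst finsum_singleton) auto
    finally show ?thesis .
  qed
  finally show ?thesis .
qed

lemma (in abelian_monoid) finsum_superset:
  assumes "finite B" "A \<subseteq> B" "f \<in> B \<rightarrow> carrier G" "\<And>j. j \<in> B - A \<Longrightarrow> f j = \<zero>"
  shows "finsum G f A = finsum G f B"
  using assms by (intro add.finprod_mono_neutral_cong_left) auto

context ring
begin

section \<open>Integer multiples in a ring\<close>

lemma zmult_closed [simp, intro]: "x \<in> carrier R \<Longrightarrow> [(n::int)] \<cdot> x \<in> carrier R"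
  by (rule add.int_pow_closed)

lemma zmult_simps [simp]:
  "[(0::int)] \<cdot> x = \<zero>" "x \<in> carrier R \<Longrightarrow> [(1::int)] \<cdot> x = x" "[(n::int)] \<cdot> \<zero> = \<zero>"
  "x \<in> carrier R \<Longrightarrow> [(-1::int)] \<cdot> x = \<ominus> x"
  using add.int_pow_neg[of x 1] add.int_pow_one[of n] add.int_pow_1[of x] by (simp_all add: add_pow_def)

lemma zmult_add: "x \<in> carrier R \<Longrightarrow> [(m + n :: int)] \<cdot> x = [m] \<cdot> x \<oplus> [n] \<cdot> x"
  using add.int_pow_mult by blast

lemma zmult_neg: "x \<in> carrier R \<Longrightarrow> [(- n :: int)] \<cdot> x = \<ominus> ([n] \<cdot> x)"
  using add.int_pow_neg by blast

lemma zmult_zmult: "x \<in> carrier R \<Longrightarrow> [(m * n :: int)] \<cdot> x = [m] \<cdot> ([n] \<cdot> x)"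
  using add.int_pow_pow[of x m n] by (simp add: mult.commute)

lemma zmult_plus: "x \<in> carrier R \<Longrightarrow> y \<in> carrier R \<Longrightarrow> [(n::int)] \<cdot> (x \<oplus> y) = [n] \<cdot> x \<oplus> [n] \<cdot> y"
  using add.int_pow_distrib by blast

lemma zmult_finsum:
  "finite A \<Longrightarrow> f \<in> A \<rightarrow> carrier R \<Longrightarrow> [(n::int)] \<cdot> (\<Oplus>i\<in>A. f i) = (\<Oplus>i\<in>A. [n] \<cdot> f i)"
proof (induction A rule: finite_induct)
  case (insert a A)
  then have "f \<in> A \<rightarrow> carrier R" "f a \<in> carrier R" by auto
  then show ?case using insert by (simp add: zmult_plus Pi_def finsum_closed)
qed simp

lemma finsum_zmult:
  "finite A \<Longrightarrow> x \<in> carrier R \<Longrightarrow> (\<Oplus>i\<in>A. [(f i :: int)] \<cdot> x) = [(\<Sum>i\<in>A. f i)] \<cdot> x"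
proof (induction A rule: finite_induct)
  case (insert a A)
  then show ?case by (simp add: zmult_add Pi_def)
qed simp

section \<open>The ring of finitely supported functions on words\<close>

definition supp :: "('x \<Rightarrow> 'a) \<Rightarrow> 'x set" where
  "supp f = {w. f w \<noteq> \<zero>}"

abbreviation FR :: "'x set \<Rightarrow> ('a, 'x list \<Rightarrow> 'a) module" where
  "FR X \<equiv> free_ring R X"

lemma free_carrier:
  "f \<in> carrier (FR X) \<longleftrightarrow> (\<forall>w. f w \<in> carrier R) \<and> finite (supp f) \<and> supp f \<subseteq> lists X - {[]}"
  by (simp add: free_ring_def supp_def)

lemma free_simps:
  "f \<oplus>\<^bsub>FR X\<^esub> g = (\<lambda>w. f w \<oplus> g w)" "\<zero>\<^bsub>FR X\<^esub> = (\<lambda>w. \<zero>)"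
  "c \<odot>\<^bsub>FR X\<^esub> f = (\<lambda>w. c \<otimes> f w)"
  "(f \<otimes>\<^bsub>FR X\<^esub> g) w = (\<Oplus>i\<in>{1..<length w}. f (take i w) \<otimes> g (drop i w))"
  by (simp_all add: free_ring_def)

lemma free_add_closed:
  assumes "f \<in> carrier (FR X)" "g \<in> carrier (FR X)"
  shows "f \<oplus>\<^bsub>FR X\<^esub> g \<in> carrier (FR X)"
proof -
  have "supp (\<lambda>w. f w \<oplus> g w) \<subseteq> supp f \<union> supp g"
    by (auto simp: supp_def)
  then show ?thesis using assms finite_subset unfolding free_carrier free_simps by blast
qed

lemma free_scale_closed:
  assumes "f \<in> carrier (FR X)" "c \<in> carrier R"
  shows "c \<odot>\<^bsub>FR X\<^esub> f \<in> carrier (FR X)"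
proof -
  have "supp (\<lambda>w. c \<otimes> f w) \<subseteq> supp f"
    using assms by (auto simp: supp_def)
  then show ?thesis using assms finite_subset unfolding free_carrier free_simps by blast
qed

lemma free_neg_closed:
  assumes "f \<in> carrier (FR X)"
  shows "(\<lambda>w. \<ominus> f w) \<in> carrier (FR X)"
proof -
  have "supp (\<lambda>w. \<ominus> f w) \<subseteq> supp f"
    using assms by (auto simp: supp_def free_carrier)
  then show ?thesis using assms finite_subset unfolding free_carrier by blast
qed

lemma free_abelian_group: "abelian_group (FR X)"
proof (rule abelian_groupI)
  show "\<zero>\<^bsub>FR X\<^esub> \<in> carrier (FR X)" by (simp add: free_carrier free_simps supp_def)
  fix f assume f: "f \<in> carrier (FR X)"
  show "\<exists>y\<in>carrier (FR X). y \<oplus>\<^bsub>FR X\<^esub> f = \<zero>\<^bsub>FR X\<^esub>"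
    using free_neg_closed[OF f] f by (intro bexI[of _ "\<lambda>w. \<ominus> f w"]) (auto simp: free_simps free_carrier l_neg)
next
  fix f g assume "f \<in> carrier (FR X)" "g \<in> carrier (FR X)"
  then show "f \<oplus>\<^bsub>FR X\<^esub> g \<in> carrier (FR X)" by (rule free_add_closed)
qed (auto simp: free_simps free_carrier a_ac)

lemma free_neg:
  assumes "f \<in> carrier (FR X)"
  shows "\<ominus>\<^bsub>FR X\<^esub> f = (\<lambda>w. \<ominus> f w)"
proof -
  interpret F: abelian_group "FR X" by (rule free_abelian_group)
  have "(\<lambda>w. \<ominus> f w) \<oplus>\<^bsub>FR X\<^esub> f = \<zero>\<^bsub>FR X\<^esub>" using assms by (auto simp: free_simps free_carrier l_neg)
  then show ?thesis using F.minus_equality assms free_neg_closed by blast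
qed

lemma free_minus:
  assumes "f \<in> carrier (FR X)" "g \<in> carrier (FR X)"
  shows "f \<ominus>\<^bsub>FR X\<^esub> g = (\<lambda>w. f w \<ominus> g w)"
  using assms by (simp add: a_minus_def free_neg free_simps)

lemma free_finsum:
  assumes "finite A" "\<And>i. i \<in> A \<Longrightarrow> f i \<in> carrier (FR X)"
  shows "(\<Oplus>\<^bsub>FR X\<^esub>i\<in>A. f i) w = (\<Oplus>i\<in>A. f i w)"
  using assms
proof (induction A)
  case empty
  interpret F: abelian_group "FR X" by (rule free_abelian_group)
  show ?case by (simp add: free_simps)
next
  case (insert a A)
  interpret F: abelian_group "FR X" by (rule free_abelian_group)
  have "f \<in> A \<rightarrow> carrier (FR X)" "f a \<in> carrier (FR X)" using insert by auto
  moreover have "(\<lambda>i. f i w) \<in> A \<rightarrow> carrier R" "f a w \<in> carrier R" using insert by (auto simp: free_carrier)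
  ultimately show ?case using insert by (simp add: free_simps)
qed

text \<open>A factorisation of \<open>w\<close> is determined by its first factor, so summing over
  cut points or over pairs of supporting words is the same. The double sum is the convenient form,
  since its index sets do not depend on \<open>w\<close>.\<close>

lemma free_mult_apply:
  assumes f: "f \<in> carrier (FR X)" and g: "g \<in> carrier (FR X)"
    and S: "finite S" "supp f \<subseteq> S" and T: "finite T" "supp g \<subseteq> T"
  shows "(f \<otimes>\<^bsub>FR X\<^esub> g) w = (\<Oplus>p\<in>S. \<Oplus>q\<in>T. if p @ q = w then f p \<otimes> g q else \<zero>)"
proof -
  have fc: "\<And>u. f u \<in> carrier R" and gc: "\<And>u. g u \<in> carrier R" using f g by (auto simp: free_carrier)
  have f0: "f [] = \<zero>" and g0: "g [] = \<zero>" using f g by (auto simp: free_carrier supp_def)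
  have inner: "(\<Oplus>q\<in>T. if p @ q = w then f p \<otimes> g q else \<zero>) =
    (if take (length p) w = p then f p \<otimes> g (drop (length p) w) else \<zero>)" for p
  proof (cases "take (length p) w = p")
    case True
    then have pq: "p @ q = w \<longleftrightarrow> q = drop (length p) w" for q
      by (metis append_eq_conv_conj append_take_drop_id)
    show ?thesis
    proof (cases "drop (length p) w \<in> T")
      case in_T: True
      have "(\<Oplus>q\<in>T. if p @ q = w then f p \<otimes> g q else \<zero>) =
        (if p @ drop (length p) w = w then f p \<otimes> g (drop (length p) w) else \<zero>)"
        using T in_T fc gc pq by (intro finsum_single) auto
      moreover have "p @ drop (length p) w = w" using pq by blast
      ultimately show ?thesis by (simp only: True if_True refl)
    next
      case False
      then have g0': "g (drop (length p) w) = \<zero>" using T by (auto simp: supp_def)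
      moreover have "(\<Oplus>q\<in>T. if p @ q = w then f p \<otimes> g q else \<zero>) = \<zero>"
        using False pq by (intro add.finprod_one_eqI) auto
      ultimately show ?thesis using fc g0' by simp
    qed
  next
    case False
    then have "p @ q \<noteq> w" for q by auto
    then show ?thesis using False by simp
  qed
  let ?I = "{1..<length w}" and ?t = "\<lambda>p. if take (length p) w = p then f p \<otimes> g (drop (length p) w) else \<zero>"
  have "(\<Oplus>i\<in>?I. f (take i w) \<otimes> g (drop i w)) = (\<Oplus>i\<in>?I. ?t (take i w))"
    using fc gc by (intro finsum_cong') (auto simp: min_def)
  also have "\<dots> = (\<Oplus>p\<in>(\<lambda>i. take i w) ` ?I. ?t p)"
    using fc gc by (intro finsum_reindex[symmetric] inj_onI)
      (auto, metis less_imp_le_nat length_take min.absorb2)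
  also have "\<dots> = (\<Oplus>p\<in>(\<lambda>i. take i w) ` ?I \<union> S. ?t p)"
  proof (rule finsum_superset)
    fix p assume p: "p \<in> (\<lambda>i. take i w) ` ?I \<union> S - (\<lambda>i. take i w) ` ?I"
    show "?t p = \<zero>"
    proof (cases "take (length p) w = p")
      case True
      \<comment> \<open>The cuts missing from the range leave an empty factor, on which
        \<open>f\<close> or \<open>g\<close> vanishes.\<close>
      then have "length p \<notin> ?I" using p image_eqI[of p "\<lambda>i. take i w" "length p" ?I] by auto
      then have "p = [] \<or> drop (length p) w = []" by (cases p) auto
      then show ?thesis using f0 g0 fc gc by auto
    qed auto
  qed (use S fc gc in auto)
  also have "\<dots> = (\<Oplus>p\<in>S. ?t p)"
  proof (rule finsum_superset[symmetric])
    fix p assume "p \<in> (\<lambda>i. take i w) ` ?I \<union> S - S"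
    then have "f p = \<zero>" using S by (auto simp: supp_def)
    then show "?t p = \<zero>" using gc by simp
  qed (use S fc gc in auto)
  finally show ?thesis unfolding free_simps inner .
qed

lemma free_mult_supp:
  assumes f: "f \<in> carrier (FR X)" and g: "g \<in> carrier (FR X)"
  shows "supp (f \<otimes>\<^bsub>FR X\<^esub> g) \<subseteq> (\<lambda>(p, q). p @ q) ` (supp f \<times> supp g)"
proof
  fix w assume w: "w \<in> supp (f \<otimes>\<^bsub>FR X\<^esub> g)"
  show "w \<in> (\<lambda>(p, q). p @ q) ` (supp f \<times> supp g)"
  proof (rule ccontr)
    assume "w \<notin> (\<lambda>(p, q). p @ q) ` (supp f \<times> supp g)"
    then have "p @ q \<noteq> w" if "p \<in> supp f" "q \<in> supp g" for p q using that by force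
    then have "(\<Oplus>p\<in>supp f. \<Oplus>q\<in>supp g. if p @ q = w then f p \<otimes> g q else \<zero>) = \<zero>"
      by (intro add.finprod_one_eqI) auto
    moreover have "(f \<otimes>\<^bsub>FR X\<^esub> g) w = (\<Oplus>p\<in>supp f. \<Oplus>q\<in>supp g. if p @ q = w then f p \<otimes> g q else \<zero>)"
      using assms by (intro free_mult_apply) (auto simp: free_carrier)
    ultimately show False using w by (simp add: supp_def)
  qed
qed

lemma free_mult_closed:
  assumes f: "f \<in> carrier (FR X)" and g: "g \<in> carrier (FR X)"
  shows "f \<otimes>\<^bsub>FR X\<^esub> g \<in> carrier (FR X)"
proof -
  have "finite (supp f)" "finite (supp g)" using assms by (auto simp: free_carrier)
  then have "finite (supp (f \<otimes>\<^bsub>FR X\<^esub> g))"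
    using free_mult_supp[OF assms] by (meson finite_SigmaI finite_imageI finite_subset)
  moreover have "supp (f \<otimes>\<^bsub>FR X\<^esub> g) \<subseteq> lists X - {[]}"
  proof
    fix w assume "w \<in> supp (f \<otimes>\<^bsub>FR X\<^esub> g)"
    then obtain p q where "p \<in> supp f" "q \<in> supp g" "w = p @ q" using free_mult_supp[OF assms] by auto
    moreover from this have "p \<in> lists X - {[]}" "q \<in> lists X - {[]}" using assms by (auto simp: free_carrier)
    ultimately show "w \<in> lists X - {[]}" by auto
  qed
  moreover have "(f \<otimes>\<^bsub>FR X\<^esub> g) w \<in> carrier R" for w
    unfolding free_simps using assms by (intro finsum_closed) (auto simp: free_carrier)
  ultimately show ?thesis by (simp add: free_carrier)
qed

lemma free_nonunital_ring: "nonunital_ring (FR (X :: 'c set))"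
proof -
  interpret F: abelian_group "FR X" by (rule free_abelian_group)
  show ?thesis
  proof
    fix f g h assume fgh: "f \<in> carrier (FR X)" "g \<in> carrier (FR X)" "h \<in> carrier (FR X)"
    then have c: "f w \<in> carrier R" "g w \<in> carrier R" "h w \<in> carrier R" for w by (auto simp: free_carrier)
    show "f \<otimes>\<^bsub>FR X\<^esub> g \<in> carrier (FR X)" using fgh free_mult_closed by blast
    show "(f \<oplus>\<^bsub>FR X\<^esub> g) \<otimes>\<^bsub>FR X\<^esub> h = f \<otimes>\<^bsub>FR X\<^esub> h \<oplus>\<^bsub>FR X\<^esub> g \<otimes>\<^bsub>FR X\<^esub> h"
      unfolding fun_eq_iff free_simps using c by (simp add: l_distr finsum_addf Pi_def)
    show "h \<otimes>\<^bsub>FR X\<^esub> (f \<oplus>\<^bsub>FR X\<^esub> g) = h \<otimes>\<^bsub>FR X\<^esub> f \<oplus>\<^bsub>FR X\<^esub> h \<otimes>\<^bsub>FR X\<^esub> g"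
      unfolding fun_eq_iff free_simps using c by (simp add: r_distr finsum_addf Pi_def)
    show "(f \<otimes>\<^bsub>FR X\<^esub> g) \<otimes>\<^bsub>FR X\<^esub> h = f \<otimes>\<^bsub>FR X\<^esub> (g \<otimes>\<^bsub>FR X\<^esub> h)"
    proof
      fix w :: "'c list"
      let ?n = "length w"
      let ?T = "\<lambda>j i. f (take j w) \<otimes> g (drop j (take i w)) \<otimes> h (drop i w)"
      \<comment> \<open>Both bracketings sum over two cut points \<open>j < i\<close> of
        \<open>w\<close>. Extending the triangle by zeros to a square permits the exchange of the
        sums.\<close>
      have "((f \<otimes>\<^bsub>FR X\<^esub> g) \<otimes>\<^bsub>FR X\<^esub> h) w = (\<Oplus>i\<in>{1..<?n}. \<Oplus>j\<in>{1..<i}. ?T j i)"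
        unfolding free_simps using c
        by (intro finsum_cong') (auto simp: finsum_ldistr min_def intro!: finsum_closed finsum_cong')
      also have "\<dots> = (\<Oplus>i\<in>{1..<?n}. \<Oplus>j\<in>{1..<?n}. if j < i then ?T j i else \<zero>)"
        using c by (intro finsum_cong' refl add.finprod_mono_neutral_cong_left) (auto intro!: finsum_closed)
      also have "\<dots> = (\<Oplus>j\<in>{1..<?n}. \<Oplus>i\<in>{1..<?n}. if j < i then ?T j i else \<zero>)"
        using c by (intro finsum_swap) auto
      \<comment> \<open>The other bracketing measures the second cut from the first one, as
        \<open>i = j + k\<close>.\<close>
      also have "\<dots> = (\<Oplus>j\<in>{1..<?n}. \<Oplus>i\<in>(\<lambda>k. j + k) ` {1..<?n - j}. ?T j i)"
      proof (rule finsum_cong'[OF refl])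
        fix j assume j: "j \<in> {1..<?n}"
        have "(\<lambda>k. j + k) ` {1..<?n - j} = {j + 1..<?n}"
          using j by (simp add: add.commute)
        then show "(\<Oplus>i\<in>{1..<?n}. if j < i then ?T j i else \<zero>) = (\<Oplus>i\<in>(\<lambda>k. j + k) ` {1..<?n - j}. ?T j i)"
          using c j by (intro add.finprod_mono_neutral_cong_right) auto
      qed (use c in \<open>auto intro!: finsum_closed\<close>)
      also have "\<dots> = (\<Oplus>j\<in>{1..<?n}. \<Oplus>k\<in>{1..<?n - j}. ?T j (j + k))"
      proof (rule finsum_cong'[OF refl])
        fix j
        show "(\<Oplus>i\<in>(\<lambda>k. j + k) ` {1..<?n - j}. ?T j i) = (\<Oplus>k\<in>{1..<?n - j}. ?T j (j + k))"
          using c by (intro finsum_reindex) auto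
      qed (use c in \<open>auto intro!: finsum_closed\<close>)
      also have "\<dots> = (f \<otimes>\<^bsub>FR X\<^esub> (g \<otimes>\<^bsub>FR X\<^esub> h)) w"
        unfolding free_simps
      proof (rule finsum_cong'[OF refl])
        fix j
        have "(\<Oplus>k\<in>{1..<?n - j}. ?T j (j + k)) =
          (\<Oplus>k\<in>{1..<?n - j}. f (take j w) \<otimes> (g (take k (drop j w)) \<otimes> h (drop k (drop j w))))"
        proof (rule finsum_cong'[OF refl])
          fix k
          have "drop j (take (j + k) w) = take k (drop j w)" "drop (j + k) w = drop k (drop j w)"
            by (simp_all add: take_drop add.commute)
          then show "?T j (j + k) = f (take j w) \<otimes> (g (take k (drop j w)) \<otimes> h (drop k (drop j w)))"
            using c by (simp add: m_assoc)
        qed (use c in auto)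
        also have "\<dots> = f (take j w) \<otimes> (\<Oplus>k\<in>{1..<length (drop j w)}. g (take k (drop j w)) \<otimes> h (drop k (drop j w)))"
          using c by (subst finsum_rdistr) auto
        finally show "(\<Oplus>k\<in>{1..<?n - j}. ?T j (j + k)) =
          f (take j w) \<otimes> (\<Oplus>k\<in>{1..<length (drop j w)}. g (take k (drop j w)) \<otimes> h (drop k (drop j w)))" .
      qed (use c in \<open>auto intro!: finsum_closed\<close>)
      finally show "((f \<otimes>\<^bsub>FR X\<^esub> g) \<otimes>\<^bsub>FR X\<^esub> h) w = (f \<otimes>\<^bsub>FR X\<^esub> (g \<otimes>\<^bsub>FR X\<^esub> h)) w" .
    qed
  qed
qed

text \<open>
  Integer-valued functions on words extend to functionals on the free \<open>R\<close>-ring (\<open>ev\<close>), and integer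
  combinations of words give elements of it (\<open>lin\<close>). This way all calculations with words take place
  over the integers.
\<close>

definition ev :: "('x list \<Rightarrow> int) \<Rightarrow> ('x list \<Rightarrow> 'a) \<Rightarrow> 'a" where
  "ev \<phi> f = (\<Oplus>w\<in>supp f. [\<phi> w] \<cdot> f w)"

lemma ev_superset:
  assumes "f \<in> carrier (FR X)" "finite S" "supp f \<subseteq> S"
  shows "ev \<phi> f = (\<Oplus>w\<in>S. [\<phi> w] \<cdot> f w)"
  unfolding ev_def using assms
  by (intro finsum_superset) (auto simp: free_carrier supp_def)

lemma ev_closed: "f \<in> carrier (FR X) \<Longrightarrow> ev \<phi> f \<in> carrier R"
  unfolding ev_def by (intro finsum_closed) (auto simp: free_carrier)

lemma ev_add:
  assumes f: "f \<in> carrier (FR X)" and g: "g \<in> carrier (FR X)"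
  shows "ev \<phi> (f \<oplus>\<^bsub>FR X\<^esub> g) = ev \<phi> f \<oplus> ev \<phi> g"
proof -
  have c: "\<And>w. f w \<in> carrier R" "\<And>w. g w \<in> carrier R" using f g by (auto simp: free_carrier)
  let ?S = "supp f \<union> supp g"
  have S: "finite ?S" using f g by (auto simp: free_carrier)
  have "supp (f \<oplus>\<^bsub>FR X\<^esub> g) \<subseteq> ?S" by (auto simp: supp_def free_simps)
  then have "ev \<phi> (f \<oplus>\<^bsub>FR X\<^esub> g) = (\<Oplus>w\<in>?S. [\<phi> w] \<cdot> (f w \<oplus> g w))"
    using ev_superset[OF free_add_closed[OF f g] S] by (simp add: free_simps)
  also have "\<dots> = (\<Oplus>w\<in>?S. [\<phi> w] \<cdot> f w \<oplus> [\<phi> w] \<cdot> g w)"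
    using c by (intro finsum_cong') (auto simp: zmult_plus)
  also have "\<dots> = ev \<phi> f \<oplus> ev \<phi> g"
    using c ev_superset[OF f S] ev_superset[OF g S] by (simp add: finsum_addf Pi_def)
  finally show ?thesis .
qed

lemma ev_scale:
  assumes f: "f \<in> carrier (FR X)" and r: "r \<in> carrier R"
  shows "ev \<phi> (r \<odot>\<^bsub>FR X\<^esub> f) = r \<otimes> ev \<phi> f"
proof -
  have c: "\<And>w. f w \<in> carrier R" and S: "finite (supp f)" using f by (auto simp: free_carrier)
  have "supp (r \<odot>\<^bsub>FR X\<^esub> f) \<subseteq> supp f" using r by (auto simp: supp_def free_simps)
  then have "ev \<phi> (r \<odot>\<^bsub>FR X\<^esub> f) = (\<Oplus>w\<in>supp f. [\<phi> w] \<cdot> (r \<otimes> f w))"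
    using ev_superset[OF free_scale_closed[OF f r] S] by (simp add: free_simps)
  also have "\<dots> = (\<Oplus>w\<in>supp f. r \<otimes> ([\<phi> w] \<cdot> f w))"
    using c r by (intro finsum_cong') (auto simp: add_pow_rdistr_int)
  also have "\<dots> = r \<otimes> ev \<phi> f"
    unfolding ev_def using c r S by (subst finsum_rdistr) auto
  finally show ?thesis .
qed

lemma ev_neg:
  assumes f: "f \<in> carrier (FR X)"
  shows "ev \<phi> (\<ominus>\<^bsub>FR X\<^esub> f) = \<ominus> ev \<phi> f"
proof -
  interpret F: abelian_group "FR X" by (rule free_abelian_group)
  have "ev \<phi> f \<oplus> ev \<phi> (\<ominus>\<^bsub>FR X\<^esub> f) = ev \<phi> (\<zero>\<^bsub>FR X\<^esub>)"
    using f by (simp add: ev_add[symmetric] F.r_neg)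
  also have "\<dots> = \<zero>" by (simp add: ev_def supp_def free_simps)
  finally show ?thesis using ev_closed f F.a_inv_closed by (metis minus_equality add.m_comm)
qed

text \<open>Each pair of supporting words contributes to exactly one concatenation, so the sum over
  product words collapses. The functional need not be multiplicative.\<close>

lemma ev_mult:
  assumes f: "f \<in> carrier (FR X)" and g: "g \<in> carrier (FR X)"
  shows "ev \<phi> (f \<otimes>\<^bsub>FR X\<^esub> g) = (\<Oplus>p\<in>supp f. \<Oplus>q\<in>supp g. [\<phi> (p @ q)] \<cdot> (f p \<otimes> g q))"
proof -
  have c: "\<And>w. f w \<in> carrier R" "\<And>w. g w \<in> carrier R" and S: "finite (supp f)" "finite (supp g)"
    using f g by (auto simp: free_carrier)
  let ?W = "(\<lambda>(p, q). p @ q) ` (supp f \<times> supp g)"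
  have W: "finite ?W" using S by simp
  have "ev \<phi> (f \<otimes>\<^bsub>FR X\<^esub> g) = (\<Oplus>w\<in>?W. [\<phi> w] \<cdot> (f \<otimes>\<^bsub>FR X\<^esub> g) w)"
    by (rule ev_superset[OF free_mult_closed[OF f g] W free_mult_supp[OF f g]])
  also have "\<dots> = (\<Oplus>w\<in>?W. \<Oplus>p\<in>supp f. \<Oplus>q\<in>supp g. if p @ q = w then [\<phi> (p @ q)] \<cdot> (f p \<otimes> g q) else \<zero>)"
  proof (rule finsum_cong'[OF refl])
    fix w assume "w \<in> ?W"
    have "[\<phi> w] \<cdot> (f \<otimes>\<^bsub>FR X\<^esub> g) w =
      [\<phi> w] \<cdot> (\<Oplus>p\<in>supp f. \<Oplus>q\<in>supp g. if p @ q = w then f p \<otimes> g q else \<zero>)"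
      using free_mult_apply[OF f g S(1) _ S(2)] by simp
    also have "\<dots> = (\<Oplus>p\<in>supp f. [\<phi> w] \<cdot> (\<Oplus>q\<in>supp g. if p @ q = w then f p \<otimes> g q else \<zero>))"
      using S c by (intro zmult_finsum) (auto intro!: finsum_closed)
    also have "\<dots> = (\<Oplus>p\<in>supp f. \<Oplus>q\<in>supp g. if p @ q = w then [\<phi> (p @ q)] \<cdot> (f p \<otimes> g q) else \<zero>)"
    proof (rule finsum_cong'[OF refl])
      fix p
      have "[\<phi> w] \<cdot> (\<Oplus>q\<in>supp g. if p @ q = w then f p \<otimes> g q else \<zero>) =
        (\<Oplus>q\<in>supp g. [\<phi> w] \<cdot> (if p @ q = w then f p \<otimes> g q else \<zero>))"
        using S c by (intro zmult_finsum) auto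
      also have "\<dots> = (\<Oplus>q\<in>supp g. if p @ q = w then [\<phi> (p @ q)] \<cdot> (f p \<otimes> g q) else \<zero>)"
        using c by (intro finsum_cong') auto
      finally show "[\<phi> w] \<cdot> (\<Oplus>q\<in>supp g. if p @ q = w then f p \<otimes> g q else \<zero>) =
        (\<Oplus>q\<in>supp g. if p @ q = w then [\<phi> (p @ q)] \<cdot> (f p \<otimes> g q) else \<zero>)" .
    qed (use c in \<open>auto intro!: finsum_closed\<close>)
    finally show "[\<phi> w] \<cdot> (f \<otimes>\<^bsub>FR X\<^esub> g) w =
      (\<Oplus>p\<in>supp f. \<Oplus>q\<in>supp g. if p @ q = w then [\<phi> (p @ q)] \<cdot> (f p \<otimes> g q) else \<zero>)" .
  qed (use c in \<open>auto intro!: finsum_closed\<close>)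
  also have "\<dots> = (\<Oplus>p\<in>supp f. \<Oplus>w\<in>?W. \<Oplus>q\<in>supp g. if p @ q = w then [\<phi> (p @ q)] \<cdot> (f p \<otimes> g q) else \<zero>)"
    using c S W by (intro finsum_swap) (auto intro!: finsum_closed)
  also have "\<dots> = (\<Oplus>p\<in>supp f. \<Oplus>q\<in>supp g. [\<phi> (p @ q)] \<cdot> (f p \<otimes> g q))"
  proof (rule finsum_cong'[OF refl])
    fix p assume p: "p \<in> supp f"
    have "(\<Oplus>w\<in>?W. \<Oplus>q\<in>supp g. if p @ q = w then [\<phi> (p @ q)] \<cdot> (f p \<otimes> g q) else \<zero>) =
      (\<Oplus>q\<in>supp g. \<Oplus>w\<in>?W. if p @ q = w then [\<phi> (p @ q)] \<cdot> (f p \<otimes> g q) else \<zero>)"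
      using c S W by (intro finsum_swap) auto
    also have "\<dots> = (\<Oplus>q\<in>supp g. [\<phi> (p @ q)] \<cdot> (f p \<otimes> g q))"
    proof (rule finsum_cong'[OF refl])
      fix q assume q: "q \<in> supp g"
      have "p @ q \<in> ?W" using p q by force
      then show "(\<Oplus>w\<in>?W. if p @ q = w then [\<phi> (p @ q)] \<cdot> (f p \<otimes> g q) else \<zero>) = [\<phi> (p @ q)] \<cdot> (f p \<otimes> g q)"
        using W c by (subst finsum_singleton) auto
    qed (use c in auto)
    finally show "(\<Oplus>w\<in>?W. \<Oplus>q\<in>supp g. if p @ q = w then [\<phi> (p @ q)] \<cdot> (f p \<otimes> g q) else \<zero>) =
      (\<Oplus>q\<in>supp g. [\<phi> (p @ q)] \<cdot> (f p \<otimes> g q))" .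
  qed (use c in \<open>auto intro!: finsum_closed\<close>)
  finally show ?thesis .
qed

text \<open>Linearity in the functional rather than in the ring element. It reduces the functionals
  of a product to those of a factor known to vanish.\<close>

lemma ev_combination:
  assumes f: "f \<in> carrier (FR X)" and W: "finite W" and 0: "\<And>w. w \<in> W \<Longrightarrow> ev (\<psi> w) f = \<zero>"
    and \<phi>: "\<And>p. p \<in> supp f \<Longrightarrow> \<phi> p = (\<Sum>w\<in>W. n w * \<psi> w p)"
  shows "ev \<phi> f = \<zero>"
proof -
  have c: "\<And>w. f w \<in> carrier R" and S: "finite (supp f)" using f by (auto simp: free_carrier)
  have "ev \<phi> f = (\<Oplus>p\<in>supp f. \<Oplus>w\<in>W. [n w] \<cdot> ([\<psi> w p] \<cdot> f p))"
    unfolding ev_def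
  proof (rule finsum_cong'[OF refl])
    fix p assume p: "p \<in> supp f"
    have "(\<Oplus>w\<in>W. [n w] \<cdot> ([\<psi> w p] \<cdot> f p)) = (\<Oplus>w\<in>W. [(n w * \<psi> w p)] \<cdot> f p)"
      using c by (intro finsum_cong') (auto simp: zmult_zmult)
    then show "[\<phi> p] \<cdot> f p = (\<Oplus>w\<in>W. [n w] \<cdot> ([\<psi> w p] \<cdot> f p))"
      using finsum_zmult[OF W c] \<phi>[OF p] by simp
  qed (use c in \<open>auto intro!: finsum_closed\<close>)
  also have "\<dots> = (\<Oplus>w\<in>W. \<Oplus>p\<in>supp f. [n w] \<cdot> ([\<psi> w p] \<cdot> f p))"
    using c S W by (intro finsum_swap) auto
  also have "\<dots> = (\<Oplus>w\<in>W. \<zero>)"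
  proof (rule finsum_cong'[OF refl])
    fix w assume w: "w \<in> W"
    have "(\<Oplus>p\<in>supp f. [n w] \<cdot> ([\<psi> w p] \<cdot> f p)) = [n w] \<cdot> ev (\<psi> w) f"
      unfolding ev_def using c S by (intro zmult_finsum[symmetric]) auto
    then show "(\<Oplus>p\<in>supp f. [n w] \<cdot> ([\<psi> w p] \<cdot> f p)) = \<zero>" using 0[OF w] by simp
  qed auto
  finally show ?thesis by simp
qed

text \<open>Integer multiples pass through products, so the coefficient \<open>g q\<close> can be
  pulled out on the right without commuting with the coefficients of \<open>f\<close>.\<close>

lemma ev_mult_left_0:
  assumes f: "f \<in> carrier (FR X)" and g: "g \<in> carrier (FR X)"
    and 0: "\<And>q. q \<in> supp g \<Longrightarrow> ev (\<lambda>p. \<phi> (p @ q)) f = \<zero>"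
  shows "ev \<phi> (f \<otimes>\<^bsub>FR X\<^esub> g) = \<zero>"
proof -
  have c: "\<And>w. f w \<in> carrier R" "\<And>w. g w \<in> carrier R" and S: "finite (supp f)" "finite (supp g)"
    using f g by (auto simp: free_carrier)
  have "ev \<phi> (f \<otimes>\<^bsub>FR X\<^esub> g) = (\<Oplus>q\<in>supp g. \<Oplus>p\<in>supp f. [\<phi> (p @ q)] \<cdot> (f p \<otimes> g q))"
    unfolding ev_mult[OF f g] using c S by (intro finsum_swap) auto
  also have "\<dots> = (\<Oplus>q\<in>supp g. \<zero>)"
  proof (rule finsum_cong'[OF refl])
    fix q assume q: "q \<in> supp g"
    have "(\<Oplus>p\<in>supp f. [\<phi> (p @ q)] \<cdot> (f p \<otimes> g q)) = (\<Oplus>p\<in>supp f. [\<phi> (p @ q)] \<cdot> f p \<otimes> g q)"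
      using c by (intro finsum_cong') (auto simp: add_pow_ldistr_int)
    also have "\<dots> = ev (\<lambda>p. \<phi> (p @ q)) f \<otimes> g q"
      unfolding ev_def using c S by (intro finsum_ldistr[symmetric]) auto
    finally show "(\<Oplus>p\<in>supp f. [\<phi> (p @ q)] \<cdot> (f p \<otimes> g q)) = \<zero>" using 0[OF q] c by simp
  qed auto
  finally show ?thesis by simp
qed

lemma ev_mult_right_0:
  assumes f: "f \<in> carrier (FR X)" and g: "g \<in> carrier (FR X)"
    and 0: "\<And>p. p \<in> supp f \<Longrightarrow> ev (\<lambda>q. \<phi> (p @ q)) g = \<zero>"
  shows "ev \<phi> (f \<otimes>\<^bsub>FR X\<^esub> g) = \<zero>"
proof -
  have c: "\<And>w. f w \<in> carrier R" "\<And>w. g w \<in> carrier R" and S: "finite (supp f)" "finite (supp g)"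
    using f g by (auto simp: free_carrier)
  have "ev \<phi> (f \<otimes>\<^bsub>FR X\<^esub> g) = (\<Oplus>p\<in>supp f. \<zero>)"
    unfolding ev_mult[OF f g]
  proof (rule finsum_cong'[OF refl])
    fix p assume p: "p \<in> supp f"
    have "(\<Oplus>q\<in>supp g. [\<phi> (p @ q)] \<cdot> (f p \<otimes> g q)) = (\<Oplus>q\<in>supp g. f p \<otimes> ([\<phi> (p @ q)] \<cdot> g q))"
      using c by (intro finsum_cong') (auto simp: add_pow_rdistr_int)
    also have "\<dots> = f p \<otimes> ev (\<lambda>q. \<phi> (p @ q)) g"
      unfolding ev_def using c S by (intro finsum_rdistr[symmetric]) auto
    finally show "(\<Oplus>q\<in>supp g. [\<phi> (p @ q)] \<cdot> (f p \<otimes> g q)) = \<zero>" using 0[OF p] c by simp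
  qed auto
  then show ?thesis by simp
qed

definition lin :: "'a \<Rightarrow> ('x list \<Rightarrow>\<^sub>0 int) \<Rightarrow> 'x list \<Rightarrow> 'a" where
  "lin r z = (\<lambda>u. [(lookup z u)] \<cdot> r)"

lemma lin_closed:
  assumes "r \<in> carrier R" "keys z \<subseteq> lists X - {[]}"
  shows "lin r z \<in> carrier (FR X)"
proof -
  have "supp (lin r z) \<subseteq> keys z"
    by (auto simp: supp_def lin_def in_keys_iff)
  then show ?thesis using assms finite_subset[OF _ finite_keys]
    by (auto simp: free_carrier lin_def)
qed

lemma lin_add: "r \<in> carrier R \<Longrightarrow> lin r (y + z) = lin r y \<oplus>\<^bsub>FR X\<^esub> lin r z"
  by (auto simp: lin_def free_simps lookup_add zmult_add)

lemma lin_0: "lin r 0 = \<zero>\<^bsub>FR X\<^esub>"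
  by (auto simp: lin_def free_simps)

lemma lin_diff:
  assumes "r \<in> carrier R" "keys y \<subseteq> lists X - {[]}" "keys z \<subseteq> lists X - {[]}"
  shows "lin r (y - z) = lin r y \<ominus>\<^bsub>FR X\<^esub> lin r z"
proof -
  have "lin r y \<ominus>\<^bsub>FR X\<^esub> lin r z = (\<lambda>w. lin r y w \<ominus> lin r z w)"
    using assms lin_closed by (intro free_minus)
  moreover have "[(a - b :: int)] \<cdot> r = [a] \<cdot> r \<ominus> [b] \<cdot> r" for a b
    using zmult_add[of r a "- b"] zmult_neg[of r b] assms by (simp add: a_minus_def)
  ultimately show ?thesis by (simp add: lin_def lookup_minus)
qed

lemma lin_scale: "r \<in> carrier R \<Longrightarrow> s \<in> carrier R \<Longrightarrow> s \<odot>\<^bsub>FR X\<^esub> lin r z = lin (s \<otimes> r) z"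
  by (auto simp: lin_def free_simps add_pow_rdistr_int)

lemma lin_sum:
  assumes "finite A" "r \<in> carrier R" "\<And>i. i \<in> A \<Longrightarrow> keys (z i) \<subseteq> lists X - {[]}"
  shows "(\<Oplus>\<^bsub>FR X\<^esub>i\<in>A. lin r (z i)) = lin r (\<Sum>i\<in>A. z i)"
proof -
  interpret F: abelian_group "FR X" by (rule free_abelian_group)
  show ?thesis
    using assms
  proof (induction A rule: finite_induct)
    case empty
    then show ?case by (simp add: lin_0[of r X])
  next
    case (insert a A)
    have "lin r (z i) \<in> carrier (FR X)" if "i \<in> insert a A" for i
      using insert.prems that by (intro lin_closed)
    then have "(\<lambda>i. lin r (z i)) \<in> A \<rightarrow> carrier (FR X)" "lin r (z a) \<in> carrier (FR X)" by auto
    then show ?case using insert by (simp add: lin_add[where X = X])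
  qed
qed

lemma free_gen_lin: "free_gen R x = lin \<one> (frag_of [x])"
  by (auto simp: free_gen_def lin_def)

lemma lin_frag_of: "r \<in> carrier R \<Longrightarrow> lin r (frag_of p) = (\<lambda>w. if w = p then r else \<zero>)"
  by (auto simp: lin_def)

lemma lin_mult_frag_of:
  assumes "r \<in> carrier R" "s \<in> carrier R" "p \<in> lists X - {[]}" "q \<in> lists X - {[]}"
  shows "lin r (frag_of p) \<otimes>\<^bsub>FR X\<^esub> lin s (frag_of q) = lin (r \<otimes> s) (frag_of (p @ q))"
proof
  fix w
  have c: "lin r (frag_of p) \<in> carrier (FR X)" "lin s (frag_of q) \<in> carrier (FR X)"
    using assms by (auto intro!: lin_closed)
  have "(lin r (frag_of p) \<otimes>\<^bsub>FR X\<^esub> lin s (frag_of q)) w =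
    (\<Oplus>p'\<in>{p}. \<Oplus>q'\<in>{q}. if p' @ q' = w then lin r (frag_of p) p' \<otimes> lin s (frag_of q) q' else \<zero>)"
    using c assms by (intro free_mult_apply) (auto simp: supp_def lin_frag_of split: if_splits)
  then show "(lin r (frag_of p) \<otimes>\<^bsub>FR X\<^esub> lin s (frag_of q)) w = lin (r \<otimes> s) (frag_of (p @ q)) w"
    using assms by (simp add: lin_frag_of)
qed

lemma ev_lin:
  assumes "r \<in> carrier R" "keys z \<subseteq> lists X - {[]}"
  shows "ev \<phi> (lin r z) = [(\<Sum>w\<in>keys z. lookup z w * \<phi> w)] \<cdot> r"
proof -
  have "supp (lin r z) \<subseteq> keys z" by (auto simp: supp_def lin_def in_keys_iff)
  then have "ev \<phi> (lin r z) = (\<Oplus>w\<in>keys z. [\<phi> w] \<cdot> lin r z w)"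
    using ev_superset[OF lin_closed[OF assms]] by simp
  also have "\<dots> = (\<Oplus>w\<in>keys z. [(lookup z w * \<phi> w)] \<cdot> r)"
    using assms by (intro finsum_cong') (auto simp: lin_def zmult_zmult[symmetric] mult.commute)
  finally show ?thesis by (simp only: finsum_zmult[OF finite_keys assms(1)])
qed

text \<open>Covers left and right multiplication by a word at once. As \<open>H\<close> is only
  known to respect sums, the step for differences is an addition followed by cancellation.\<close>

lemma lin_frag_extend:
  assumes r: "r \<in> carrier R" and z: "keys z \<subseteq> lists X - {[]}"
    and closed: "\<And>f. f \<in> carrier (FR X) \<Longrightarrow> H f \<in> carrier (FR X)"
    and add: "\<And>f g. f \<in> carrier (FR X) \<Longrightarrow> g \<in> carrier (FR X) \<Longrightarrow> H (f \<oplus>\<^bsub>FR X\<^esub> g) = H f \<oplus>\<^bsub>FR X\<^esub> H g"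
    and base: "\<And>q. q \<in> lists X - {[]} \<Longrightarrow> h q \<in> lists X - {[]} \<and> H (lin r (frag_of q)) = lin r (frag_of (h q))"
  shows "keys (frag_extend (\<lambda>q. frag_of (h q)) z) \<subseteq> lists X - {[]} \<and>
    H (lin r z) = lin r (frag_extend (\<lambda>q. frag_of (h q)) z)"
proof -
  interpret F: abelian_group "FR X" by (rule free_abelian_group)
  let ?e = "frag_extend (\<lambda>q. frag_of (h q))"
  have "keys z \<subseteq> lists X - {[]} \<and> keys (?e z) \<subseteq> lists X - {[]} \<and> H (lin r z) = lin r (?e z)"
    using z
  proof (induction z rule: frag_induction)
    case zero
    have "H \<zero>\<^bsub>FR X\<^esub> = \<zero>\<^bsub>FR X\<^esub>"
      using add[of "\<zero>\<^bsub>FR X\<^esub>" "\<zero>\<^bsub>FR X\<^esub>"] closed[of "\<zero>\<^bsub>FR X\<^esub>"]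
        F.add.r_cancel_one'[of "H \<zero>\<^bsub>FR X\<^esub>" "H \<zero>\<^bsub>FR X\<^esub>"] by simp
    then show ?case by (simp add: lin_0[of r X])
  next
    case (one q)
    then show ?case using base[of q] by simp
  next
    case (diff a b)
    have k: "keys (a - b) \<subseteq> lists X - {[]}" using keys_diff[of a b] diff by blast
    have k': "keys (?e (a - b)) \<subseteq> lists X - {[]}"
      using keys_diff[of "?e a" "?e b"] diff unfolding frag_extend_diff by blast
    have c: "lin r b \<in> carrier (FR X)" using lin_closed r diff by blast
    have "H (lin r (a - b)) \<oplus>\<^bsub>FR X\<^esub> H (lin r b) = H (lin r a)"
      using add[of "lin r (a - b)" "lin r b"] lin_add[OF r, of "a - b" b X] lin_closed[OF r k] c by simp
    also have "\<dots> = lin r (?e (a - b)) \<oplus>\<^bsub>FR X\<^esub> lin r (?e b)"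
      using diff lin_add[OF r, of "?e (a - b)" "?e b" X] by (simp add: frag_extend_diff)
    finally have eq: "H (lin r (a - b)) \<oplus>\<^bsub>FR X\<^esub> lin r (?e b) = lin r (?e (a - b)) \<oplus>\<^bsub>FR X\<^esub> lin r (?e b)"
      using diff by simp
    have "lin r (?e b) \<in> carrier (FR X)" "lin r (?e (a - b)) \<in> carrier (FR X)"
      using diff k' by (simp_all add: lin_closed[OF r])
    moreover have "H (lin r (a - b)) \<in> carrier (FR X)" using lin_closed[OF r k] closed by simp
    ultimately have "H (lin r (a - b)) = lin r (?e (a - b))"
      using eq F.add.right_cancel by blast
    then show ?case using k k' by simp
  qed
  then show ?thesis by blast
qed

lemma lin_mult_left:
  assumes r: "r \<in> carrier R" and p: "p \<in> lists X - {[]}" and z: "keys z \<subseteq> lists X - {[]}"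
  shows "keys (frag_extend (\<lambda>q. frag_of (p @ q)) z) \<subseteq> lists X - {[]} \<and>
    lin \<one> (frag_of p) \<otimes>\<^bsub>FR X\<^esub> lin r z = lin r (frag_extend (\<lambda>q. frag_of (p @ q)) z)"
proof -
  interpret F: nonunital_ring "FR X" by (rule free_nonunital_ring)
  have "lin \<one> (frag_of p) \<in> carrier (FR X)" using p by (intro lin_closed) auto
  then show ?thesis
    using p r by (intro lin_frag_extend[OF r z]) (auto simp: lin_mult_frag_of F.m_closed F.r_distr)
qed

lemma lin_mult_right:
  assumes r: "r \<in> carrier R" and p: "p \<in> lists X - {[]}" and z: "keys z \<subseteq> lists X - {[]}"
  shows "keys (frag_extend (\<lambda>q. frag_of (q @ p)) z) \<subseteq> lists X - {[]} \<and>
    lin r z \<otimes>\<^bsub>FR X\<^esub> lin \<one> (frag_of p) = lin r (frag_extend (\<lambda>q. frag_of (q @ p)) z)"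
proof -
  interpret F: nonunital_ring "FR X" by (rule free_nonunital_ring)
  have "lin \<one> (frag_of p) \<in> carrier (FR X)" using p by (intro lin_closed) auto
  then show ?thesis
    using p r by (intro lin_frag_extend[OF r z]) (auto simp: lin_mult_frag_of F.m_closed F.l_distr)
qed

end

section \<open>Quotients of rings without unit\<close>

context nonunital_ring
begin

lemma l_null [simp]: "x \<in> carrier A \<Longrightarrow> \<zero> \<otimes> x = \<zero>"
  using l_distr[of \<zero> \<zero> x] m_closed[of \<zero> x] add.r_cancel_one'[of "\<zero> \<otimes> x" "\<zero> \<otimes> x"] by simp

lemma r_null [simp]: "x \<in> carrier A \<Longrightarrow> x \<otimes> \<zero> = \<zero>"
  using r_distr[of \<zero> \<zero> x] m_closed[of x \<zero>] add.r_cancel_one'[of "x \<otimes> \<zero>" "x \<otimes> \<zero>"] by simp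

context
  fixes I
  assumes sub: "additive_subgroup I A"
    and left: "\<And>x a. x \<in> carrier A \<Longrightarrow> a \<in> I \<Longrightarrow> x \<otimes> a \<in> I"
    and right: "\<And>x a. x \<in> carrier A \<Longrightarrow> a \<in> I \<Longrightarrow> a \<otimes> x \<in> I"
begin

interpretation I: abelian_subgroup I A
  by (rule abelian_subgroupI3[OF sub abelian_group_axioms])

lemma coset_eq_I_iff: "x \<in> carrier A \<Longrightarrow> I +> x = I \<longleftrightarrow> x \<in> I"
  using I.a_rcos_self I.a_rcos_const by blast

text \<open>The product of cosets is a union over all representatives. Changing representatives
  alters the product by elements of \<open>I\<close> only, so all the cosets in the union
  coincide.\<close>

lemma rcoset_mult_coset:
  assumes x: "x \<in> carrier A" and y: "y \<in> carrier A"
  shows "[mod I:] (I +> x) \<Otimes> (I +> y) = I +> (x \<otimes> y)"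
proof -
  have "I +> (a \<otimes> b) = I +> (x \<otimes> y)" if ab: "a \<in> I +> x" "b \<in> I +> y" for a b
  proof -
    obtain i j where ij: "i \<in> I" "j \<in> I" "a = i \<oplus> x" "b = j \<oplus> y"
      using ab by (auto simp: a_r_coset_def')
    have c: "i \<in> carrier A" "j \<in> carrier A" using ij I.a_subset by auto
    have "a \<otimes> b = (i \<otimes> (j \<oplus> y) \<oplus> x \<otimes> j) \<oplus> x \<otimes> y"
      using c x y unfolding ij(3,4) by (simp add: l_distr r_distr m_closed a_ac)
    moreover have "i \<otimes> (j \<oplus> y) \<oplus> x \<otimes> j \<in> I"
      using ij c x y left right by (intro I.a_closed) auto
    ultimately have "a \<otimes> b \<in> I +> (x \<otimes> y)" by (auto simp: a_r_coset_def')
    then show ?thesis using a_repr_independence[OF _ _ I.a_subgroup] x y m_closed by metis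
  qed
  moreover have "x \<in> I +> x" "y \<in> I +> y" using x y I.a_rcos_self by auto
  ultimately show ?thesis unfolding rcoset_mult_def by blast
qed

lemma carrier_quotient: "carrier (A Quot I) = (\<lambda>x. I +> x) ` carrier A"
  unfolding FactRing_def A_RCOSETS_def' by (simp add: UNION_singleton_eq_range)

lemma quotient_nonunital_ring: "nonunital_ring (A Quot I)"
proof -
  have add: "add_monoid (A Quot I) = A A_Mod I"
    by (simp add: FactRing_def A_FactGroup_def')
  have "abelian_group (A Quot I)"
    using I.a_factorgroup_is_comm_group unfolding add[symmetric]
    by (intro abelian_group.intro abelian_monoid.intro abelian_group_axioms.intro)
      (auto simp: comm_group_def)
  moreover have "nonunital_ring_axioms (A Quot I)"
  proof
    fix P Q T assume "P \<in> carrier (A Quot I)" "Q \<in> carrier (A Quot I)" "T \<in> carrier (A Quot I)"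
    then obtain x y z where xyz: "x \<in> carrier A" "y \<in> carrier A" "z \<in> carrier A"
      and [simp]: "P = I +> x" "Q = I +> y" "T = I +> z"
      unfolding carrier_quotient by blast
    have mult: "(I +> a) \<otimes>\<^bsub>A Quot I\<^esub> (I +> b) = I +> (a \<otimes> b)"
      and add: "(I +> a) \<oplus>\<^bsub>A Quot I\<^esub> (I +> b) = I +> (a \<oplus> b)"
      if "a \<in> carrier A" "b \<in> carrier A" for a b
      using that by (simp_all add: FactRing_def rcoset_mult_coset I.a_rcos_sum)
    show "P \<otimes>\<^bsub>A Quot I\<^esub> Q \<in> carrier (A Quot I)"
      using xyz by (simp add: mult carrier_quotient m_closed)
    show "P \<otimes>\<^bsub>A Quot I\<^esub> Q \<otimes>\<^bsub>A Quot I\<^esub> T = P \<otimes>\<^bsub>A Quot I\<^esub> (Q \<otimes>\<^bsub>A Quot I\<^esub> T)"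
      using xyz m_assoc[of x y z] by (simp add: mult m_closed)
    show "(P \<oplus>\<^bsub>A Quot I\<^esub> Q) \<otimes>\<^bsub>A Quot I\<^esub> T = P \<otimes>\<^bsub>A Quot I\<^esub> T \<oplus>\<^bsub>A Quot I\<^esub> Q \<otimes>\<^bsub>A Quot I\<^esub> T"
      using xyz l_distr[of x y z] by (simp add: mult add m_closed)
    show "T \<otimes>\<^bsub>A Quot I\<^esub> (P \<oplus>\<^bsub>A Quot I\<^esub> Q) = T \<otimes>\<^bsub>A Quot I\<^esub> P \<oplus>\<^bsub>A Quot I\<^esub> T \<otimes>\<^bsub>A Quot I\<^esub> Q"
      using xyz r_distr[of x y z] by (simp add: mult add m_closed)
  qed
  ultimately show ?thesis by (simp add: nonunital_ring_def)
qed

text \<open>Complete primeness of the ideal moves the question to representatives, so that later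
  arguments take place in the free ring.\<close>

lemma nc_domain_quotient_iff:
  "nc_domain (A Quot I) \<longleftrightarrow>
    I \<noteq> carrier A \<and> (\<forall>f\<in>carrier A. \<forall>g\<in>carrier A. f \<otimes> g \<in> I \<longrightarrow> f \<in> I \<or> g \<in> I)"
proof -
  have zero: "\<zero>\<^bsub>A Quot I\<^esub> = I" by (simp add: FactRing_def)
  note carr = carrier_quotient
  have "carrier (A Quot I) \<noteq> {\<zero>\<^bsub>A Quot I\<^esub>} \<longleftrightarrow> I \<noteq> carrier A"
  proof -
    have "carrier (A Quot I) = {I} \<longleftrightarrow> (\<forall>x\<in>carrier A. I +> x = I)"
      unfolding carr
    proof (intro iffI ballI)
      fix x assume "(\<lambda>x. I +> x) ` carrier A = {I}" "x \<in> carrier A"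
      then show "I +> x = I" using imageI[of x "carrier A" "\<lambda>x. I +> x"] by simp
    next
      assume "\<forall>x\<in>carrier A. I +> x = I"
      then have "(\<lambda>x. I +> x) ` carrier A = (\<lambda>x. I) ` carrier A" by (intro image_cong) auto
      then show "(\<lambda>x. I +> x) ` carrier A = {I}" using zero_closed by (simp add: image_constant[of \<zero>])
    qed
    also have "\<dots> \<longleftrightarrow> I = carrier A" using coset_eq_I_iff I.a_subset by auto
    finally show ?thesis unfolding zero by blast
  qed
  moreover have "(\<forall>P\<in>carrier (A Quot I). \<forall>Q\<in>carrier (A Quot I).
      P \<otimes>\<^bsub>A Quot I\<^esub> Q = \<zero>\<^bsub>A Quot I\<^esub> \<longrightarrow> P = \<zero>\<^bsub>A Quot I\<^esub> \<or> Q = \<zero>\<^bsub>A Quot I\<^esub>) \<longleftrightarrow>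
    (\<forall>f\<in>carrier A. \<forall>g\<in>carrier A. f \<otimes> g \<in> I \<longrightarrow> f \<in> I \<or> g \<in> I)"
  proof -
    have "(I +> f) \<otimes>\<^bsub>A Quot I\<^esub> (I +> g) = I \<longleftrightarrow> f \<otimes> g \<in> I" if "f \<in> carrier A" "g \<in> carrier A" for f g
      using that by (simp add: FactRing_def rcoset_mult_coset coset_eq_I_iff m_closed)
    then show ?thesis unfolding carr zero by (simp add: coset_eq_I_iff)
  qed
  ultimately show ?thesis
    using quotient_nonunital_ring unfolding nc_domain_def nc_domain_axioms_def by auto
qed

end

end

lemma R_idealD:
  assumes "R_ideal R A I"
  shows "additive_subgroup I A" "\<And>x a. x \<in> carrier A \<Longrightarrow> a \<in> I \<Longrightarrow> x \<otimes>\<^bsub>A\<^esub> a \<in> I"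
    "\<And>x a. x \<in> carrier A \<Longrightarrow> a \<in> I \<Longrightarrow> a \<otimes>\<^bsub>A\<^esub> x \<in> I"
    "\<And>c a. c \<in> carrier R \<Longrightarrow> a \<in> I \<Longrightarrow> c \<odot>\<^bsub>A\<^esub> a \<in> I"
  using assms by (auto simp: R_ideal_def)

lemma (in abelian_group) additive_subgroupI:
  assumes "I \<subseteq> carrier G" "\<zero> \<in> I" "\<And>a b. a \<in> I \<Longrightarrow> b \<in> I \<Longrightarrow> a \<oplus> b \<in> I" "\<And>a. a \<in> I \<Longrightarrow> \<ominus> a \<in> I"
  shows "additive_subgroup I G"
  using assms by (intro additive_subgroup.intro add.subgroupI) auto

lemma (in abelian_group) additive_subgroupD:
  assumes "additive_subgroup I G"
  shows "I \<subseteq> carrier G" "\<zero> \<in> I" "\<And>a b. a \<in> I \<Longrightarrow> b \<in> I \<Longrightarrow> a \<oplus> b \<in> I" "\<And>a. a \<in> I \<Longrightarrow> \<ominus> a \<in> I"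
    "\<And>a b. a \<in> I \<Longrightarrow> b \<in> I \<Longrightarrow> a \<ominus> b \<in> I"
proof -
  have s: "subgroup I (add_monoid G)" using assms by (rule additive_subgroup.a_subgroup)
  show "I \<subseteq> carrier G" "\<zero> \<in> I" using subgroup.subset[OF s] subgroup.one_closed[OF s] by auto
  show p: "a \<oplus> b \<in> I" if "a \<in> I" "b \<in> I" for a b using subgroup.m_closed[OF s that] by simp
  show m: "\<ominus> a \<in> I" if "a \<in> I" for a using subgroup.m_inv_closed[OF s that] by (simp add: a_inv_def)
  show "a \<ominus> b \<in> I" if "a \<in> I" "b \<in> I" for a b using that p m by (simp add: a_minus_def)
qed

lemma gen_R_ideal:
  assumes "nonunital_ring A" "S \<subseteq> carrier A" "\<And>c a. c \<in> carrier R \<Longrightarrow> a \<in> carrier A \<Longrightarrow> c \<odot>\<^bsub>A\<^esub> a \<in> carrier A"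
  shows "R_ideal R A (gen_R_ideal R A S)" "S \<subseteq> gen_R_ideal R A S"
proof -
  interpret A: nonunital_ring A by fact
  \<comment> \<open>This member keeps the intersection inside the carrier; an empty family would
    intersect to the universal set.\<close>
  have top: "R_ideal R A (carrier A)"
    unfolding R_ideal_def using assms(3) A.m_closed by (auto intro!: A.additive_subgroupI)
  let ?J = "gen_R_ideal R A S"
  have memI: "x \<in> ?J" if "\<And>I. R_ideal R A I \<Longrightarrow> S \<subseteq> I \<Longrightarrow> x \<in> I" for x
    using that unfolding gen_R_ideal_def by simp
  have memD: "x \<in> I" if "x \<in> ?J" "R_ideal R A I" "S \<subseteq> I" for x I
    using that unfolding gen_R_ideal_def by simp
  have add: "additive_subgroup ?J A"
  proof (rule A.additive_subgroupI)
    show "?J \<subseteq> carrier A" using memD[OF _ top assms(2)] by blast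
    show "\<zero>\<^bsub>A\<^esub> \<in> ?J" by (rule memI) (rule A.additive_subgroupD(2)[OF R_idealD(1)])
    fix a b assume a: "a \<in> ?J"
    show "\<ominus>\<^bsub>A\<^esub> a \<in> ?J"
      by (rule memI) (rule A.additive_subgroupD(4)[OF R_idealD(1)], assumption, rule memD[OF a])
    assume b: "b \<in> ?J"
    show "a \<oplus>\<^bsub>A\<^esub> b \<in> ?J"
      by (rule memI) (rule A.additive_subgroupD(3)[OF R_idealD(1)], assumption,
          rule memD[OF a], assumption+, rule memD[OF b])
  qed
  show "R_ideal R A ?J"
    unfolding R_ideal_def[of R A ?J]
  proof (intro conjI ballI add memI)
    fix x a I assume "x \<in> carrier A" "a \<in> ?J" "R_ideal R A I" "S \<subseteq> I"
    then show "x \<otimes>\<^bsub>A\<^esub> a \<in> I" "a \<otimes>\<^bsub>A\<^esub> x \<in> I"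
      using R_idealD(2,3)[of R A I x a] memD[of a I] by auto
  next
    fix c a I assume "c \<in> carrier R" "a \<in> ?J" "R_ideal R A I" "S \<subseteq> I"
    then show "c \<odot>\<^bsub>A\<^esub> a \<in> I" using R_idealD(4)[of R A I c a] memD[of a I] by auto
  qed
  show "S \<subseteq> ?J" unfolding gen_R_ideal_def by blast
qed

section \<open>The ideal of relations\<close>

lemma setcompr_image2:
  assumes "\<And>v w. P v w \<Longrightarrow> f v w = h (g v w)"
  shows "{f v w | v w. P v w} = h ` {g v w | v w. P v w}"
proof -
  have "{f v w | v w. P v w} = {h (g v w) | v w. P v w}"
    by (intro Collect_cong ex_cong1) (auto simp: assms)
  also have "\<dots> = h ` {g v w | v w. P v w}" by blast
  finally show ?thesis .
qed

lemma setcompr_image3: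
  assumes "\<And>v w x. P v w x \<Longrightarrow> f v w x = h (g v w x)"
  shows "{f v w x | v w x. P v w x} = h ` {g v w x | v w x. P v w x}"
proof -
  have "{f v w x | v w x. P v w x} = {h (g v w x) | v w x. P v w x}"
    by (intro Collect_cong ex_cong1) (auto simp: assms)
  also have "\<dots> = h ` {g v w x | v w x. P v w x}" by blast
  finally show ?thesis .
qed

locale graph_ring = ring R + weighted_graph G
  for R :: "('a, 'm) ring_scheme" (structure) and G :: "('v, 'e, 'n) wgraph_scheme"
begin

abbreviation words :: "('v, 'e) letter list set" where
  "words \<equiv> lists (letters G) - {[]}"

abbreviation FG :: "('a, ('v, 'e) letter list \<Rightarrow> 'a) module" where
  "FG \<equiv> wlpa_free R G"

text \<open>The relations before the choice of a coefficient ring, so that the same elements can act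
  on normal words and be mapped to the free ring. The guards on indices implement the convention
  that letters beyond the weight are zero.\<close>

definition int_rels :: "(('v, 'e) letter list \<Rightarrow>\<^sub>0 int) set" where
  "int_rels =
     {frag_of [Vertex v, Vertex w] - (if v = w then frag_of [Vertex v] else 0)
      | v w. v \<in> verts G \<and> w \<in> verts G} \<union>
     (\<Union>\<alpha>\<in>sedges G. \<Union>i\<in>{1..wt G \<alpha>}.
       {frag_of [Vertex (src G \<alpha>), Edge \<alpha> i] - frag_of [Edge \<alpha> i],
        frag_of [Edge \<alpha> i, Vertex (tgt G \<alpha>)] - frag_of [Edge \<alpha> i],
        frag_of [Vertex (tgt G \<alpha>), Ghost \<alpha> i] - frag_of [Ghost \<alpha> i],
        frag_of [Ghost \<alpha> i, Vertex (src G \<alpha>)] - frag_of [Ghost \<alpha> i]}) \<union>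
     {(\<Sum>\<alpha>\<in>out G v. if i \<le> wt G \<alpha> \<and> j \<le> wt G \<alpha> then frag_of [Edge \<alpha> i, Ghost \<alpha> j] else 0)
        - (if i = j then frag_of [Vertex v] else 0)
      | v i j. v \<in> verts G \<and> \<not> sink G v \<and> i \<in> {1..vwt G v} \<and> j \<in> {1..vwt G v}} \<union>
     {(\<Sum>i\<in>{1..max (wt G \<alpha>) (wt G \<beta>)}.
        if i \<le> wt G \<alpha> \<and> i \<le> wt G \<beta> then frag_of [Ghost \<alpha> i, Edge \<beta> i] else 0)
        - (if \<alpha> = \<beta> then frag_of [Vertex (tgt G \<alpha>)] else 0)
      | \<alpha> \<beta>. \<alpha> \<in> sedges G \<and> \<beta> \<in> sedges G}"

definition wlpa_ideal :: "(('v, 'e) letter list \<Rightarrow> 'a) set" where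
  "wlpa_ideal = gen_R_ideal R (FG)
     (vertex_rels R G \<union> path_rels R G \<union> row_rels R G \<union> column_rels R G)"

section \<open>The defining relations as images of integer combinations\<close>

lemma lin_frag_if: "lin \<one> (if b then frag_of w else 0) = (if b then lin \<one> (frag_of w) else \<zero>\<^bsub>free_ring R X\<^esub>)"
  by (simp add: lin_0[of \<one> X])

lemma lin_word2:
  assumes "a \<Longrightarrow> x \<in> letters G" "b \<Longrightarrow> y \<in> letters G"
  shows "lin \<one> (if a then frag_of [x] else 0) \<otimes>\<^bsub>FG\<^esub> lin \<one> (if b then frag_of [y] else 0) =
    lin \<one> (if a \<and> b then frag_of [x, y] else 0)"
proof -
  interpret F: nonunital_ring "FG" by (rule free_nonunital_ring)
  have c: "z \<in> letters G \<Longrightarrow> lin \<one> (frag_of [z]) \<in> carrier (FG)" for z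
    by (rule lin_closed) auto
  show ?thesis
    using assms lin_mult_frag_of[of \<one> \<one> "[x]" "letters G" "[y]"] c
    unfolding lin_frag_if[where X = "letters G"] by auto
qed

lemma vertex_elt_lin: "vertex_elt R v = lin \<one> (frag_of [Vertex v])"
  by (simp add: vertex_elt_def free_gen_lin)

lemma edge_elt_lin: "edge_elt R G \<alpha> i = lin \<one> (if i \<le> wt G \<alpha> then frag_of [Edge \<alpha> i] else 0)"
  by (simp add: edge_elt_def free_gen_lin lin_0[of \<one> "letters G"])

lemma ghost_elt_lin: "ghost_elt R G \<alpha> i = lin \<one> (if i \<le> wt G \<alpha> then frag_of [Ghost \<alpha> i] else 0)"
  by (simp add: ghost_elt_def free_gen_lin lin_0[of \<one> "letters G"])

lemma keys_words:
  "keys y \<subseteq> W \<Longrightarrow> keys z \<subseteq> W \<Longrightarrow> keys (y - z :: _ \<Rightarrow>\<^sub>0 int) \<subseteq> W"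
  "(b \<Longrightarrow> w \<in> W) \<Longrightarrow> keys (if b then frag_of w else 0) \<subseteq> W"
  "(\<And>i. i \<in> S \<Longrightarrow> keys (h i) \<subseteq> W) \<Longrightarrow> keys (sum h S) \<subseteq> W"
  subgoal using keys_diff[of y z] by blast
  subgoal by auto
  subgoal using keys_sum[of h S] by blast
  done

lemma vertex_rel_lin:
  assumes "v \<in> verts G" "w \<in> verts G"
  shows "vertex_elt R v \<otimes>\<^bsub>FG\<^esub> vertex_elt R w
      \<ominus>\<^bsub>FG\<^esub> (if v = w then vertex_elt R v else \<zero>\<^bsub>FG\<^esub>) =
    lin \<one> (frag_of [Vertex v, Vertex w] - (if v = w then frag_of [Vertex v] else 0))"
proof -
  have "lin \<one> (frag_of [Vertex v, Vertex w] - (if v = w then frag_of [Vertex v] else 0)) =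
    lin \<one> (frag_of [Vertex v, Vertex w]) \<ominus>\<^bsub>FG\<^esub> lin \<one> (if v = w then frag_of [Vertex v] else 0)"
    using assms by (intro lin_diff keys_words) auto
  then show ?thesis
    using assms lin_word2[of True "Vertex v" True "Vertex w"]
    by (simp add: vertex_elt_lin lin_0[of \<one> "letters G"])
qed

lemma path_rel_lin:
  assumes "x \<in> letters G" "y \<in> letters G" "z \<in> letters G"
  shows "lin \<one> (frag_of [x]) \<otimes>\<^bsub>FG\<^esub> lin \<one> (frag_of [y]) \<ominus>\<^bsub>FG\<^esub> lin \<one> (frag_of [z]) =
    lin \<one> (frag_of [x, y] - frag_of [z])"
proof -
  have "lin \<one> (frag_of [x, y] - frag_of [z]) =
    lin \<one> (frag_of [x, y]) \<ominus>\<^bsub>FG\<^esub> lin \<one> (frag_of [z])"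
    using assms by (intro lin_diff) auto
  then show ?thesis
    using assms lin_word2[of True x True y] by simp
qed

lemma row_rel_lin:
  assumes "v \<in> verts G" "1 \<le> i" "1 \<le> j"
  shows "(\<Oplus>\<^bsub>FG\<^esub>\<alpha>\<in>out G v. edge_elt R G \<alpha> i \<otimes>\<^bsub>FG\<^esub> ghost_elt R G \<alpha> j)
      \<ominus>\<^bsub>FG\<^esub> (if i = j then vertex_elt R v else \<zero>\<^bsub>FG\<^esub>) =
    lin \<one> ((\<Sum>\<alpha>\<in>out G v. if i \<le> wt G \<alpha> \<and> j \<le> wt G \<alpha> then frag_of [Edge \<alpha> i, Ghost \<alpha> j] else 0)
        - (if i = j then frag_of [Vertex v] else 0))"
proof -
  interpret F: nonunital_ring "FG" by (rule free_nonunital_ring)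
  let ?z = "\<lambda>\<alpha>. if i \<le> wt G \<alpha> \<and> j \<le> wt G \<alpha> then frag_of [Edge \<alpha> i, Ghost \<alpha> j] else 0"
  have k: "keys (?z \<alpha>) \<subseteq> words" if "\<alpha> \<in> out G v" for \<alpha>
    using that assms by (intro keys_words) (auto simp: out_def)
  have "(\<Oplus>\<^bsub>FG\<^esub>\<alpha>\<in>out G v. edge_elt R G \<alpha> i \<otimes>\<^bsub>FG\<^esub> ghost_elt R G \<alpha> j) =
    (\<Oplus>\<^bsub>FG\<^esub>\<alpha>\<in>out G v. lin \<one> (?z \<alpha>))"
  proof (rule F.finsum_cong'[OF refl])
    show "(\<lambda>\<alpha>. lin \<one> (?z \<alpha>)) \<in> out G v \<rightarrow> carrier (FG)"
      using k lin_closed[OF one_closed] by blast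
    fix \<alpha> assume "\<alpha> \<in> out G v"
    then show "edge_elt R G \<alpha> i \<otimes>\<^bsub>FG\<^esub> ghost_elt R G \<alpha> j = lin \<one> (?z \<alpha>)"
      unfolding edge_elt_lin ghost_elt_lin using assms by (intro lin_word2) (auto simp: out_def)
  qed
  also have "\<dots> = lin \<one> (\<Sum>\<alpha>\<in>out G v. ?z \<alpha>)"
    by (rule lin_sum[OF finite_out one_closed k])
  finally have 1: "(\<Oplus>\<^bsub>FG\<^esub>\<alpha>\<in>out G v. edge_elt R G \<alpha> i \<otimes>\<^bsub>FG\<^esub> ghost_elt R G \<alpha> j) =
    lin \<one> (\<Sum>\<alpha>\<in>out G v. ?z \<alpha>)" .
  have 2: "(if i = j then vertex_elt R v else \<zero>\<^bsub>FG\<^esub>) = lin \<one> (if i = j then frag_of [Vertex v] else 0)"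
    by (simp add: vertex_elt_lin lin_0[of \<one> "letters G"])
  have 3: "lin \<one> (\<Sum>\<alpha>\<in>out G v. ?z \<alpha>) \<ominus>\<^bsub>FG\<^esub> lin \<one> (if i = j then frag_of [Vertex v] else 0) =
    lin \<one> ((\<Sum>\<alpha>\<in>out G v. ?z \<alpha>) - (if i = j then frag_of [Vertex v] else 0))"
    by (rule lin_diff[OF one_closed keys_words(3)[OF k] keys_words(2), symmetric]) (use assms in auto)
  show ?thesis unfolding 1 2 3 ..
qed

lemma column_rel_lin:
  assumes \<alpha>: "\<alpha> \<in> sedges G" and \<beta>: "\<beta> \<in> sedges G"
  shows "(\<Oplus>\<^bsub>FG\<^esub>i\<in>{1..max (wt G \<alpha>) (wt G \<beta>)}. ghost_elt R G \<alpha> i \<otimes>\<^bsub>FG\<^esub> edge_elt R G \<beta> i)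
      \<ominus>\<^bsub>FG\<^esub> (if \<alpha> = \<beta> then vertex_elt R (tgt G \<alpha>) else \<zero>\<^bsub>FG\<^esub>) =
    lin \<one> ((\<Sum>i\<in>{1..max (wt G \<alpha>) (wt G \<beta>)}.
        if i \<le> wt G \<alpha> \<and> i \<le> wt G \<beta> then frag_of [Ghost \<alpha> i, Edge \<beta> i] else 0)
        - (if \<alpha> = \<beta> then frag_of [Vertex (tgt G \<alpha>)] else 0))"
proof -
  interpret F: nonunital_ring "FG" by (rule free_nonunital_ring)
  let ?z = "\<lambda>i. if i \<le> wt G \<alpha> \<and> i \<le> wt G \<beta> then frag_of [Ghost \<alpha> i, Edge \<beta> i] else 0"
  let ?M = "{1..max (wt G \<alpha>) (wt G \<beta>)}"
  have k: "keys (?z i) \<subseteq> words" if "i \<in> ?M" for i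
    using that assms by (intro keys_words) auto
  have "(\<Oplus>\<^bsub>FG\<^esub>i\<in>?M. ghost_elt R G \<alpha> i \<otimes>\<^bsub>FG\<^esub> edge_elt R G \<beta> i) =
    (\<Oplus>\<^bsub>FG\<^esub>i\<in>?M. lin \<one> (?z i))"
  proof (rule F.finsum_cong'[OF refl])
    show "(\<lambda>i. lin \<one> (?z i)) \<in> ?M \<rightarrow> carrier (FG)"
      using k lin_closed[OF one_closed] by blast
    fix i assume "i \<in> ?M"
    then show "ghost_elt R G \<alpha> i \<otimes>\<^bsub>FG\<^esub> edge_elt R G \<beta> i = lin \<one> (?z i)"
      unfolding edge_elt_lin ghost_elt_lin using assms by (intro lin_word2) auto
  qed
  also have "\<dots> = lin \<one> (\<Sum>i\<in>?M. ?z i)"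
    by (rule lin_sum[OF _ one_closed k]) auto
  finally have 1: "(\<Oplus>\<^bsub>FG\<^esub>i\<in>?M. ghost_elt R G \<alpha> i \<otimes>\<^bsub>FG\<^esub> edge_elt R G \<beta> i) =
    lin \<one> (\<Sum>i\<in>?M. ?z i)" .
  have 2: "(if \<alpha> = \<beta> then vertex_elt R (tgt G \<alpha>) else \<zero>\<^bsub>FG\<^esub>) =
    lin \<one> (if \<alpha> = \<beta> then frag_of [Vertex (tgt G \<alpha>)] else 0)"
    by (simp add: vertex_elt_lin lin_0[of \<one> "letters G"])
  have 3: "lin \<one> (\<Sum>i\<in>?M. ?z i) \<ominus>\<^bsub>FG\<^esub> lin \<one> (if \<alpha> = \<beta> then frag_of [Vertex (tgt G \<alpha>)] else 0) =
    lin \<one> ((\<Sum>i\<in>?M. ?z i) - (if \<alpha> = \<beta> then frag_of [Vertex (tgt G \<alpha>)] else 0))"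
    by (rule lin_diff[OF one_closed keys_words(3)[OF k] keys_words(2), symmetric]) (use assms tgt_closed in auto)
  show ?thesis unfolding 1 2 3 ..
qed

lemma rels_lin: "vertex_rels R G \<union> path_rels R G \<union> row_rels R G \<union> column_rels R G = lin \<one> ` int_rels"
proof -
  have v: "vertex_rels R G = lin \<one> ` {frag_of [Vertex v, Vertex w] - (if v = w then frag_of [Vertex v] else 0)
      | v w. v \<in> verts G \<and> w \<in> verts G}"
    unfolding vertex_rels_def by (rule setcompr_image2) (use vertex_rel_lin in blast)
  have p: "path_rels R G = lin \<one> ` (\<Union>\<alpha>\<in>sedges G. \<Union>i\<in>{1..wt G \<alpha>}.
       {frag_of [Vertex (src G \<alpha>), Edge \<alpha> i] - frag_of [Edge \<alpha> i],
        frag_of [Edge \<alpha> i, Vertex (tgt G \<alpha>)] - frag_of [Edge \<alpha> i],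
        frag_of [Vertex (tgt G \<alpha>), Ghost \<alpha> i] - frag_of [Ghost \<alpha> i],
        frag_of [Ghost \<alpha> i, Vertex (src G \<alpha>)] - frag_of [Ghost \<alpha> i]})"
    unfolding path_rels_def image_UN
  proof (intro SUP_cong refl)
    fix \<alpha> i assume "\<alpha> \<in> sedges G" "i \<in> {1..wt G \<alpha>}"
    then have l: "Vertex (src G \<alpha>) \<in> letters G" "Vertex (tgt G \<alpha>) \<in> letters G"
      "Edge \<alpha> i \<in> letters G" "Ghost \<alpha> i \<in> letters G" "i \<le> wt G \<alpha>"
      using src_closed tgt_closed by auto
    show "{vertex_elt R (src G \<alpha>) \<otimes>\<^bsub>FG\<^esub> edge_elt R G \<alpha> i \<ominus>\<^bsub>FG\<^esub> edge_elt R G \<alpha> i,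
        edge_elt R G \<alpha> i \<otimes>\<^bsub>FG\<^esub> vertex_elt R (tgt G \<alpha>) \<ominus>\<^bsub>FG\<^esub> edge_elt R G \<alpha> i,
        vertex_elt R (tgt G \<alpha>) \<otimes>\<^bsub>FG\<^esub> ghost_elt R G \<alpha> i \<ominus>\<^bsub>FG\<^esub> ghost_elt R G \<alpha> i,
        ghost_elt R G \<alpha> i \<otimes>\<^bsub>FG\<^esub> vertex_elt R (src G \<alpha>) \<ominus>\<^bsub>FG\<^esub> ghost_elt R G \<alpha> i} =
      lin \<one> ` {frag_of [Vertex (src G \<alpha>), Edge \<alpha> i] - frag_of [Edge \<alpha> i],
        frag_of [Edge \<alpha> i, Vertex (tgt G \<alpha>)] - frag_of [Edge \<alpha> i],
        frag_of [Vertex (tgt G \<alpha>), Ghost \<alpha> i] - frag_of [Ghost \<alpha> i],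
        frag_of [Ghost \<alpha> i, Vertex (src G \<alpha>)] - frag_of [Ghost \<alpha> i]}"
      using l by (simp add: vertex_elt_lin edge_elt_lin ghost_elt_lin path_rel_lin del: letters_simps)
  qed
  have r: "row_rels R G = lin \<one> ` {(\<Sum>\<alpha>\<in>out G v. if i \<le> wt G \<alpha> \<and> j \<le> wt G \<alpha> then frag_of [Edge \<alpha> i, Ghost \<alpha> j] else 0)
        - (if i = j then frag_of [Vertex v] else 0)
      | v i j. v \<in> verts G \<and> \<not> sink G v \<and> i \<in> {1..vwt G v} \<and> j \<in> {1..vwt G v}}"
    unfolding row_rels_def by (rule setcompr_image3) (use row_rel_lin in auto)
  have c: "column_rels R G = lin \<one> ` {(\<Sum>i\<in>{1..max (wt G \<alpha>) (wt G \<beta>)}.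
        if i \<le> wt G \<alpha> \<and> i \<le> wt G \<beta> then frag_of [Ghost \<alpha> i, Edge \<beta> i] else 0)
        - (if \<alpha> = \<beta> then frag_of [Vertex (tgt G \<alpha>)] else 0)
      | \<alpha> \<beta>. \<alpha> \<in> sedges G \<and> \<beta> \<in> sedges G}"
    unfolding column_rels_def by (rule setcompr_image2) (use column_rel_lin in blast)
  show ?thesis unfolding int_rels_def image_Un v p r c by simp
qed

text \<open>Phrased with the first and last vertex of a letter, the four path relations become two,
  so edges and ghost edges need not be distinguished.\<close>

lemma int_rels_cases:
  assumes z: "z \<in> int_rels"
  obtains (a) v w where "v \<in> verts G" "w \<in> verts G"
      "z = frag_of [Vertex v, Vertex w] - (if v = w then frag_of [Vertex v] else 0)"
    | (b) x where "x \<in> letters G" "z = frag_of [Vertex (first_vertex G [x]), x] - frag_of [x] \<or>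
         z = frag_of [x, Vertex (last_vertex G x)] - frag_of [x]"
    | (c) v i j where "out G v \<noteq> {}" "1 \<le> i" "i \<le> vwt G v" "1 \<le> j" "j \<le> vwt G v"
      "z = (\<Sum>\<alpha>\<in>out G v. if i \<le> wt G \<alpha> \<and> j \<le> wt G \<alpha> then frag_of [Edge \<alpha> i, Ghost \<alpha> j] else 0)
        - (if i = j then frag_of [Vertex v] else 0)"
    | (d) \<alpha> \<beta> where "\<alpha> \<in> sedges G" "\<beta> \<in> sedges G"
      "z = (\<Sum>i\<in>{1..max (wt G \<alpha>) (wt G \<beta>)}.
        if i \<le> wt G \<alpha> \<and> i \<le> wt G \<beta> then frag_of [Ghost \<alpha> i, Edge \<beta> i] else 0)
        - (if \<alpha> = \<beta> then frag_of [Vertex (tgt G \<alpha>)] else 0)"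
proof -
  consider "\<exists>v w. v \<in> verts G \<and> w \<in> verts G \<and>
    z = frag_of [Vertex v, Vertex w] - (if v = w then frag_of [Vertex v] else 0)"
  | \<alpha> i where "\<alpha> \<in> sedges G" "i \<in> {1..wt G \<alpha>}"
    "z \<in> {frag_of [Vertex (src G \<alpha>), Edge \<alpha> i] - frag_of [Edge \<alpha> i],
      frag_of [Edge \<alpha> i, Vertex (tgt G \<alpha>)] - frag_of [Edge \<alpha> i],
      frag_of [Vertex (tgt G \<alpha>), Ghost \<alpha> i] - frag_of [Ghost \<alpha> i],
      frag_of [Ghost \<alpha> i, Vertex (src G \<alpha>)] - frag_of [Ghost \<alpha> i]}"
  | "\<exists>v i j. v \<in> verts G \<and> \<not> sink G v \<and> i \<in> {1..vwt G v} \<and> j \<in> {1..vwt G v} \<and>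
    z = (\<Sum>\<alpha>\<in>out G v. if i \<le> wt G \<alpha> \<and> j \<le> wt G \<alpha> then frag_of [Edge \<alpha> i, Ghost \<alpha> j] else 0)
      - (if i = j then frag_of [Vertex v] else 0)"
  | "\<exists>\<alpha> \<beta>. \<alpha> \<in> sedges G \<and> \<beta> \<in> sedges G \<and>
    z = (\<Sum>i\<in>{1..max (wt G \<alpha>) (wt G \<beta>)}.
      if i \<le> wt G \<alpha> \<and> i \<le> wt G \<beta> then frag_of [Ghost \<alpha> i, Edge \<beta> i] else 0)
      - (if \<alpha> = \<beta> then frag_of [Vertex (tgt G \<alpha>)] else 0)"
    using z unfolding int_rels_def by blast
  then show ?thesis
  proof cases
    case 1 then show ?thesis using a by blast
  next
    case 2
    then have "Edge \<alpha> i \<in> letters G" "Ghost \<alpha> i \<in> letters G" by auto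
    then show ?thesis using 2(3) b[of "Edge \<alpha> i"] b[of "Ghost \<alpha> i"] by auto
  next
    case 3
    then obtain v i j where "v \<in> verts G" "\<not> sink G v" "i \<in> {1..vwt G v}" "j \<in> {1..vwt G v}"
    "z = (\<Sum>\<alpha>\<in>out G v. if i \<le> wt G \<alpha> \<and> j \<le> wt G \<alpha> then frag_of [Edge \<alpha> i, Ghost \<alpha> j] else 0)
      - (if i = j then frag_of [Vertex v] else 0)" by blast
    then show ?thesis using c[of v i j] by (simp add: sink_def)
  next
    case 4 then show ?thesis using d by blast
  qed
qed

lemma int_rels_keys:
  assumes "z \<in> int_rels"
  shows "keys z \<subseteq> words"
  using assms
proof (cases rule: int_rels_cases)
  case (a v w)
  show ?thesis unfolding a(3) by (intro keys_words) (use a in auto)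
next
  case (b x)
  have "first_vertex G [x] \<in> verts G \<and> last_vertex G x \<in> verts G"
    using b(1) src_closed tgt_closed by (cases x) auto
  then have "keys (frag_of [Vertex (first_vertex G [x]), x] - frag_of [x]) \<subseteq> words"
    "keys (frag_of [x, Vertex (last_vertex G x)] - frag_of [x]) \<subseteq> words"
    using b(1) by (intro keys_words(1); simp)+
  then show ?thesis using b(2) by metis
next
  case (c v i j)
  have "v \<in> verts G" using c(1) src_closed by (auto simp: out_def)
  then show ?thesis unfolding c(6) by (intro keys_words) (use c in \<open>auto simp: out_def\<close>)
next
  case (d \<alpha> \<beta>)
  show ?thesis unfolding d(3) by (intro keys_words) (use d tgt_closed in auto)
qed

lemma int_rels_act:
  assumes z: "z \<in> int_rels" and q: "normal_word G q"
  shows "frag_extend (\<lambda>w. word_op G w (frag_of q)) z = 0"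
proof -
  have w2: "word_op G [x, y] (frag_of q) = frag_extend (letter_op G x) (letter_op G y q)"
    and w1: "word_op G [x] (frag_of q) = letter_op G x q" for x y by simp_all
  note simps = frag_extend_diff frag_extend_sum' frag_extend_if frag_extend_of w2 w1 finite_out
  have path: "frag_extend (\<lambda>w. word_op G w (frag_of q)) (frag_of [Vertex (first_vertex G [x]), x] - frag_of [x]) = 0"
    "frag_extend (\<lambda>w. word_op G w (frag_of q)) (frag_of [x, Vertex (last_vertex G x)] - frag_of [x]) = 0"
    if "x \<in> letters G" for x
    using op_first_vertex[OF that q] op_last_vertex[OF that, of q] unfolding simps by simp_all
  from z show ?thesis
  proof (cases rule: int_rels_cases)
    case (a v w)
    show ?thesis unfolding a(3) simps vertex_vertex_op by simp
  next
    case (b x)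
    then show ?thesis using path by blast
  next
    case (c v i j)
    have "(\<Sum>\<alpha>\<in>out G v. if i \<le> wt G \<alpha> \<and> j \<le> wt G \<alpha> then frag_extend (letter_op G (Edge \<alpha> i)) (letter_op G (Ghost \<alpha> j) q) else 0) =
      (\<Sum>\<alpha>\<in>out G v. frag_extend (letter_op G (Edge \<alpha> i)) (letter_op G (Ghost \<alpha> j) q))"
    proof (rule sum.cong[OF refl])
      fix \<alpha>
      \<comment> \<open>The operator of a letter beyond the weight is already zero, so the guards
        may be dropped and \<open>row_op\<close> applies.\<close>
      have "frag_extend (letter_op G (Edge \<alpha> i)) (letter_op G (Ghost \<alpha> j) q) = 0" if "\<not> (i \<le> wt G \<alpha> \<and> j \<le> wt G \<alpha>)"
        using that by (cases "j \<le> wt G \<alpha>") (auto intro!: frag_extend_eq_0)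
      then show "(if i \<le> wt G \<alpha> \<and> j \<le> wt G \<alpha> then frag_extend (letter_op G (Edge \<alpha> i)) (letter_op G (Ghost \<alpha> j) q) else 0)
        = frag_extend (letter_op G (Edge \<alpha> i)) (letter_op G (Ghost \<alpha> j) q)" by presburger
    qed
    then show ?thesis
      unfolding c(6) frag_extend_diff frag_extend_sum'[OF finite_out] frag_extend_if frag_extend_of w2 w1
      using row_op[OF c(1-5) q] by (simp only: diff_self)
  next
    case (d \<alpha> \<beta>)
    have "(\<Sum>i\<in>{1..max (wt G \<alpha>) (wt G \<beta>)}. if i \<le> wt G \<alpha> \<and> i \<le> wt G \<beta> then frag_extend (letter_op G (Ghost \<alpha> i)) (letter_op G (Edge \<beta> i) q) else 0) =
      (\<Sum>i\<in>{1..max (wt G \<alpha>) (wt G \<beta>)}. frag_extend (letter_op G (Ghost \<alpha> i)) (letter_op G (Edge \<beta> i) q))"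
    proof (rule sum.cong[OF refl])
      fix i
      have "frag_extend (letter_op G (Ghost \<alpha> i)) (letter_op G (Edge \<beta> i) q) = 0" if "\<not> (i \<le> wt G \<alpha> \<and> i \<le> wt G \<beta>)"
        using that by (cases "i \<le> wt G \<beta>") (auto intro!: frag_extend_eq_0)
      then show "(if i \<le> wt G \<alpha> \<and> i \<le> wt G \<beta> then frag_extend (letter_op G (Ghost \<alpha> i)) (letter_op G (Edge \<beta> i) q) else 0)
        = frag_extend (letter_op G (Ghost \<alpha> i)) (letter_op G (Edge \<beta> i) q)" by presburger
    qed
    then show ?thesis
      unfolding d(3) frag_extend_diff frag_extend_sum'[OF finite_atLeastAtMost] frag_extend_if frag_extend_of w2 w1
      using column_op[OF d(1,2) q] by (simp only: diff_self)
  qed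
qed

section \<open>The ideal and the functionals vanishing on it\<close>

lemma int_rels_carrier: "lin \<one> ` int_rels \<subseteq> carrier (FG)"
  using lin_closed[OF one_closed int_rels_keys] by blast

lemma R_ideal_wlpa_ideal: "R_ideal R (FG) wlpa_ideal"
  and rels_in_ideal: "lin \<one> ` int_rels \<subseteq> wlpa_ideal"
  using gen_R_ideal[OF free_nonunital_ring int_rels_carrier, where R = R] free_scale_closed
  unfolding wlpa_ideal_def rels_lin by blast+

text \<open>The matrix entry of the word \<open>w\<close> in column \<open>q\<close> and row
  \<open>u\<close>. Taking \<open>w\<close> as the last argument makes it a functional to which
  \<open>ev\<close> applies.\<close>

definition coef :: "('v, 'e) letter list \<Rightarrow> ('v, 'e) letter list \<Rightarrow> ('v, 'e) letter list \<Rightarrow> int" where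
  "coef q u w = lookup (word_op G w (frag_of q)) u"

text \<open>Matrix multiplication. The index set may be larger than necessary, so that one set can
  serve all words of a support.\<close>

lemma coef_append:
  assumes "finite W" "keys (word_op G p' (frag_of q)) \<subseteq> W"
  shows "coef q u (p @ p') = (\<Sum>w\<in>W. coef q w p' * coef w u p)"
proof -
  have "coef q u (p @ p') = lookup (frag_extend (\<lambda>w. word_op G p (frag_of w)) (word_op G p' (frag_of q))) u"
    unfolding coef_def word_op_append word_op_frag_extend[of G p "word_op G p' (frag_of q)"] ..
  also have "\<dots> = (\<Sum>w\<in>keys (word_op G p' (frag_of q)). coef q w p' * coef w u p)"
    by (simp add: frag_extend_def lookup_sum coef_def)
  also have "\<dots> = (\<Sum>w\<in>W. coef q w p' * coef w u p)"
    using assms by (intro sum.mono_neutral_left) (auto simp: coef_def in_keys_iff)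
  finally show ?thesis .
qed

lemma ev_coef_lin:
  assumes "r \<in> carrier R" "keys z \<subseteq> words"
  shows "ev (coef q u) (lin r z) = [(lookup (frag_extend (\<lambda>w. word_op G w (frag_of q)) z) u)] \<cdot> r"
  unfolding ev_lin[OF assms] by (simp add: frag_extend_def lookup_sum coef_def)

text \<open>The elements annihilated by all matrix entries in normal columns form an
  \<open>R_ideal\<close> containing the relations, hence containing the generated ideal. This makes
  the action usable over a noncommutative ring without turning it into a module over that
  ring.\<close>

lemma ev_coef_ideal:
  assumes "f \<in> wlpa_ideal" "normal_word G q"
  shows "ev (coef q u) f = \<zero>"
proof -
  interpret F: nonunital_ring "FG" by (rule free_nonunital_ring)
  let ?K = "{f \<in> carrier (FG). \<forall>q u. normal_word G q \<longrightarrow> ev (coef q u) f = \<zero>}"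
  have "additive_subgroup ?K (FG)"
  proof (rule F.additive_subgroupI)
    show "\<zero>\<^bsub>FG\<^esub> \<in> ?K"
      using F.zero_closed by (simp add: ev_def supp_def free_simps)
  next
    fix a b assume ab: "a \<in> ?K" "b \<in> ?K"
    then show "a \<oplus>\<^bsub>FG\<^esub> b \<in> ?K" using F.a_closed by (simp add: ev_add[of a "letters G" b])
  next
    fix a assume "a \<in> ?K"
    then show "\<ominus>\<^bsub>FG\<^esub> a \<in> ?K" using F.a_inv_closed by (simp add: ev_neg[of a "letters G"])
  qed auto
  moreover have "x \<otimes>\<^bsub>FG\<^esub> a \<in> ?K" if x: "x \<in> carrier (FG)" and a: "a \<in> ?K" for x a
  proof -
    have a': "a \<in> carrier (FG)" using a by simp
    have "ev (coef q u) (x \<otimes>\<^bsub>FG\<^esub> a) = \<zero>" if q: "normal_word G q" for q u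
    proof (rule ev_mult_right_0[OF x a'])
      fix p assume "p \<in> supp x"
      \<comment> \<open>All intermediate words for the whole support of \<open>a\<close>; finiteness
        of the support makes this a finite union.\<close>
      let ?W = "\<Union>p'\<in>supp a. keys (word_op G p' (frag_of q))"
      have W: "finite ?W" using a' by (simp add: free_carrier)
      show "ev (\<lambda>p'. coef q u (p @ p')) a = \<zero>"
      proof (rule ev_combination[OF a' W])
        fix w assume "w \<in> ?W"
        show "ev (coef q w) a = \<zero>" using a q by simp
      next
        fix p' assume "p' \<in> supp a"
        then show "coef q u (p @ p') = (\<Sum>w\<in>?W. coef w u p * coef q w p')"
          using coef_append[OF W, of p' q u p] by (auto simp: mult.commute)
      qed
    qed
    then show ?thesis using F.m_closed[OF x a'] by simp
  qed
  moreover have "a \<otimes>\<^bsub>FG\<^esub> x \<in> ?K" if x: "x \<in> carrier (FG)" and a: "a \<in> ?K" for x a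
  proof -
    have a': "a \<in> carrier (FG)" using a by simp
    have "ev (coef q u) (a \<otimes>\<^bsub>FG\<^esub> x) = \<zero>" if q: "normal_word G q" for q u
    proof (rule ev_mult_left_0[OF a' x])
      fix p' assume "p' \<in> supp x"
      then have p': "set p' \<subseteq> letters G" using x by (auto simp: free_carrier)
      let ?W = "keys (word_op G p' (frag_of q))"
      show "ev (\<lambda>p. coef q u (p @ p')) a = \<zero>"
      proof (rule ev_combination[OF a' finite_keys])
        fix w assume "w \<in> ?W"
        \<comment> \<open>Membership in \<open>?K\<close> only concerns normal columns, so it is
          essential that the action preserves normality.\<close>
        then have "normal_word G w" using keys_word_op[OF p', of "frag_of q" w] q by auto
        then show "ev (coef w u) a = \<zero>" using a by simp
      next
        fix p
        show "coef q u (p @ p') = (\<Sum>w\<in>?W. coef q w p' * coef w u p)"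
          by (rule coef_append) auto
      qed
    qed
    then show ?thesis using F.m_closed[OF a' x] by simp
  qed
  moreover have "c \<odot>\<^bsub>FG\<^esub> a \<in> ?K" if "c \<in> carrier R" "a \<in> ?K" for c a
  proof -
    have a: "a \<in> carrier (FG)" using that by blast
    have "ev (coef q u) (c \<odot>\<^bsub>FG\<^esub> a) = \<zero>" if "normal_word G q" for q u
      using ev_scale[OF a, of c] \<open>a \<in> ?K\<close> \<open>c \<in> carrier R\<close> that by simp
    then show ?thesis using free_scale_closed[OF a \<open>c \<in> carrier R\<close>] by blast
  qed
  ultimately have K: "R_ideal R (FG) ?K"
    unfolding R_ideal_def[of R _ ?K] by (intro conjI ballI)
  have "lin \<one> ` int_rels \<subseteq> ?K"
  proof
    fix f assume "f \<in> lin \<one> ` int_rels"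
    then obtain z where z: "z \<in> int_rels" "f = lin \<one> z" by blast
    then show "f \<in> ?K"
      using ev_coef_lin[OF one_closed int_rels_keys[OF z(1)]] int_rels_act[OF z(1)] lin_closed[OF one_closed int_rels_keys[OF z(1)]]
      by simp
  qed
  with K have "wlpa_ideal \<subseteq> ?K" unfolding wlpa_ideal_def rels_lin gen_R_ideal_def by blast
  then show ?thesis using assms by blast
qed

text \<open>Acting on the empty path at its last vertex, a letter meets no redex and yields a single
  word with coefficient 1, so the scalar can be read off.\<close>

lemma letter_not_in_ideal:
  assumes x: "x \<in> letters G" and r: "r \<in> carrier R" and I: "lin r (frag_of [x]) \<in> wlpa_ideal"
  shows "r = \<zero>"
proof -
  let ?q = "[Vertex (last_vertex G x)]"
  have q: "normal_word G ?q" using x src_closed tgt_closed by (cases x) auto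
  have "\<exists>u. word_op G [x] (frag_of ?q) = frag_of u" using x by (cases x) auto
  then obtain u where "word_op G [x] (frag_of ?q) = frag_of u" by blast
  then have "ev (coef ?q u) (lin r (frag_of [x])) = r"
    using ev_coef_lin[OF r, of "frag_of [x]" ?q u] x r by (simp del: word_op.simps)
  then show ?thesis using ev_coef_ideal[OF I q, of u] by simp
qed

lemma nc_domain_wlpa_iff:
  "nc_domain (wlpa R G) \<longleftrightarrow>
    wlpa_ideal \<noteq> carrier (FG) \<and>
    (\<forall>f\<in>carrier (FG). \<forall>g\<in>carrier (FG).
      f \<otimes>\<^bsub>FG\<^esub> g \<in> wlpa_ideal \<longrightarrow> f \<in> wlpa_ideal \<or> g \<in> wlpa_ideal)"
  unfolding wlpa_def wlpa_ideal_def[symmetric]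
  by (rule nonunital_ring.nc_domain_quotient_iff[OF free_nonunital_ring R_idealD(1,2,3)[OF R_ideal_wlpa_ideal]])

lemma zero_in_ideal: "\<zero>\<^bsub>FG\<^esub> \<in> wlpa_ideal"
  using abelian_group.additive_subgroupD(2)[OF free_abelian_group R_idealD(1)[OF R_ideal_wlpa_ideal]] .

lemma int_rel_in_ideal: "z \<in> int_rels \<Longrightarrow> lin \<one> z \<in> wlpa_ideal"
  using rels_in_ideal by blast

section \<open>Necessity\<close>

text \<open>Each obstruction to being a domain is a product of two letters that vanishes, possibly
  after multiplication by scalars; this turns it into a statement about the scalars.\<close>

lemma product_in_ideal:
  assumes dom: "nc_domain (wlpa R G)" and xy: "x \<in> letters G" "y \<in> letters G"
    and rs: "r \<in> carrier R" "s \<in> carrier R"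
    and I: "lin (r \<otimes> s) (frag_of [x, y]) \<in> wlpa_ideal"
  shows "r = \<zero> \<or> s = \<zero>"
proof -
  have "lin r (frag_of [x]) \<otimes>\<^bsub>FG\<^esub> lin s (frag_of [y]) \<in> wlpa_ideal"
    using I lin_mult_frag_of[OF rs, of "[x]" "letters G" "[y]"] xy by simp
  moreover have "lin r (frag_of [x]) \<in> carrier (FG)" "lin s (frag_of [y]) \<in> carrier (FG)"
    using rs xy by (auto intro!: lin_closed)
  ultimately have "lin r (frag_of [x]) \<in> wlpa_ideal \<or> lin s (frag_of [y]) \<in> wlpa_ideal"
    using dom unfolding nc_domain_wlpa_iff by blast
  then show ?thesis using letter_not_in_ideal xy rs by blast
qed

lemma domain_nontrivial:
  assumes "nc_domain (wlpa R G)"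
  shows "\<one> \<noteq> \<zero>" "verts G \<noteq> {}"
proof -
  have "wlpa_ideal \<subseteq> carrier (FG)"
    by (rule abelian_group.additive_subgroupD(1)[OF free_abelian_group R_idealD(1)[OF R_ideal_wlpa_ideal]])
  moreover have "wlpa_ideal \<noteq> carrier (FG)" using assms unfolding nc_domain_wlpa_iff by simp
  ultimately obtain f where f: "f \<in> carrier (FG)" "f \<notin> wlpa_ideal" by blast
  then have "f \<noteq> (\<lambda>w. \<zero>)" using zero_in_ideal by (auto simp: free_simps)
  then obtain w where w: "f w \<noteq> \<zero>" by auto
  have fw: "f w \<in> carrier R" "w \<in> words" using f w by (auto simp: free_carrier supp_def)
  show "\<one> \<noteq> \<zero>"
  proof
    assume "\<one> = \<zero>"
    then have "carrier R = {\<zero>}" by (rule one_zeroD)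
    then show False using w fw(1) by simp
  qed
  show "verts G \<noteq> {}"
  proof
    assume "verts G = {}"
    then have "letters G = {}" using src_closed by (auto simp: letters_def)
    then show False using fw by simp
  qed
qed

lemma domain_rose:
  assumes dom: "nc_domain (wlpa R G)"
  shows "rose G"
proof -
  note nt = domain_nontrivial[OF dom]
  obtain v where v: "v \<in> verts G" using nt by auto
  have "w = v" if w: "w \<in> verts G" for w
  proof (rule ccontr)
    assume "w \<noteq> v"
    have "frag_of [Vertex w, Vertex v] - (if w = v then frag_of [Vertex w] else 0) \<in> int_rels"
      using v w unfolding int_rels_def by blast
    then have "lin \<one> (frag_of [Vertex w, Vertex v]) \<in> wlpa_ideal"
      using int_rel_in_ideal \<open>w \<noteq> v\<close> by fastforce
    then show False using product_in_ideal[OF dom, of "Vertex w" "Vertex v" \<one> \<one>] v w nt by simp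
  qed
  then have "verts G = {v}" using v by blast
  then show ?thesis by (simp add: rose_def)
qed

lemma nonunital_ring_R: "nonunital_ring R"
  by unfold_locales (auto simp: m_assoc l_distr r_distr)

lemma domain_coefficients:
  assumes dom: "nc_domain (wlpa R G)"
  shows "nc_domain R"
proof -
  interpret nonunital_ring R by (rule nonunital_ring_R)
  note nt = domain_nontrivial[OF dom]
  obtain v where v: "v \<in> verts G" using nt by auto
  show ?thesis
  proof unfold_locales
    show "carrier R \<noteq> {\<zero>}" using nt one_closed by force
    fix x y assume xy: "x \<in> carrier R" "y \<in> carrier R" "x \<otimes> y = \<zero>"
    then have "lin (x \<otimes> y) (frag_of [Vertex v, Vertex v]) \<in> wlpa_ideal"
      using zero_in_ideal by (simp add: lin_frag_of free_simps)
    from product_in_ideal[OF dom _ _ xy(1,2) this] show "x = \<zero> \<or> y = \<zero>" using v by simp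
  qed
qed

lemma domain_weight_one:
  assumes dom: "nc_domain (wlpa R G)" and \<alpha>: "\<alpha> \<in> sedges G" "wt G \<alpha> = 1" and \<beta>: "\<beta> \<in> sedges G"
  shows "\<beta> = \<alpha>"
proof (rule ccontr)
  assume ne: "\<beta> \<noteq> \<alpha>"
  let ?f = "\<lambda>i. if i \<le> wt G \<alpha> \<and> i \<le> wt G \<beta> then frag_of [Ghost \<alpha> i, Edge \<beta> i] else 0"
  have \<beta>1: "1 \<le> wt G \<beta>" using wt_pos \<beta> by blast
  have A: "(\<Sum>i\<in>{1..max (wt G \<alpha>) (wt G \<beta>)}. ?f i) - (if \<alpha> = \<beta> then frag_of [Vertex (tgt G \<alpha>)] else 0) \<in> int_rels"
    using \<alpha> \<beta> unfolding int_rels_def by blast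
  have B: "(\<Sum>i\<in>{1..max (wt G \<alpha>) (wt G \<beta>)}. ?f i) = (\<Sum>i\<in>{1}. ?f i)"
    using \<alpha> by (intro sum.mono_neutral_right) auto
  have C: "(\<Sum>i\<in>{1}. ?f i) = frag_of [Ghost \<alpha> 1, Edge \<beta> 1]" using \<alpha> \<beta>1 by simp
  have "frag_of [Ghost \<alpha> 1, Edge \<beta> 1] - (if \<alpha> = \<beta> then frag_of [Vertex (tgt G \<alpha>)] else 0) \<in> int_rels"
    using A unfolding B C .
  then have "frag_of [Ghost \<alpha> 1, Edge \<beta> 1] \<in> int_rels" using ne by auto
  then have "lin \<one> (frag_of [Ghost \<alpha> 1, Edge \<beta> 1]) \<in> wlpa_ideal" by (rule int_rel_in_ideal)
  then show False
    using product_in_ideal[OF dom, of "Ghost \<alpha> 1" "Edge \<beta> 1" \<one> \<one>] \<alpha> \<beta> \<beta>1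
      domain_nontrivial[OF dom] by simp
qed

lemma domain_two_maximal:
  assumes dom: "nc_domain (wlpa R G)" and \<alpha>: "\<alpha> \<in> out G v" "2 \<le> wt G \<alpha>"
    and max: "\<And>\<beta>. \<beta> \<in> out G v \<Longrightarrow> wt G \<beta> \<le> wt G \<alpha>"
  shows "\<exists>\<beta>\<in>out G v. \<beta> \<noteq> \<alpha> \<and> wt G \<beta> = wt G \<alpha>"
proof (rule ccontr)
  assume no: "\<not> ?thesis"
  then have less: "wt G \<beta> < wt G \<alpha>" if "\<beta> \<in> out G v" "\<beta> \<noteq> \<alpha>" for \<beta>
    using that max le_neq_implies_less by blast
  let ?n = "wt G \<alpha>"
  have vwt: "vwt G v = ?n" unfolding vwt_def using finite_out \<alpha> max by (intro Max_eqI) auto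
  have v: "v \<in> verts G" "\<not> sink G v" using \<alpha> src_closed by (auto simp: out_def sink_def)
  let ?f = "\<lambda>\<gamma>. if ?n \<le> wt G \<gamma> \<and> 1 \<le> wt G \<gamma> then frag_of [Edge \<gamma> ?n, Ghost \<gamma> 1] else 0"
  \<comment> \<open>The row relation with indices \<open>?n\<close> and 1: these differ since the
    weight is at least 2, so the vertex is absent, and index \<open>?n\<close> occurs on \<alpha>
    only.\<close>
  have A: "(\<Sum>\<gamma>\<in>out G v. ?f \<gamma>) - (if ?n = 1 then frag_of [Vertex v] else 0) \<in> int_rels"
    using v vwt \<alpha>(2) unfolding int_rels_def
    by (intro UnI1 UnI2 CollectI exI[of _ v] exI[of _ ?n] exI[of _ 1]) auto
  have B: "(\<Sum>\<gamma>\<in>out G v. ?f \<gamma>) = (\<Sum>\<gamma>\<in>{\<alpha>}. ?f \<gamma>)"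
  proof (rule sum.mono_neutral_right)
    show "\<forall>\<gamma>\<in>out G v - {\<alpha>}. ?f \<gamma> = 0" using less by (auto simp: not_le)
  qed (use finite_out \<alpha> in auto)
  have C: "(\<Sum>\<gamma>\<in>{\<alpha>}. ?f \<gamma>) = frag_of [Edge \<alpha> ?n, Ghost \<alpha> 1]" using \<alpha> by simp
  have "frag_of [Edge \<alpha> ?n, Ghost \<alpha> 1] - (if ?n = 1 then frag_of [Vertex v] else 0) \<in> int_rels"
    using A unfolding B C .
  then have "frag_of [Edge \<alpha> ?n, Ghost \<alpha> 1] \<in> int_rels" using \<alpha>(2) by auto
  then have "lin \<one> (frag_of [Edge \<alpha> ?n, Ghost \<alpha> 1]) \<in> wlpa_ideal" by (rule int_rel_in_ideal)
  then show False
    using product_in_ideal[OF dom, of "Edge \<alpha> ?n" "Ghost \<alpha> 1" \<one> \<one>] \<alpha>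
      domain_nontrivial[OF dom] by (simp add: out_def)
qed

lemma domain_graph:
  assumes dom: "nc_domain (wlpa R G)"
  shows "(rose G \<and> unweighted G \<and> finite (sedges G) \<and> card (sedges G) \<le> 1) \<or> LV_rose G"
proof -
  have rose: "rose G" using domain_rose[OF dom] .
  then obtain v where V: "verts G = {v}" by (auto simp: rose_def card_1_singleton_iff)
  have out: "out G v = sedges G" using src_closed V by (auto simp: out_def)
  show ?thesis
  proof (cases "\<exists>\<alpha>\<in>sedges G. wt G \<alpha> = 1")
    case True
    then obtain \<alpha> where \<alpha>: "\<alpha> \<in> sedges G" "wt G \<alpha> = 1" by blast
    then have "sedges G = {\<alpha>}" using domain_weight_one[OF dom \<alpha>] by blast
    then show ?thesis using rose \<alpha> by (simp add: unweighted_def)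
  next
    case False
    show ?thesis
    proof (cases "sedges G = {}")
      case True
      then show ?thesis using rose by (simp add: unweighted_def)
    next
      case ne: False
      have w2: "2 \<le> wt G \<alpha>" if "\<alpha> \<in> sedges G" for \<alpha>
        using False wt_pos[OF that] that by (metis One_nat_def Suc_1 le_antisym not_less_eq_eq)
      let ?s = "special G v"
      have s: "?s \<in> out G v" "\<And>\<beta>. \<beta> \<in> out G v \<Longrightarrow> wt G \<beta> \<le> wt G ?s"
        using special(1,2)[of v] ne out by auto
      then obtain \<beta> where "\<beta> \<in> out G v" "\<beta> \<noteq> ?s" "wt G \<beta> = wt G ?s"
        using domain_two_maximal[OF dom] w2 out by metis
      then have "LV_rose G" unfolding LV_rose_def using rose ne w2 s out by metis
      then show ?thesis ..
    qed
  qed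
qed

section \<open>Normal forms over a rose\<close>

text \<open>Integer congruences modulo the ideal, required for all scalars at once. Reductions of
  words can then be done with integer coefficients and multiplied by the coefficients of a ring
  element afterwards.\<close>

definition int_ideal :: "(('v, 'e) letter list \<Rightarrow>\<^sub>0 int) set" where
  "int_ideal = {z. keys z \<subseteq> words \<and> (\<forall>r\<in>carrier R. lin r z \<in> wlpa_ideal)}"

lemma int_ideal_0: "0 \<in> int_ideal"
  using zero_in_ideal by (simp add: int_ideal_def lin_0[of _ "letters G"])

lemma int_ideal_diff:
  assumes "y \<in> int_ideal" "z \<in> int_ideal"
  shows "y - z \<in> int_ideal"
proof -
  have k: "keys y \<subseteq> words" "keys z \<subseteq> words" using assms by (auto simp: int_ideal_def)
  have "lin r (y - z) \<in> wlpa_ideal" if "r \<in> carrier R" for r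
    unfolding lin_diff[OF that k]
    by (rule abelian_group.additive_subgroupD(5)[OF free_abelian_group R_idealD(1)[OF R_ideal_wlpa_ideal]])
      (use assms that in \<open>auto simp: int_ideal_def\<close>)
  then show ?thesis using keys_words(1)[OF k] by (simp add: int_ideal_def)
qed

lemma int_ideal_add:
  assumes "y \<in> int_ideal" "z \<in> int_ideal"
  shows "y + z \<in> int_ideal"
  using int_ideal_diff[OF assms(1) int_ideal_diff[OF int_ideal_0 assms(2)]] by simp

lemma int_ideal_frag_extend:
  assumes "\<And>u. u \<in> keys z \<Longrightarrow> h u \<in> int_ideal"
  shows "frag_extend h z \<in> int_ideal"
proof -
  have "(\<Sum>i\<in>S. frag_cmul (lookup z i) (h i)) \<in> int_ideal" if "finite S" "S \<subseteq> keys z" for S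
    using that
  proof (induction S rule: finite_induct)
    case (insert i S)
    have "frag_cmul (lookup z i) (h i) \<in> int_ideal"
      by (rule frag_closure_minus_cmul[where P = "\<lambda>x. x \<in> int_ideal"])
        (use int_ideal_0 int_ideal_diff assms insert in auto)
    then show ?case using insert int_ideal_add by simp
  qed (simp add: int_ideal_0)
  then show ?thesis unfolding frag_extend_def by simp
qed

lemma int_ideal_mult_left:
  assumes z: "z \<in> int_ideal" and p: "set p \<subseteq> letters G"
  shows "frag_extend (\<lambda>q. frag_of (p @ q)) z \<in> int_ideal"
proof (cases "p = []")
  case True
  then show ?thesis using z by (simp flip: frag_expansion)
next
  case False
  then have p': "p \<in> words" using p by auto
  have k: "keys z \<subseteq> words" using z by (simp add: int_ideal_def)
  have c: "lin \<one> (frag_of p) \<in> carrier (FG)" using p' by (auto intro: lin_closed)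
  show ?thesis
    using lin_mult_left[OF _ p' k] R_idealD(2)[OF R_ideal_wlpa_ideal c] z
    unfolding int_ideal_def by fastforce
qed

lemma int_ideal_mult_right:
  assumes z: "z \<in> int_ideal" and p: "set p \<subseteq> letters G"
  shows "frag_extend (\<lambda>q. frag_of (q @ p)) z \<in> int_ideal"
proof (cases "p = []")
  case True
  then show ?thesis using z by (simp flip: frag_expansion)
next
  case False
  then have p': "p \<in> words" using p by auto
  have k: "keys z \<subseteq> words" using z by (simp add: int_ideal_def)
  have c: "lin \<one> (frag_of p) \<in> carrier (FG)" using p' by (auto intro: lin_closed)
  show ?thesis
    using lin_mult_right[OF _ p' k] R_idealD(3)[OF R_ideal_wlpa_ideal c] z
    unfolding int_ideal_def by fastforce
qed

lemma int_rels_int_ideal: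
  assumes z: "z \<in> int_rels"
  shows "z \<in> int_ideal"
proof -
  have "lin r z \<in> wlpa_ideal" if r: "r \<in> carrier R" for r
    using R_idealD(4)[OF R_ideal_wlpa_ideal r int_rel_in_ideal[OF z]] r by (simp add: lin_scale[OF one_closed r])
  then show ?thesis using int_rels_keys[OF z] by (simp add: int_ideal_def)
qed

lemma path_rels_int_rels:
  assumes \<alpha>: "\<alpha> \<in> sedges G" and i: "i \<in> {1..wt G \<alpha>}"
    and z: "z \<in> {frag_of [Vertex (src G \<alpha>), Edge \<alpha> i] - frag_of [Edge \<alpha> i],
        frag_of [Edge \<alpha> i, Vertex (tgt G \<alpha>)] - frag_of [Edge \<alpha> i],
        frag_of [Vertex (tgt G \<alpha>), Ghost \<alpha> i] - frag_of [Ghost \<alpha> i],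
        frag_of [Ghost \<alpha> i, Vertex (src G \<alpha>)] - frag_of [Ghost \<alpha> i]}"
  shows "z \<in> int_rels"
  unfolding int_rels_def
  by (rule UnI1, rule UnI1, rule UnI2, rule UN_I[OF \<alpha>], rule UN_I[OF i], rule z)

lemma path_int_ideal:
  assumes "x \<in> letters G"
  shows "frag_of [Vertex (first_vertex G [x]), x] - frag_of [x] \<in> int_ideal"
    "frag_of [x, Vertex (last_vertex G x)] - frag_of [x] \<in> int_ideal"
proof -
  have "frag_of [Vertex (first_vertex G [x]), x] - frag_of [x] \<in> int_rels \<and>
    frag_of [x, Vertex (last_vertex G x)] - frag_of [x] \<in> int_rels"
  proof (cases x)
    case (Vertex v)
    then have "v \<in> verts G" using assms by simp
    then have "frag_of [Vertex v, Vertex v] - (if v = v then frag_of [Vertex v] else 0) \<in> int_rels"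
      unfolding int_rels_def by blast
    then show ?thesis using Vertex by simp
  next
    case (Edge \<alpha> i)
    then have "\<alpha> \<in> sedges G" "i \<in> {1..wt G \<alpha>}" using assms by auto
    from path_rels_int_rels[OF this] show ?thesis unfolding Edge first_vertex.simps last_vertex.simps by simp
  next
    case (Ghost \<alpha> i)
    then have "\<alpha> \<in> sedges G" "i \<in> {1..wt G \<alpha>}" using assms by auto
    from path_rels_int_rels[OF this] show ?thesis unfolding Ghost first_vertex.simps last_vertex.simps by simp
  qed
  then show "frag_of [Vertex (first_vertex G [x]), x] - frag_of [x] \<in> int_ideal"
    "frag_of [x, Vertex (last_vertex G x)] - frag_of [x] \<in> int_ideal" using int_rels_int_ideal by auto
qed

section \<open>Reduction of words modulo the ideal\<close>

lemma vertex_left_int_ideal: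
  assumes u: "normal_word G u"
  shows "frag_of (Vertex (first_vertex G u) # u) - frag_of u \<in> int_ideal"
proof -
  obtain x u' where xu: "u = x # u'" using u by (cases u) auto
  have l: "x \<in> letters G" "set u' \<subseteq> letters G" using normal_letters[OF u] xu by auto
  have "first_vertex G u = first_vertex G [x]" using xu by (cases x) auto
  then show ?thesis
    using int_ideal_mult_right[OF path_int_ideal(1)[OF l(1)] l(2)] xu by (simp add: frag_extend_diff)
qed

text \<open>The rewriting step is a defining relation multiplied on the right by the rest
  \<open>r\<close> of the word. Over a rose all letters are composable, so \<open>letter_op\<close>
  never vanishes because of mismatched vertices.\<close>

lemma letter_op_int_ideal:
  assumes V: "verts G = {v}" and u: "normal_word G u" and x: "x \<in> letters G"
  shows "frag_of (x # u) - letter_op G x u \<in> int_ideal"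
proof -
  have fu: "first_vertex G u = v" by (rule first_vertex_rose[OF V u])
  have lx: "last_vertex G x = v" by (rule last_vertex_rose[OF V x])
  show ?thesis
  proof (cases x)
    case (Vertex w)
    then show ?thesis using vertex_left_int_ideal[OF u] fu lx by simp
  next
    case (Edge \<alpha> i)
    show ?thesis
    proof (cases "redex G x u")
      case False
      then show ?thesis using Edge fu lx x int_ideal_0 by simp
    next
      case True
      then obtain j r where r: "u = Ghost \<alpha> j # r" "\<alpha> = special G (src G \<alpha>)"
        unfolding Edge by (blast elim: redex_EdgeE)
      have \<alpha>: "\<alpha> \<in> sedges G" "1 \<le> i" "i \<le> wt G \<alpha>" "1 \<le> j" "j \<le> wt G \<alpha>" "normal_word G r"
        using x u Edge r by auto
      have sv: "src G \<alpha> = v" using \<alpha> src_closed V by auto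
      have \<alpha>_out: "\<alpha> \<in> out G v" using \<alpha> sv by (simp add: out_def)
      have vw: "vwt G v = wt G \<alpha>" using special(3)[of v] \<alpha>_out r(2) sv by force
      have rl: "set r \<subseteq> letters G" using normal_letters[OF \<alpha>(6)] .
      let ?f = "\<lambda>\<gamma>. if i \<le> wt G \<gamma> \<and> j \<le> wt G \<gamma> then frag_of [Edge \<gamma> i, Ghost \<gamma> j] else 0"
      let ?g = "\<lambda>\<gamma>. if i \<le> wt G \<gamma> \<and> j \<le> wt G \<gamma> then frag_of (Edge \<gamma> i # Ghost \<gamma> j # r) else 0"
      have "(\<Sum>\<gamma>\<in>out G v. ?f \<gamma>) - (if i = j then frag_of [Vertex v] else 0) \<in> int_rels"
        using V \<alpha> \<alpha>_out vw unfolding int_rels_def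
        by (intro UnI1 UnI2 CollectI exI[of _ v] exI[of _ i] exI[of _ j]) (auto simp: sink_def)
      from int_ideal_mult_right[OF int_rels_int_ideal[OF this] rl]
      have 1: "(\<Sum>\<gamma>\<in>out G v. ?g \<gamma>) - (if i = j then frag_of (Vertex v # r) else 0) \<in> int_ideal"
        by (simp add: frag_extend_diff frag_extend_sum'[OF finite_out] frag_extend_if cong: if_cong split del: if_split)
      \<comment> \<open>The vertex from the right-hand side of the relation ends up in front of
        \<open>r\<close> and has to be absorbed.\<close>
      have 2: "(if i = j then frag_of (Vertex v # r) - frag_of r else 0) \<in> int_ideal"
        using vertex_left_int_ideal[OF \<alpha>(6)] first_vertex_rose[OF V \<alpha>(6)] int_ideal_0 by simp
      have "(\<Sum>\<gamma>\<in>out G v. ?g \<gamma>) = frag_of (x # u) + (\<Sum>\<gamma>\<in>out G v - {\<alpha>}. ?g \<gamma>)"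
        using \<alpha> r Edge by (simp add: sum.remove[OF finite_out \<alpha>_out])
      moreover have "letter_op G x u = (if i = j then frag_of r else 0) - (\<Sum>\<gamma>\<in>out G v - {\<alpha>}. ?g \<gamma>)"
        using True Edge fu lx \<alpha> r sv by simp
      ultimately have "frag_of (x # u) - letter_op G x u =
        ((\<Sum>\<gamma>\<in>out G v. ?g \<gamma>) - (if i = j then frag_of (Vertex v # r) else 0)) +
        (if i = j then frag_of (Vertex v # r) - frag_of r else 0)"
        by (auto simp: algebra_simps)
      then show ?thesis using int_ideal_add[OF 1 2] by simp
    qed
  next
    case (Ghost \<alpha> i)
    show ?thesis
    proof (cases "redex G x u")
      case False
      then show ?thesis using Ghost fu lx x int_ideal_0 by simp
    next
      case True
      then obtain \<beta> r where r: "u = Edge \<beta> 1 # r" "i = 1"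
        unfolding Ghost by (blast elim: redex_GhostE)
      have \<alpha>: "\<alpha> \<in> sedges G" "1 \<le> wt G \<alpha>" "\<beta> \<in> sedges G" "1 \<le> wt G \<beta>" "normal_word G r"
        using x u Ghost r by auto
      have tv: "tgt G \<alpha> = v" "tgt G \<beta> = v" using \<alpha> tgt_closed V by auto
      have rl: "set r \<subseteq> letters G" using normal_letters[OF \<alpha>(5)] .
      let ?M = "{1..max (wt G \<alpha>) (wt G \<beta>)}"
      let ?f = "\<lambda>k. if k \<le> wt G \<alpha> \<and> k \<le> wt G \<beta> then frag_of [Ghost \<alpha> k, Edge \<beta> k] else 0"
      let ?g = "\<lambda>k. if k \<le> wt G \<alpha> \<and> k \<le> wt G \<beta> then frag_of (Ghost \<alpha> k # Edge \<beta> k # r) else 0"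
      have "(\<Sum>k\<in>?M. ?f k) - (if \<alpha> = \<beta> then frag_of [Vertex (tgt G \<alpha>)] else 0) \<in> int_rels"
        using \<alpha> unfolding int_rels_def by blast
      from int_ideal_mult_right[OF int_rels_int_ideal[OF this] rl]
      have 1: "(\<Sum>k\<in>?M. ?g k) - (if \<alpha> = \<beta> then frag_of (Vertex v # r) else 0) \<in> int_ideal"
        by (simp add: frag_extend_diff frag_extend_sum'[OF finite_atLeastAtMost] frag_extend_if tv cong: if_cong split del: if_split)
      have 2: "(if \<alpha> = \<beta> then frag_of (Vertex v # r) - frag_of r else 0) \<in> int_ideal"
        using vertex_left_int_ideal[OF \<alpha>(5)] first_vertex_rose[OF V \<alpha>(5)] int_ideal_0 by simp
      have "(\<Sum>k\<in>?M. ?g k) = ?g 1 + (\<Sum>k\<in>{Suc 1..max (wt G \<alpha>) (wt G \<beta>)}. ?g k)"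
        by (rule sum.atLeast_Suc_atMost) (use \<alpha> in simp)
      \<comment> \<open>Indices beyond the smaller weight contribute zero, which brings the sum to
        the form used in \<open>letter_op\<close>.\<close>
      also have "(\<Sum>k\<in>{Suc 1..max (wt G \<alpha>) (wt G \<beta>)}. ?g k) =
          (\<Sum>k\<in>{2..min (wt G \<alpha>) (wt G \<beta>)}. frag_of (Ghost \<alpha> k # Edge \<beta> k # r))"
        by (intro sum.mono_neutral_cong_right) auto
      also have "?g 1 = frag_of (x # u)" using \<alpha> r Ghost by simp
      finally have 3: "(\<Sum>k\<in>?M. ?g k) = frag_of (x # u) +
          (\<Sum>k\<in>{2..min (wt G \<alpha>) (wt G \<beta>)}. frag_of (Ghost \<alpha> k # Edge \<beta> k # r))" .
      have "letter_op G x u = (if \<alpha> = \<beta> then frag_of r else 0) -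
          (\<Sum>k\<in>{2..min (wt G \<alpha>) (wt G \<beta>)}. frag_of (Ghost \<alpha> k # Edge \<beta> k # r))"
        using True Ghost fu lx \<alpha> r by simp
      with 3 have "frag_of (x # u) - letter_op G x u =
        ((\<Sum>k\<in>?M. ?g k) - (if \<alpha> = \<beta> then frag_of (Vertex v # r) else 0)) +
        (if \<alpha> = \<beta> then frag_of (Vertex v # r) - frag_of r else 0)"
        by (auto simp: algebra_simps)
      then show ?thesis using int_ideal_add[OF 1 2] by simp
    qed
  qed
qed

text \<open>Appending the vertex does not change a word modulo the ideal, and acting on the empty
  path reduces it letter by letter from the right.\<close>

lemma word_op_int_ideal:
  assumes V: "verts G = {v}" and p: "p \<in> words"
  shows "frag_of p - word_op G p (frag_of [Vertex v]) \<in> int_ideal"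
proof -
  have nV: "normal_word G [Vertex v]" using V by simp
  have main: "frag_of (p @ [Vertex v]) - word_op G p (frag_of [Vertex v]) \<in> int_ideal" if "set p \<subseteq> letters G" for p
    using that
  proof (induction p)
    case Nil
    then show ?case by (simp add: int_ideal_0)
  next
    case (Cons x p)
    let ?z = "word_op G p (frag_of [Vertex v])"
    have x: "x \<in> letters G" and p: "set p \<subseteq> letters G" using Cons.prems by auto
    have "frag_extend (\<lambda>q. frag_of ([x] @ q)) (frag_of (p @ [Vertex v]) - ?z) \<in> int_ideal"
      using Cons.IH[OF p] x by (intro int_ideal_mult_left) auto
    then have 1: "frag_of (x # p @ [Vertex v]) - frag_extend (\<lambda>q. frag_of (x # q)) ?z \<in> int_ideal"
      by (simp add: frag_extend_diff)
    have "frag_extend (\<lambda>q. frag_of (x # q) - letter_op G x q) ?z \<in> int_ideal"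
    proof (rule int_ideal_frag_extend)
      fix u assume "u \<in> keys ?z"
      then have "normal_word G u" using keys_word_op[OF p, of "frag_of [Vertex v]" u] nV by auto
      then show "frag_of (x # u) - letter_op G x u \<in> int_ideal" by (rule letter_op_int_ideal[OF V _ x])
    qed
    moreover have "frag_extend (\<lambda>q. frag_of (x # q) - letter_op G x q) ?z =
      frag_extend (\<lambda>q. frag_of (x # q)) ?z - frag_extend (letter_op G x) ?z"
      unfolding frag_extend_def sum_subtractf[symmetric]
      by (intro sum.cong refl poly_mapping_eqI) (simp add: lookup_minus algebra_simps)
    ultimately have 2: "frag_extend (\<lambda>q. frag_of (x # q)) ?z - frag_extend (letter_op G x) ?z \<in> int_ideal" by simp
    show ?case using int_ideal_add[OF 1 2] by simp
  qed
  \<comment> \<open>A word is nonempty, so its last letter can absorb the appended vertex.\<close>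
  obtain p' y where py: "p = p' @ [y]" using p by (cases p rule: rev_cases) auto
  have l: "set p' \<subseteq> letters G" "y \<in> letters G" using p py by auto
  have "frag_of (p @ [Vertex v]) - frag_of p \<in> int_ideal"
    using int_ideal_mult_left[OF path_int_ideal(2)[OF l(2)] l(1)] last_vertex_rose[OF V l(2)] py
    by (simp add: frag_extend_diff)
  moreover have "frag_of (p @ [Vertex v]) - word_op G p (frag_of [Vertex v]) \<in> int_ideal"
    using main p by auto
  ultimately have "(frag_of (p @ [Vertex v]) - word_op G p (frag_of [Vertex v])) -
    (frag_of (p @ [Vertex v]) - frag_of p) \<in> int_ideal" by (rule int_ideal_diff[rotated])
  then show ?thesis by simp
qed

text \<open>The result of letting \<open>f\<close> act on the empty path: the coefficient at
  \<open>u\<close> comes from the matrix entries in that column.\<close>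

definition normal_form :: "'v \<Rightarrow> (('v, 'e) letter list \<Rightarrow> 'a) \<Rightarrow> ('v, 'e) letter list \<Rightarrow> 'a" where
  "normal_form v f = (\<lambda>u. ev (coef [Vertex v] u) f)"

lemma normal_form:
  assumes V: "verts G = {v}" and f: "f \<in> carrier (FG)"
  shows "normal_form v f \<in> carrier (FG)" "w \<in> supp (normal_form v f) \<Longrightarrow> normal_word G w"
    "f \<ominus>\<^bsub>FG\<^esub> normal_form v f \<in> wlpa_ideal"
proof -
  interpret F: nonunital_ring "FG" by (rule free_nonunital_ring)
  have nV: "normal_word G [Vertex v]" using V by simp
  have S: "finite (supp f)" "supp f \<subseteq> words" and c: "\<And>w. f w \<in> carrier R" using f by (auto simp: free_carrier)
  let ?W = "\<Union>p\<in>supp f. keys (word_op G p (frag_of [Vertex v]))"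
  have supp: "supp (normal_form v f) \<subseteq> ?W"
  proof
    fix u assume u: "u \<in> supp (normal_form v f)"
    show "u \<in> ?W"
    proof (rule ccontr)
      assume "u \<notin> ?W"
      then have "ev (coef [Vertex v] u) f = \<zero>"
        unfolding ev_def by (intro add.finprod_one_eqI) (auto simp: coef_def in_keys_iff)
      then show False using u by (simp add: supp_def normal_form_def)
    qed
  qed
  have W: "normal_word G w" if "w \<in> ?W" for w
  proof -
    obtain p where "p \<in> supp f" "w \<in> keys (word_op G p (frag_of [Vertex v]))" using \<open>w \<in> ?W\<close> by blast
    then show ?thesis using keys_word_op[of p "frag_of [Vertex v]" w] nV S by auto
  qed
  show n: "w \<in> supp (normal_form v f) \<Longrightarrow> normal_word G w" for w using supp W by blast
  have "supp (normal_form v f) \<subseteq> words"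
  proof
    fix w assume "w \<in> supp (normal_form v f)"
    then have "normal_word G w" by (rule n)
    then show "w \<in> words" using normal_letters[of w] by (cases w) auto
  qed
  moreover have "finite (supp (normal_form v f))" using finite_subset[OF supp] S by simp
  ultimately show nf: "normal_form v f \<in> carrier (FG)"
    using ev_closed[OF f] by (simp add: free_carrier normal_form_def)
  let ?z = "\<lambda>p. frag_of p - word_op G p (frag_of [Vertex v])"
  have z: "?z p \<in> int_ideal" if "p \<in> supp f" for p using word_op_int_ideal[OF V] that S by blast
  have zc: "lin (f p) (?z p) \<in> wlpa_ideal" "lin (f p) (?z p) \<in> carrier (FG)" if "p \<in> supp f" for p
    using z[OF that] c by (auto simp: int_ideal_def intro: lin_closed)
  have "(\<Oplus>\<^bsub>FG\<^esub>p\<in>A. lin (f p) (?z p)) \<in> wlpa_ideal" if "finite A" "A \<subseteq> supp f" for A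
    using that
  proof (induction A rule: finite_induct)
    case empty
    then show ?case using zero_in_ideal by simp
  next
    case (insert p A)
    then have "(\<Oplus>\<^bsub>FG\<^esub>p\<in>insert p A. lin (f p) (?z p)) =
      lin (f p) (?z p) \<oplus>\<^bsub>FG\<^esub> (\<Oplus>\<^bsub>FG\<^esub>p\<in>A. lin (f p) (?z p))"
      using zc by (intro F.finsum_insert) auto
    then show ?case
      using insert zc F.additive_subgroupD(3)[OF R_idealD(1)[OF R_ideal_wlpa_ideal]] by simp
  qed
  then have "(\<Oplus>\<^bsub>FG\<^esub>p\<in>supp f. lin (f p) (?z p)) \<in> wlpa_ideal" using S by blast
  \<comment> \<open>Summing the congruences of the single words, weighted by the coefficients of
    \<open>f\<close>, gives the difference between \<open>f\<close> and its normal form.\<close>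
  moreover have "(\<Oplus>\<^bsub>FG\<^esub>p\<in>supp f. lin (f p) (?z p)) = f \<ominus>\<^bsub>FG\<^esub> normal_form v f"
  proof
    fix u
    have zm: "[(a - b :: int)] \<cdot> r = [a] \<cdot> r \<oplus> \<ominus> ([b] \<cdot> r)" if "r \<in> carrier R" for a b r
      using zmult_add[OF that, of a "- b"] zmult_neg[OF that, of b] by simp
    have "(\<Oplus>\<^bsub>FG\<^esub>p\<in>supp f. lin (f p) (?z p)) u = (\<Oplus>p\<in>supp f. lin (f p) (?z p) u)"
      using zc S by (intro free_finsum) auto
    also have "\<dots> = (\<Oplus>p\<in>supp f. (if p = u then f p else \<zero>) \<oplus> [(- 1 :: int)] \<cdot> ([(coef [Vertex v] u p)] \<cdot> f p))"
      using c by (intro finsum_cong') (auto simp: lin_def lookup_minus coef_def zm)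
    also have "\<dots> = (\<Oplus>p\<in>supp f. if p = u then f p else \<zero>) \<oplus> (\<Oplus>p\<in>supp f. [(- 1 :: int)] \<cdot> ([(coef [Vertex v] u p)] \<cdot> f p))"
      using c by (intro finsum_addf) auto
    also have "(\<Oplus>p\<in>supp f. [(- 1 :: int)] \<cdot> ([(coef [Vertex v] u p)] \<cdot> f p)) = [(- 1 :: int)] \<cdot> normal_form v f u"
      unfolding normal_form_def ev_def using c S by (intro zmult_finsum[symmetric]) auto
    also have "\<dots> = \<ominus> normal_form v f u" using ev_closed[OF f] by (simp add: normal_form_def)
    also have "(\<Oplus>p\<in>supp f. if p = u then f p else \<zero>) = f u"
    proof (cases "u \<in> supp f")
      case True
      then have "(\<Oplus>p\<in>supp f. if p = u then f p else \<zero>) = (if u = u then f u else \<zero>)"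
        using S c by (intro finsum_single) auto
      then show ?thesis by simp
    next
      case False
      then have "(\<Oplus>p\<in>supp f. if p = u then f p else \<zero>) = \<zero>" by (intro add.finprod_one_eqI) auto
      then show ?thesis using False by (simp add: supp_def)
    qed
    finally show "(\<Oplus>\<^bsub>FG\<^esub>p\<in>supp f. lin (f p) (?z p)) u = (f \<ominus>\<^bsub>FG\<^esub> normal_form v f) u"
      using free_minus[OF f nf] by (simp add: a_minus_def)
  qed
  ultimately show "f \<ominus>\<^bsub>FG\<^esub> normal_form v f \<in> wlpa_ideal" by simp
qed

text \<open>Replacing the factors by their normal forms keeps the product in the ideal, where all
  matrix entries vanish. At the word \<open>u\<close> of the unique product, the only term left is
  the product of two nonzero coefficients, up to sign.\<close>

lemma unique_products_domain:
  assumes V: "verts G = {v}" and UP: "unique_products G" and dom: "nc_domain R"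
  shows "nc_domain (wlpa R G)"
proof -
  interpret F: nonunital_ring "FG" by (rule free_nonunital_ring)
  note ideal = R_idealD[OF R_ideal_wlpa_ideal]
  note sub = F.additive_subgroupD[OF ideal(1)]
  have nV: "normal_word G [Vertex v]" using V by simp
  have one: "\<one> \<noteq> \<zero>"
  proof
    assume "\<one> = \<zero>"
    then have "carrier R = {\<zero>}" by (rule one_zeroD)
    then show False using nc_domain.nonzero[OF dom] by simp
  qed
  have "lin \<one> (frag_of [Vertex v]) \<notin> wlpa_ideal"
    using letter_not_in_ideal[of "Vertex v" \<one>] V one by auto
  moreover have "lin \<one> (frag_of [Vertex v]) \<in> carrier (FG)" using V by (intro lin_closed) auto
  ultimately have proper: "wlpa_ideal \<noteq> carrier (FG)" by blast
  have "f \<in> wlpa_ideal \<or> g \<in> wlpa_ideal"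
    if f: "f \<in> carrier (FG)" and g: "g \<in> carrier (FG)"
      and fg: "f \<otimes>\<^bsub>FG\<^esub> g \<in> wlpa_ideal" for f g
  proof (rule ccontr)
    assume not: "\<not> ?thesis"
    define a where "a = normal_form v f"
    define b where "b = normal_form v g"
    note nf = normal_form[OF V f, folded a_def] and ng = normal_form[OF V g, folded b_def]
    have sum: "h = (h \<ominus>\<^bsub>FG\<^esub> k) \<oplus>\<^bsub>FG\<^esub> k"
      if "h \<in> carrier (FG)" "k \<in> carrier (FG)" for h k
      using that by (simp add: F.minus_eq F.a_assoc F.l_neg)
    have nonzero: "supp a \<noteq> {}" "supp b \<noteq> {}"
    proof -
      have "h \<in> wlpa_ideal"
        if h: "h \<in> carrier (FG)" "k \<in> carrier (FG)" "h \<ominus>\<^bsub>FG\<^esub> k \<in> wlpa_ideal"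
          "supp k = {}" for h k
      proof -
        have "k = \<zero>\<^bsub>FG\<^esub>" using h(4) by (auto simp: supp_def free_simps)
        then show ?thesis using sum[OF h(1,2)] sub(2,3) h(3) by metis
      qed
      then show "supp a \<noteq> {}" "supp b \<noteq> {}" using nf ng f g not by blast+
    qed
    have ag: "a \<otimes>\<^bsub>FG\<^esub> g \<in> wlpa_ideal"
    proof -
      have d: "(f \<ominus>\<^bsub>FG\<^esub> a) \<otimes>\<^bsub>FG\<^esub> g \<in> wlpa_ideal" using ideal(3)[OF g nf(3)] .
      have "f \<otimes>\<^bsub>FG\<^esub> g = (f \<ominus>\<^bsub>FG\<^esub> a) \<otimes>\<^bsub>FG\<^esub> g \<oplus>\<^bsub>FG\<^esub> a \<otimes>\<^bsub>FG\<^esub> g"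
        by (subst sum[OF f nf(1)]) (use f g nf(1) F.minus_closed in \<open>simp add: F.l_distr\<close>)
      then have "a \<otimes>\<^bsub>FG\<^esub> g = f \<otimes>\<^bsub>FG\<^esub> g \<ominus>\<^bsub>FG\<^esub> (f \<ominus>\<^bsub>FG\<^esub> a) \<otimes>\<^bsub>FG\<^esub> g"
        using F.m_closed[OF nf(1) g] F.m_closed[OF F.minus_closed[OF f nf(1)] g]
        by (simp add: F.minus_eq F.a_ac F.r_neg F.r_neg1 F.r_neg2)
      then show ?thesis using sub(5)[OF fg d] by simp
    qed
    have ab: "a \<otimes>\<^bsub>FG\<^esub> b \<in> wlpa_ideal"
    proof -
      have d: "a \<otimes>\<^bsub>FG\<^esub> (g \<ominus>\<^bsub>FG\<^esub> b) \<in> wlpa_ideal" using ideal(2)[OF nf(1) ng(3)] .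
      have "a \<otimes>\<^bsub>FG\<^esub> g = a \<otimes>\<^bsub>FG\<^esub> (g \<ominus>\<^bsub>FG\<^esub> b) \<oplus>\<^bsub>FG\<^esub> a \<otimes>\<^bsub>FG\<^esub> b"
        by (subst sum[OF g ng(1)]) (use ng(1) g nf(1) F.minus_closed in \<open>simp add: F.r_distr\<close>)
      then have "a \<otimes>\<^bsub>FG\<^esub> b = a \<otimes>\<^bsub>FG\<^esub> g \<ominus>\<^bsub>FG\<^esub> a \<otimes>\<^bsub>FG\<^esub> (g \<ominus>\<^bsub>FG\<^esub> b)"
        using F.m_closed[OF nf(1) ng(1)] F.m_closed[OF nf(1) F.minus_closed[OF g ng(1)]]
        by (simp add: F.minus_eq F.a_ac F.r_neg F.r_neg1 F.r_neg2)
      then show ?thesis using sub(5)[OF ag d] by simp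
    qed
    have fin: "finite (supp a)" "finite (supp b)" and c: "\<And>w. a w \<in> carrier R" "\<And>w. b w \<in> carrier R"
      using nf(1) ng(1) by (auto simp: free_carrier)
    have "unique_product G (supp a) (supp b)"
      using UP fin nonzero nf(2) ng(2) unfolding unique_products_def by simp
    then obtain p0 q0 u where p0: "p0 \<in> supp a" and q0: "q0 \<in> supp b"
      and u: "lookup (word_op G p0 (frag_of q0)) u \<in> {1, -1}"
      and uniq': "\<forall>p\<in>supp a. \<forall>q\<in>supp b. lookup (word_op G p (frag_of q)) u \<noteq> 0 \<longrightarrow> p = p0 \<and> q = q0"
      unfolding unique_product_def by (elim bexE exE conjE)
    note uniq = uniq'[rule_format]
    \<comment> \<open>A normal word takes the empty path to itself, so the action of
      \<open>p @ q\<close> on the empty path is the action of \<open>p\<close> on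
      \<open>q\<close>.\<close>
    have coef: "coef [Vertex v] u (p @ q) = lookup (word_op G p (frag_of q)) u" if "q \<in> supp b" for p q
    proof -
      have q: "normal_word G q" using ng(2) that .
      obtain w q' where q': "q = q' @ [Vertex w]" "w \<in> verts G" using normal_snocE[OF q] by metis
      have "word_op G q (frag_of [Vertex v]) = word_op G q' (frag_of [Vertex v])"
        using q' V word_op_last_Vertex[OF V nV, of q'] by simp
      also have "\<dots> = frag_of q" using word_op_normal[of q' "[Vertex v]"] q q' V by simp
      finally show ?thesis by (simp add: coef_def word_op_append)
    qed
    have "\<zero> = ev (coef [Vertex v] u) (a \<otimes>\<^bsub>FG\<^esub> b)" using ev_coef_ideal[OF ab nV] by simp
    also have "\<dots> = (\<Oplus>p\<in>supp a. \<Oplus>q\<in>supp b. [(coef [Vertex v] u (p @ q))] \<cdot> (a p \<otimes> b q))"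
      by (rule ev_mult[OF nf(1) ng(1)])
    also have "\<dots> = (\<Oplus>q\<in>supp b. [(coef [Vertex v] u (p0 @ q))] \<cdot> (a p0 \<otimes> b q))"
    proof (rule finsum_single[OF fin(1) p0])
      fix p assume p: "p \<in> supp a" "p \<noteq> p0"
      show "(\<Oplus>q\<in>supp b. [(coef [Vertex v] u (p @ q))] \<cdot> (a p \<otimes> b q)) = \<zero>"
      proof (rule add.finprod_one_eqI)
        fix q assume q: "q \<in> supp b"
        have "coef [Vertex v] u (p @ q) = 0" using coef[OF q] uniq[OF p(1) q] p(2) by metis
        then show "[(coef [Vertex v] u (p @ q))] \<cdot> (a p \<otimes> b q) = \<zero>" by simp
      qed
    qed (use c in \<open>auto intro!: finsum_closed\<close>)
    also have "\<dots> = [(coef [Vertex v] u (p0 @ q0))] \<cdot> (a p0 \<otimes> b q0)"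
    proof (rule finsum_single[OF fin(2) q0])
      fix q assume q: "q \<in> supp b" "q \<noteq> q0"
      have "coef [Vertex v] u (p0 @ q) = 0" using coef[OF q(1)] uniq[OF p0 q(1)] q(2) by metis
      then show "[(coef [Vertex v] u (p0 @ q))] \<cdot> (a p0 \<otimes> b q) = \<zero>" by simp
    qed (use c in auto)
    finally have "[(coef [Vertex v] u (p0 @ q0))] \<cdot> (a p0 \<otimes> b q0) = \<zero>" by simp
    moreover have "coef [Vertex v] u (p0 @ q0) \<in> {1, -1}" using u coef[OF q0] by simp
    ultimately have "a p0 \<otimes> b q0 = \<zero>" using c by auto
    then have "a p0 = \<zero> \<or> b q0 = \<zero>" using nc_domain.no_zero_divisors[OF dom] c by blast
    then show False using p0 q0 by (simp add: supp_def)
  qed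
  then show ?thesis unfolding nc_domain_wlpa_iff using proper by blast
qed

end

theorem theorem41:
  fixes G :: "('v, 'e, 'n) wgraph_scheme" and R :: "('a, 'm) ring_scheme"
  assumes "weighted_graph G" and "ring R"
  shows "nc_domain (wlpa R G) \<longleftrightarrow>
    nc_domain R \<and>
    ((rose G \<and> unweighted G \<and> finite (sedges G) \<and> card (sedges G) \<le> 1) \<or> LV_rose G)"
proof -
  interpret graph_ring R G using assms by (simp add: graph_ring_def)
  show ?thesis
  proof
    assume "nc_domain (wlpa R G)"
    then show "nc_domain R \<and>
      ((rose G \<and> unweighted G \<and> finite (sedges G) \<and> card (sedges G) \<le> 1) \<or> LV_rose G)"
      using domain_coefficients domain_graph by blast
  next
    assume *: "nc_domain R \<and>
      ((rose G \<and> unweighted G \<and> finite (sedges G) \<and> card (sedges G) \<le> 1) \<or> LV_rose G)"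
    then have "rose G" by (auto simp: LV_rose_def)
    then obtain v where V: "verts G = {v}" by (auto simp: rose_def card_1_singleton_iff)
    have "unique_products G"
      using *
    proof (elim conjE disjE)
      assume "unweighted G" "finite (sedges G)" "card (sedges G) \<le> 1"
      \<comment> \<open>Finiteness rules out an infinite set of edges, for which \<open>card\<close>
        would be 0 as well.\<close>
      then consider "sedges G = {}" | \<alpha> where "sedges G = {\<alpha>}" "wt G \<alpha> = 1"
        by (metis card_1_singletonE card_0_eq insertI1 le_less less_one unweighted_def)
      then show ?thesis
        using edgeless_unique_products[OF V] single_loop_unique_products[OF V] by cases auto
    qed (rule LV_unique_products)
    then show "nc_domain (wlpa R G)" using unique_products_domain V * by blast
  qed
qed

end
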